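(* Let $n\ge 1$, let $x_1,\ldots,x_n\in\mathbb{R}$ be distinct, let $t_1,\ldots,t_n\in\mathbb{R}$ be distinct, and let $x\in\mathbb{R}$. Put $X=\operatorname{diag}(x_1,\ldots,x_n)$, $T=\operatorname{diag}(t_1,\ldots,t_n)$, $\widetilde X=\operatorname{diag}(x,x_1,\ldots,x_n)$, and let $\operatorname{conv}(\widetilde X)\subset\mathbb{R}$ be the convex hull of the points $x,x_1,\ldots,x_n$. Then for any $f\in C^n(\operatorname{conv}(\widetilde X))$, $$f(x)-I^{\mathrm e}_{\{x_k,t_k\}_{k=1}^n}f(x)=\frac{\prod_{k=1}^n(x-x_k)}{n!\,Z_{\{x_k,t_k\}_{k=1}^n}}\int_{S^{2n+1}}\int_{\mathbb{U}(n)}e^{\operatorname{tr}(TU^\dagger P_{\mathbf v}^\dagger\widetilde XP_{\mathbf v}U)}\Big[\prod_{k=1}^n\Big(\frac{d}{dq}-t_k\Big)\Big]f(q)\Big|_{q=\mathbf v^\dagger\widetilde X\mathbf v}\,d\mathbf v\,dU .$$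
   Context: Exponential interpolation: for distinct nodes $x_1,\ldots,x_n\in\mathbb{R}$ and distinct $t_1,\ldots,t_n\in\mathbb{R}$, $I^{\mathrm e}_{\{x_k,t_k\}_{k=1}^n}f$ is the unique function of the form $y\mapsto\sum_{k=1}^n c_k e^{t_k y}$ that agrees with $f$ at $x_1,\ldots,x_n$ (the matrix $(e^{t_kx_m})_{k,m=1}^n$ is invertible). Notation: $^\dagger$ denotes the Hermitian conjugate. $\mathbb{U}(n)$ is the group of unitary $n\times n$ matrices, and $dU$ is its Haar measure, normalized to total mass $1$. $Z_{\{x_k,t_k\}_{k=1}^n}=\int_{\mathbb{U}(n)}e^{\operatorname{tr}(TU^\dagger XU)}dU>0$. $\int_{S^{2n+1}}\cdot\,d\mathbf v$ denotes integration over the normalized (total mass $1$) Lebesgue measure on the unit sphere $S^{2n+1}=\{\mathbf v:|\mathbf v|=1\}$ in $\mathbb{C}^{n+1}$. For $\mathbf v\in S^{2n+1}$, $P_{\mathbf v}:\mathbb{C}^n\to\mathbb{C}^{n+1}$ is any linear isometry of $\mathbb{C}^n$ onto the orthogonal complement of $\mathbf v$ in $\mathbb{C}^{n+1}$, chosen to depend measurably on $\mathbf v$. The product $\prod_k(\frac{d}{dq}-t_k)$ is a composition of differential operators applied to $f$, and the result is evaluated at the real number $q=\mathbf v^\dagger\widetilde X\mathbf v\in\operatorname{conv}(\widetilde X)$. *)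

theory Defs
  imports "HOL-Probability.Probability"
begin

definition herm_conj :: "complex^'n^'m \<Rightarrow> complex^'m^'n" where
  "herm_conj A = (\<chi> i j. cnj (A $ j $ i))"

definition herm_form :: "complex^'n \<Rightarrow> complex^'n \<Rightarrow> complex" where
  "herm_form v w = (\<Sum>i\<in>UNIV. cnj (v $ i) * w $ i)"

definition real_diag :: "('n \<Rightarrow> real) \<Rightarrow> complex^'n^'n" where
  "real_diag d = (\<chi> i j. if i = j then complex_of_real (d i) else 0)"

definition unitary_group :: "(complex^'n^'n) set" where
  "unitary_group = {U. herm_conj U ** U = mat 1 \<and> U ** herm_conj U = mat 1}"

text \<open>
  On a compact group the normalized left Haar measure is unique and bi-invariant, so this predicate
  determines \<open>\<mu>\<close>. The measure lives on the unitary group itself (not on the ambient matrix space).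
\<close>

definition unitary_haar :: "(complex^'n^'n) measure \<Rightarrow> bool" where
  "unitary_haar \<mu> \<longleftrightarrow>
     prob_space \<mu> \<and>
     space \<mu> = unitary_group \<and>
     sets \<mu> = sets (restrict_space borel unitary_group) \<and>
     (\<forall>V\<in>unitary_group. distr \<mu> \<mu> (\<lambda>U. V ** U) = \<mu>)"

text \<open>
  Normalized surface measure: the mass of \<open>A\<close> is the fraction of the volume of the unit ball
  occupied by the cone over \<open>A\<close>. The function \<^const>\<open>sgn\<close> is the radial projection.
\<close>

definition sphere_measure :: "'a::euclidean_space measure" where
  "sphere_measure =
     restrict_space (distr (uniform_measure lborel (cball 0 1)) borel sgn) (sphere 0 1)"

definition isometry_onto_compl :: "complex^'m \<Rightarrow> complex^'n^'m \<Rightarrow> bool" where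
  "isometry_onto_compl v P \<longleftrightarrow>
     (\<forall>w. norm (P *v w) = norm w) \<and> range ((*v) P) = {u. herm_form v u = 0}"

text \<open>The partition function; it is a positive real number, considered as a complex number.\<close>

definition Z_unitary ::
    "(complex^'n^'n) measure \<Rightarrow> ('n \<Rightarrow> real) \<Rightarrow> ('n \<Rightarrow> real) \<Rightarrow> complex" where
  "Z_unitary \<mu> x t =
     (LINT U|\<mu>. exp (trace (real_diag t ** herm_conj U ** real_diag x ** U)))"

definition exp_interpolant ::
    "('n::finite \<Rightarrow> real) \<Rightarrow> ('n \<Rightarrow> real) \<Rightarrow> (real \<Rightarrow> complex) \<Rightarrow> real \<Rightarrow> complex" where
  "exp_interpolant x t f =
     (THE g. (\<exists>c. g = (\<lambda>y. \<Sum>k\<in>UNIV. c k * exp (complex_of_real (t k * y)))) \<and>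
             (\<forall>m. g (x m) = f (x m)))"

text \<open>
  Derivatives are taken within \<open>S\<close>, hence one-sided at the endpoints of an interval. On a
  one-point set every function is of class \<open>C\<^sup>k\<close> and the derivative is an unspecified value.
\<close>

primrec Ck_on :: "nat \<Rightarrow> real set \<Rightarrow> (real \<Rightarrow> complex) \<Rightarrow> bool" where
  "Ck_on 0 S f \<longleftrightarrow> continuous_on S f"
| "Ck_on (Suc k) S f \<longleftrightarrow>
     f differentiable_on S \<and> Ck_on k S (\<lambda>y. vector_derivative f (at y within S))"

text \<open>\<open>diff_ops S [t\<^sub>1, \<dots>, t\<^sub>n] f = (d/dq - t\<^sub>1) (\<dots> ((d/dq - t\<^sub>n) f) \<dots>)\<close> on \<open>S\<close>.\<close>

primrec diff_ops :: "real set \<Rightarrow> real list \<Rightarrow> (real \<Rightarrow> complex) \<Rightarrow> real \<Rightarrow> complex" where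
  "diff_ops S [] f = f"
| "diff_ops S (t # ts) f =
     (\<lambda>q. vector_derivative (diff_ops S ts f) (at q within S)
          - complex_of_real t * diff_ops S ts f q)"

end

(* Write tr (T U^* X U) = sum x_a t_k |U_ak|^2. Gluing v to the columns of P_v U gives a matrix W in
   U(n+1), and W is Haar distributed when v and U are. Hence for f(q) = e^(sq) the double integral is the
   partition function Z' of (x, x_1, ..., x_n) and (s, t_1, ..., t_n) on U(n+1).

   The essential point is that F(h) = prod_k (h - x_k) Z'(h, x_1, ..., x_n) is an exponential sum in h with
   the exponents s, t_1, ..., t_n. Invariance under rotations in coordinate planes yields a first-order
   system of differential equations in the x_a for the expectations of |U_aj|^2 e^(tr ...), and together
   with the Vandermonde determinant D it implies prod_j (z - d/dx_j) (D Z') = prod_j (z - t_j) D Z', from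
   which the dependence on a single variable can be solved.

   Since F vanishes at the nodes, F(h) = c (e^(sh) - I(e^(s.))(h)) with I the interpolation operator. For s
   larger than all t_k, Laplace's method as h tends to infinity gives c = n! Z / prod_k (s - t_k), which is
   the theorem for f(q) = e^(sq).

   For general f the image of f under prod_k (d/dq - t_k) is approximated uniformly by sums of exponentials
   with exponents larger than all t_k (Weierstrass in the variable e^q). Both sides of the claimed equality
   are controlled by the supremum of that image. *)
theory Submission
  imports Defs "HOL-Computational_Algebra.Polynomial" "HOL-Real_Asymp.Real_Asymp"
begin

section \<open>Partial fractions\<close>

text \<open>The determinantal formula of Harish-Chandra, Itzykson and Zuber for Z' would show at
  once that F is an exponential sum. It is avoided: only the dependence on one variable h = x_a
  matters. At z = t_j the right side of the operator equation vanishes, so the product of z - d/dx_i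
  over the other i, applied to D Z', is there a multiple of e^(t_j h). This polynomial in z has
  degree n and leading coefficient D Z', so its values at the n + 1 exponents determine D Z'. For
  the operator equation, an expectation of resolvent entries and an alternating sum of partial
  symbols are shown to solve one first-order system. Its coefficients 1/(x_i - x_c) are the reason
  for the partial fractions; the factor D enters because its logarithmic derivative cancels the
  diagonal terms. The Haar measure on U(n+1) is no further hypothesis: it is built from the sphere
  and \<open>\<mu>\<close>. The n! is (n+1)!/pi^(n+1), the inverse volume of the unit ball of
  C^(n+1), times pi^n from a Gaussian integral and pi/(n+1) from a disc.\<close>

definition pfrac :: "('m \<Rightarrow> real) \<Rightarrow> 'm \<Rightarrow> 'm set \<Rightarrow> real" where
  "pfrac x i S = (\<Prod>j\<in>S. inverse (x i - x j))"

lemma pfrac_empty [simp]: "pfrac x i {} = 1"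
  by (simp add: pfrac_def)

text \<open>The right side is a rational function of \<open>w\<close> with simple poles, and the
  left side collects its residues. The induction uses the hypothesis both at \<open>w\<close> and at
  the new node \<open>x r\<close>, hence \<open>w\<close> is arbitrary.\<close>

lemma partial_fractions:
  assumes "finite R" "R \<noteq> {}" "inj_on x R" "w \<notin> x ` R"
  shows "(\<Sum>l\<in>R. inverse (w - x l) * pfrac x l (R - {l})) = (\<Prod>j\<in>R. inverse (w - x j))"
  using assms
proof (induction R arbitrary: w rule: finite_ne_induct)
  case (singleton r)
  then show ?case by simp
next
  case (insert r R)
  let ?P = "\<lambda>w. \<Prod>j\<in>R. inverse (w - x j)"
  have IH: "(\<Sum>l\<in>R. inverse (v - x l) * pfrac x l (R - {l})) = ?P v" if "v \<notin> x ` R" for v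
    using insert that by (auto simp: inj_on_def)
  have r: "x r \<notin> x ` R"
    using insert by (auto simp: inj_on_def)
  have split: "inverse (w - x l) * pfrac x l (insert r R - {l}) =
      inverse (w - x r) * (inverse (w - x l) * pfrac x l (R - {l})
        - inverse (x r - x l) * pfrac x l (R - {l}))" if "l \<in> R" for l
  proof -
    have "insert r R - {l} = insert r (R - {l})" "r \<notin> R - {l}"
      using that insert by auto
    then have 1: "pfrac x l (insert r R - {l}) = inverse (x l - x r) * pfrac x l (R - {l})"
      using \<open>finite R\<close> by (simp add: pfrac_def)
    have "w \<noteq> x l" "w \<noteq> x r"
      using insert.prems that by auto
    moreover have "x l \<noteq> x r"
      using that r by (metis imageI)
    ultimately
    have "inverse (w - x l) * inverse (x l - x r)
        = inverse (w - x r) * (inverse (w - x l) - inverse (x r - x l))"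
      by (simp add: divide_simps) (simp add: algebra_simps)
    then show ?thesis
      unfolding 1 by algebra
  qed
  have rr: "insert r R - {r} = R"
    using insert by auto
  have "(\<Sum>l\<in>insert r R. inverse (w - x l) * pfrac x l (insert r R - {l})) =
     inverse (w - x r) * ?P (x r) +
     (\<Sum>l\<in>R. inverse (w - x r) * (inverse (w - x l) * pfrac x l (R - {l})
        - inverse (x r - x l) * pfrac x l (R - {l})))"
    using insert.hyps by (simp add: split rr) (simp add: pfrac_def)
  also have "\<dots> = inverse (w - x r) * ?P (x r) + inverse (w - x r) * (?P w - ?P (x r))"
    using insert.prems r by (simp add: sum_distrib_left [symmetric] sum_subtractf IH)
  finally show ?case
    using insert.hyps by (simp add: algebra_simps)
qed

text \<open>This is the divided difference of the constant 1. With one node \<open>w\<close> split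
  off, it becomes \<open>partial_fractions\<close> for the remaining nodes, evaluated at
  \<open>x w\<close>.\<close>

lemma partial_fractions_sum_0:
  assumes "finite R" "card R \<noteq> 1" "inj_on x R"
  shows "(\<Sum>i\<in>R. pfrac x i (R - {i})) = 0"
proof (cases "R = {}")
  case False
  then obtain w R' where R: "R = insert w R'" "w \<notin> R'" "finite R'" "R' \<noteq> {}"
  proof -
    from False obtain w where "w \<in> R" by auto
    moreover from this have "R - {w} \<noteq> {}"
      using assms(2) by (metis card_1_singleton_iff One_nat_def insert_Diff)
    ultimately show thesis
      using assms(1) by (intro that[of w "R - {w}"]) auto
  qed
  then have w: "x w \<notin> x ` R'" "inj_on x R'"
    using assms by auto
  have split: "pfrac x i (R - {i}) = - (inverse (x w - x i) * pfrac x i (R' - {i}))" if "i \<in> R'" for i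
  proof -
    have "R - {i} = insert w (R' - {i})" using R that by auto
    then have "pfrac x i (R - {i}) = inverse (x i - x w) * pfrac x i (R' - {i})"
      using R that by (simp add: pfrac_def)
    also have "inverse (x i - x w) = - inverse (x w - x i)"
      by (simp flip: inverse_minus_eq)
    finally show ?thesis by simp
  qed
  have "R - {w} = R'" using R by auto
  then have "(\<Sum>i\<in>R. pfrac x i (R - {i})) = pfrac x w R' + (\<Sum>i\<in>R'. pfrac x i (R - {i}))"
    using R by simp
  also have "\<dots> = 0"
    using partial_fractions[OF R(3,4) w(2,1)] by (simp add: split sum_negf) (simp add: pfrac_def)
  finally show ?thesis .
qed simp

lemma prod_inverse_has_derivative:
  fixes x :: "'m \<Rightarrow> real"
  assumes "finite S" "w \<notin> x ` S"
  shows "((\<lambda>h. \<Prod>j\<in>S. inverse (h - x j)) has_real_derivative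
     - (\<Prod>j\<in>S. inverse (w - x j)) * (\<Sum>j\<in>S. inverse (w - x j))) (at w)"
  using assms
proof (induction S)
  case (insert r S)
  then have "w \<noteq> x r" by auto
  have IH: "((\<lambda>h. \<Prod>j\<in>S. inverse (h - x j)) has_real_derivative
     - (\<Prod>j\<in>S. inverse (w - x j)) * (\<Sum>j\<in>S. inverse (w - x j))) (at w)"
    using insert by auto
  have "((\<lambda>h. inverse (h - x r) * (\<Prod>j\<in>S. inverse (h - x j))) has_real_derivative
      (- (inverse (w - x r) * inverse (w - x r))) * (\<Prod>j\<in>S. inverse (w - x j))
       + (- (\<Prod>j\<in>S. inverse (w - x j)) * (\<Sum>j\<in>S. inverse (w - x j))) * inverse (w - x r)) (at w)"
    by (rule DERIV_mult[OF _ IH]) (use \<open>w \<noteq> x r\<close> in \<open>auto intro!: derivative_eq_intros\<close>)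
  then show ?case
    using insert.hyps by (simp add: algebra_simps)
qed auto

text \<open>Differentiate \<open>partial_fractions\<close> in \<open>w\<close>: simple poles become
  double poles and the product acquires its logarithmic derivative.\<close>

lemma partial_fractions_square:
  assumes "finite R" "inj_on x R" "w \<notin> x ` R"
  shows "(\<Sum>l\<in>R. (inverse (w - x l))\<^sup>2 * pfrac x l (R - {l}))
       = (\<Prod>j\<in>R. inverse (w - x j)) * (\<Sum>j\<in>R. inverse (w - x j))"
proof (cases "R = {}")
  case False
  have op: "open (- (x ` R))"
    using assms(1) by (simp add: finite_imp_closed open_Compl)
  have "((\<lambda>h. \<Sum>l\<in>R. inverse (h - x l) * pfrac x l (R - {l})) has_real_derivative
      (\<Sum>l\<in>R. - (inverse (w - x l))\<^sup>2 * pfrac x l (R - {l}))) (at w)"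
    using assms(3) by (auto intro!: derivative_eq_intros sum.cong simp: power2_eq_square image_iff)
  then have "((\<lambda>h. \<Prod>j\<in>R. inverse (h - x j)) has_real_derivative
      (\<Sum>l\<in>R. - (inverse (w - x l))\<^sup>2 * pfrac x l (R - {l}))) (at w)"
    by (rule has_field_derivative_transform_within_open[OF _ op])
       (use assms False in \<open>auto intro!: partial_fractions\<close>)
  from DERIV_unique[OF this prod_inverse_has_derivative[OF assms(1,3)]]
  show ?thesis by (simp add: sum_negf)
qed simp

text \<open>Pairs (R, l) with l in R correspond to pairs (l, S) with S = R - {l}. Sums with a
  distinguished index are thereby grouped by the underlying set, where partial fractions
  apply.\<close>

lemma sum_Pow_remove:
  assumes "finite A"
  shows "(\<Sum>R\<in>Pow A. \<Sum>l\<in>R. f l (R - {l})) = (\<Sum>l\<in>A. \<Sum>S\<in>Pow (A - {l}). f l S :: 'a::comm_monoid_add)"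
proof -
  have fin: "finite R" if "R \<in> Pow A" for R
    using that assms finite_subset by auto
  have "(\<Sum>R\<in>Pow A. \<Sum>l\<in>R. f l (R - {l})) = (\<Sum>(R,l)\<in>Sigma (Pow A) (\<lambda>R. R). f l (R - {l}))"
    using assms fin by (intro sum.Sigma) auto
  also have "\<dots> = (\<Sum>(l,S)\<in>Sigma A (\<lambda>l. Pow (A - {l})). f l S)"
    by (rule sum.reindex_bij_witness[of _ "\<lambda>(l,S). (insert l S, l)" "\<lambda>(R,l). (l, R - {l})"])
       (auto simp: insert_absorb)
  also have "\<dots> = (\<Sum>l\<in>A. \<Sum>S\<in>Pow (A - {l}). f l S)"
    using assms by (intro sum.Sigma[symmetric]) auto
  finally show ?thesis .
qed

lemma sum_Pow_insert:
  assumes "finite A" "i \<notin> A"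
  shows "(\<Sum>S\<in>Pow (insert i A). f S :: 'a::comm_monoid_add) = (\<Sum>S\<in>Pow A. f S) + (\<Sum>S\<in>Pow A. f (insert i S))"
proof -
  have "(\<Sum>S\<in>Pow (insert i A). f S) = (\<Sum>S\<in>Pow A. f S) + (\<Sum>S\<in>insert i ` Pow A. f S)"
    unfolding Pow_insert by (rule sum.union_disjoint) (use assms in auto)
  also have "(\<Sum>S\<in>insert i ` Pow A. f S) = (\<Sum>S\<in>Pow A. f (insert i S))"
    by (rule sum.reindex_cong[of "insert i"]) (use assms in \<open>auto simp: inj_on_def\<close>)
  finally show ?thesis .
qed

section \<open>The symbol of a family of mixed partial derivatives\<close>

text \<open>The variable z of the polynomials stays formal and only coefficients are differentiated
  in \<open>x i\<close>, since \<open>symb_UNIV_eq\<close> compares coefficients one degree at a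
  time.\<close>

definition coeff_deriv ::
    "'m \<Rightarrow> (('m \<Rightarrow> real) \<Rightarrow> real poly) \<Rightarrow> real poly \<Rightarrow> ('m \<Rightarrow> real) \<Rightarrow> bool" where
  "coeff_deriv i F G x \<longleftrightarrow>
     (\<forall>k. ((\<lambda>h. coeff (F (x(i := h))) k) has_real_derivative coeff G k) (at (x i)))"

lemma coeff_deriv_sum:
  assumes "\<And>a. a \<in> A \<Longrightarrow> coeff_deriv i (F a) (G a) x"
  shows "coeff_deriv i (\<lambda>x. \<Sum>a\<in>A. F a x) (\<Sum>a\<in>A. G a) x"
  using assms unfolding coeff_deriv_def by (auto simp: coeff_sum intro!: DERIV_sum)

lemma coeff_deriv_diff:
  assumes "coeff_deriv i F F' x" "coeff_deriv i G G' x"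
  shows "coeff_deriv i (\<lambda>x. F x - G x) (F' - G') x"
  using assms unfolding coeff_deriv_def by (auto intro!: DERIV_diff)

lemma coeff_deriv_smult:
  assumes "((\<lambda>h. f (x(i := h))) has_real_derivative f') (at (x i))" "coeff_deriv i F F' x"
  shows "coeff_deriv i (\<lambda>x. smult (f x) (F x)) (smult f' (F x) + smult (f x) F') x"
  using assms unfolding coeff_deriv_def
  by (auto intro!: derivative_eq_intros simp: algebra_simps)

lemma coeff_deriv_const_poly:
  assumes "((\<lambda>h. f (x(i := h))) has_real_derivative f') (at (x i))"
  shows "coeff_deriv i (\<lambda>x. smult (f x) p) (smult f' p) x"
  using coeff_deriv_smult[OF assms, of "\<lambda>_. p" 0] by (simp add: coeff_deriv_def)

lemma eventually_inj_upd:
  fixes x :: "'m::finite \<Rightarrow> real"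
  assumes "inj x"
  shows "\<forall>\<^sub>F h in nhds (x i). inj (x(i := h))"
proof -
  have "open (- (x ` (- {i})))"
    by (simp add: finite_imp_closed open_Compl)
  moreover have "x i \<in> - (x ` (- {i}))"
    using assms by (auto simp: inj_def)
  ultimately have "\<forall>\<^sub>F h in nhds (x i). h \<in> - (x ` (- {i}))"
    by (rule eventually_nhds_in_open)
  then show ?thesis
  proof eventually_elim
    case (elim h)
    then show ?case
      using assms unfolding inj_def by (auto simp: image_iff)
  qed
qed

lemma pfrac_has_derivative:
  fixes x :: "'m::finite \<Rightarrow> real"
  assumes "inj x" "i \<notin> S"
  shows "((\<lambda>h. pfrac (x(i := h)) i S) has_real_derivative
     - pfrac x i S * (\<Sum>j\<in>S. inverse (x i - x j))) (at (x i))"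
proof -
  have "x i \<notin> x ` S"
    using assms by (auto simp: inj_def)
  moreover have "(\<lambda>h. pfrac (x(i := h)) i S) = (\<lambda>h. \<Prod>j\<in>S. inverse (h - x j))"
    using assms(2) by (auto simp: pfrac_def fun_eq_iff intro!: prod.cong)
  ultimately show ?thesis
    using prod_inverse_has_derivative[of S "x i" x] by (simp add: pfrac_def)
qed

text \<open>\<open>symb R\<close> stands for \<open>\<Prod>j\<in>R. (z - \<partial>\<^sub>j)\<close> applied to \<open>\<phi> {}\<close>, as a polynomial in \<open>z\<close>,
  when \<open>\<phi> Q\<close> is the mixed partial derivative of \<open>\<phi> {}\<close> in the variables from \<open>Q\<close>.\<close>

definition symb :: "('m set \<Rightarrow> ('m \<Rightarrow> real) \<Rightarrow> real) \<Rightarrow> 'm set \<Rightarrow> ('m \<Rightarrow> real) \<Rightarrow> real poly" where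
  "symb \<phi> R x = (\<Sum>Q\<in>Pow R. monom ((-1) ^ card Q * \<phi> Q x) (card (R - Q)))"

text \<open>\<open>symb \<phi> (insert i R)\<close> is z - d/dx_i applied to
  \<open>symb \<phi> R\<close>; solve for the derivative. \<open>pCons 0\<close> is multiplication
  by z.\<close>

lemma symb_deriv:
  fixes \<phi> :: "'m::finite set \<Rightarrow> ('m \<Rightarrow> real) \<Rightarrow> real"
  assumes "\<And>Q. i \<notin> Q \<Longrightarrow>
      ((\<lambda>h. \<phi> Q (x(i := h))) has_real_derivative \<phi> (insert i Q) x) (at (x i))" and "i \<notin> R"
  shows "coeff_deriv i (symb \<phi> R) (pCons 0 (symb \<phi> R x) - symb \<phi> (insert i R) x) x"
proof -
  have d: "coeff_deriv i (symb \<phi> R)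
      (\<Sum>Q\<in>Pow R. monom ((-1) ^ card Q * \<phi> (insert i Q) x) (card (R - Q))) x"
    unfolding symb_def
  proof (rule coeff_deriv_sum)
    fix Q assume "Q \<in> Pow R"
    then have "i \<notin> Q" using assms(2) by auto
    show "coeff_deriv i (\<lambda>x. monom ((-1) ^ card Q * \<phi> Q x) (card (R - Q)))
        (monom ((-1) ^ card Q * \<phi> (insert i Q) x) (card (R - Q))) x"
      using assms(1)[OF \<open>i \<notin> Q\<close>] by (auto simp: coeff_deriv_def intro!: derivative_eq_intros)
  qed
  have "symb \<phi> (insert i R) x =
      (\<Sum>Q\<in>Pow R. monom ((-1) ^ card Q * \<phi> Q x) (Suc (card (R - Q)))) +
      (\<Sum>Q\<in>Pow R. - monom ((-1) ^ card Q * \<phi> (insert i Q) x) (card (R - Q)))"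
    unfolding symb_def sum_Pow_insert[OF finite assms(2)]
  proof (intro arg_cong2[of _ _ _ _ "(+)"] sum.cong refl)
    fix Q assume "Q \<in> Pow R"
    then have "i \<notin> Q" "insert i R - Q = insert i (R - Q)" "insert i R - insert i Q = R - Q"
      using assms(2) by auto
    then show "monom ((-1) ^ card Q * \<phi> Q x) (card (insert i R - Q)) =
        monom ((-1) ^ card Q * \<phi> Q x) (Suc (card (R - Q)))"
      and "monom ((-1) ^ card (insert i Q) * \<phi> (insert i Q) x) (card (insert i R - insert i Q)) =
        - monom ((-1) ^ card Q * \<phi> (insert i Q) x) (card (R - Q))"
      using assms(2) by (simp_all add: minus_monom)
  qed
  moreover have "pCons 0 (symb \<phi> R x) =
      (\<Sum>Q\<in>Pow R. monom ((-1) ^ card Q * \<phi> Q x) (Suc (card (R - Q))))"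
    unfolding symb_def by (rule poly_eqI) (auto simp: coeff_pCons coeff_sum split: nat.split)
  ultimately show ?thesis
    using d by (simp add: sum_negf)
qed

text \<open>Leibniz rule for a product of factors z - d/dx_j, each of derivative 1 in z. The
  exponent brought down from the monomial of \<open>Q\<close> counts the indices i outside
  \<open>Q\<close>, which are those for which \<open>Q\<close> occurs in
  \<open>symb \<phi> (- {i})\<close>.\<close>

lemma pderiv_symb:
  fixes \<phi> :: "'m::finite set \<Rightarrow> ('m \<Rightarrow> real) \<Rightarrow> real"
  shows "pderiv (symb \<phi> UNIV x) = (\<Sum>i\<in>UNIV. symb \<phi> (- {i}) x)"
proof -
  define g where "g Q = monom ((-1) ^ card Q * \<phi> Q x) (card (- Q) - 1)" for Q
  have "pderiv (symb \<phi> UNIV x) = (\<Sum>Q\<in>UNIV. smult (of_nat (card (- Q))) (g Q))"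
    unfolding symb_def higher_pderiv_sum[of 1, simplified] pderiv_monom g_def
    by (intro sum.cong) (simp_all add: smult_monom mult_ac flip: Compl_eq_Diff_UNIV)
  also have "\<dots> = (\<Sum>Q\<in>UNIV. \<Sum>i\<in>{i\<in>UNIV. i \<notin> Q}. g Q)"
  proof (rule sum.cong)
    fix Q :: "'m set"
    have "smult (of_nat (card A)) (g Q) = (\<Sum>i\<in>A. g Q)" for A :: "'m set"
    proof -
      have "smult (of_nat (card A)) (g Q) = (\<Sum>i\<in>A. smult 1 (g Q))"
        by (simp only: smult_sum[symmetric] sum_constant mult_1_right)
      then show ?thesis by (simp only: smult_1_left)
    qed
    moreover have "{i\<in>UNIV. i \<notin> Q} = - Q" by auto
    ultimately show "smult (of_nat (card (- Q))) (g Q) = (\<Sum>i\<in>{i\<in>UNIV. i \<notin> Q}. g Q)"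
      by metis
  qed simp
  also have "\<dots> = (\<Sum>i\<in>UNIV. \<Sum>Q\<in>{Q\<in>UNIV. i \<notin> Q}. g Q)"
    by (rule sum.swap_restrict) auto
  also have "\<dots> = (\<Sum>i\<in>UNIV. \<Sum>Q\<in>Pow (- {i}). g Q)"
    by (intro sum.cong refl) auto
  also have "\<dots> = (\<Sum>i\<in>UNIV. symb \<phi> (- {i}) x)"
    unfolding symb_def
  proof (intro sum.cong refl)
    fix i and Q :: "'m set" assume "Q \<in> Pow (- {i})"
    then have "- Q = insert i (- {i} - Q)" "i \<notin> - {i} - Q" by auto
    then have "card (- Q) = Suc (card (- {i} - Q))"
      by (metis card_insert_disjoint finite)
    then show "g Q = monom ((-1) ^ card Q * \<phi> Q x) (card (- {i} - Q))"
      by (simp add: g_def)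
  qed
  finally show ?thesis .
qed

text \<open>For a family as in \<open>symb_phi_UNIV\<close> below this is, up to the Vandermonde factor,
  the polynomial \<open>resolvent_poly\<close>; both satisfy the same first-order system.\<close>

definition colsymb :: "('m set \<Rightarrow> ('m \<Rightarrow> real) \<Rightarrow> real) \<Rightarrow> 'm \<Rightarrow> ('m \<Rightarrow> real) \<Rightarrow> real poly" where
  "colsymb \<phi> i x = (\<Sum>S\<in>Pow (- {i}). smult ((-1) ^ card S * pfrac x i S) (symb \<phi> (- insert i S) x))"

text \<open>Grouped by \<open>R = insert i S\<close>, the polynomial
  \<open>symb \<phi> (- R) x\<close> is multiplied by the sum of \<open>pfrac x i (R - {i})\<close>
  over i in \<open>R\<close>, up to sign. This vanishes unless \<open>R\<close> is a singleton, and
  the singletons give the Leibniz sum of \<open>pderiv_symb\<close>.\<close>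

lemma sum_colsymb:
  fixes \<phi> :: "'m::finite set \<Rightarrow> ('m \<Rightarrow> real) \<Rightarrow> real"
  assumes "inj x"
  shows "(\<Sum>i\<in>UNIV. colsymb \<phi> i x) = pderiv (symb \<phi> UNIV x)"
proof -
  define f where "f i S = smult ((-1) ^ card S * pfrac x i S) (symb \<phi> (- insert i S) x)" for i S
  have "(\<Sum>i\<in>UNIV. colsymb \<phi> i x) = (\<Sum>i\<in>UNIV. \<Sum>S\<in>Pow (UNIV - {i}). f i S)"
    by (simp add: colsymb_def f_def flip: Compl_eq_Diff_UNIV)
  also have "\<dots> = (\<Sum>R\<in>Pow UNIV. \<Sum>i\<in>R. f i (R - {i}))"
    by (rule sum_Pow_remove[symmetric]) simp
  also have "\<dots> = (\<Sum>R\<in>Pow UNIV. if card R = 1 then symb \<phi> (- R) x else 0)"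
  proof (rule sum.cong)
    fix R :: "'m set"
    show "(\<Sum>i\<in>R. f i (R - {i})) = (if card R = 1 then symb \<phi> (- R) x else 0)"
    proof (cases "card R = 1")
      case True
      then obtain i where "R = {i}" by (auto simp: card_1_singleton_iff)
      then show ?thesis by (simp add: f_def)
    next
      case False
      have "f i (R - {i}) = smult (pfrac x i (R - {i})) (smult ((-1) ^ (card R - 1)) (symb \<phi> (- R) x))"
        if "i \<in> R" for i
        using that by (simp add: f_def insert_absorb card_Diff_singleton mult.commute)
      then have "(\<Sum>i\<in>R. f i (R - {i})) =
          smult (\<Sum>i\<in>R. pfrac x i (R - {i})) (smult ((-1) ^ (card R - 1)) (symb \<phi> (- R) x))"
        by (simp add: smult_sum del: smult_smult)
      also have "(\<Sum>i\<in>R. pfrac x i (R - {i})) = 0"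
        using False assms by (intro partial_fractions_sum_0) (auto intro: inj_on_subset)
      finally show ?thesis using False by simp
    qed
  qed simp
  also have "\<dots> = (\<Sum>R\<in>(\<lambda>i. {i}) ` UNIV. symb \<phi> (- R) x)"
    by (rule sum.mono_neutral_cong_right) (auto simp: card_1_singleton_iff)
  also have "\<dots> = (\<Sum>i\<in>UNIV. symb \<phi> (- {i}) x)"
    by (simp add: sum.reindex inj_def)
  finally show ?thesis by (simp add: pderiv_symb)
qed

text \<open>Differentiating the terms of \<open>colsymb\<close> yields multiples of
  \<open>symb \<phi> (- insert i S) x\<close> and of \<open>symb \<phi> (- S) x\<close>. In the sum
  over \<open>c\<close>, the subsets without \<open>i\<close> reproduce the second kind by
  \<open>partial_fractions\<close>, those containing \<open>i\<close> the first kind by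
  \<open>partial_fractions_square\<close>.\<close>

lemma colsymb_deriv:
  fixes \<phi> :: "'m::finite set \<Rightarrow> ('m \<Rightarrow> real) \<Rightarrow> real"
  assumes \<phi>: "\<And>Q. i \<notin> Q \<Longrightarrow>
      ((\<lambda>h. \<phi> Q (x(i := h))) has_real_derivative \<phi> (insert i Q) x) (at (x i))" and x: "inj x"
  shows "coeff_deriv i (colsymb \<phi> i)
     (pCons 0 (colsymb \<phi> i x) + (\<Sum>c\<in>- {i}. smult (inverse (x i - x c)) (colsymb \<phi> c x))
        - symb \<phi> UNIV x) x"
proof -
  let ?K = "\<lambda>S. (-1) ^ card S * pfrac x i S"
  let ?A = "\<lambda>S. symb \<phi> (- insert i S) x"
  define D where "D S = smult (- ?K S * (\<Sum>j\<in>S. inverse (x i - x j))) (?A S)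
     + smult (?K S) (pCons 0 (?A S) - symb \<phi> (- S) x)" for S
  have d: "coeff_deriv i (colsymb \<phi> i) (\<Sum>S\<in>Pow (- {i}). D S) x"
    unfolding colsymb_def[abs_def]
  proof (rule coeff_deriv_sum)
    fix S assume S: "S \<in> Pow (- {i})"
    then have "i \<notin> S" "insert i (- insert i S) = - S" by auto
    have 1: "((\<lambda>h. (-1) ^ card S * pfrac (x(i := h)) i S) has_real_derivative
        - ?K S * (\<Sum>j\<in>S. inverse (x i - x j))) (at (x i))"
      using pfrac_has_derivative[OF x \<open>i \<notin> S\<close>] by (auto intro!: derivative_eq_intros)
    have 2: "coeff_deriv i (symb \<phi> (- insert i S)) (pCons 0 (?A S) - symb \<phi> (- S) x) x"
      using symb_deriv[of i \<phi> x "- insert i S", OF \<phi>] \<open>insert i (- insert i S) = - S\<close> by simp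
    show "coeff_deriv i (\<lambda>x. smult ((-1) ^ card S * pfrac x i S) (symb \<phi> (- insert i S) x)) (D S) x"
      unfolding D_def by (rule coeff_deriv_smult[where f = "\<lambda>x. (-1) ^ card S * pfrac x i S", OF 1 2])
  qed
  define g where "g l S = smult (inverse (x i - x l) * ((-1) ^ card S * pfrac x l S))
      (symb \<phi> (- insert l S) x)" for l S
  have inj: "inj_on x R" for R using x by (auto intro: inj_on_subset)
  have xi: "x i \<notin> x ` R" if "R \<subseteq> - {i}" for R using x that by (auto simp: inj_def)
  have "(\<Sum>l\<in>- {i}. smult (inverse (x i - x l)) (colsymb \<phi> l x)) = (\<Sum>l\<in>- {i}. \<Sum>S\<in>Pow (- {l}). g l S)"
    by (rule poly_eqI) (simp add: colsymb_def g_def coeff_sum sum_distrib_left mult.assoc)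
  also have "\<dots> = (\<Sum>l\<in>- {i}. \<Sum>S\<in>Pow (- {i} - {l}). g l S + g l (insert i S))"
  proof (rule sum.cong)
    fix l assume "l \<in> - {i}"
    then have "- {l} = insert i (- {i} - {l})" by auto
    then have "(\<Sum>S\<in>Pow (- {l}). g l S) = (\<Sum>S\<in>Pow (insert i (- {i} - {l})). g l S)"
      by (rule arg_cong)
    also have "\<dots> = (\<Sum>S\<in>Pow (- {i} - {l}). g l S) + (\<Sum>S\<in>Pow (- {i} - {l}). g l (insert i S))"
      by (rule sum_Pow_insert) auto
    finally show "(\<Sum>S\<in>Pow (- {l}). g l S) = (\<Sum>S\<in>Pow (- {i} - {l}). g l S + g l (insert i S))"
      by (simp only: sum.distrib)
  qed simp
  also have "\<dots> = (\<Sum>R\<in>Pow (- {i}). \<Sum>l\<in>R. g l (R - {l}) + g l (insert i (R - {l})))"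
    by (rule sum_Pow_remove[symmetric]) simp
  \<comment> \<open>For empty \<open>R\<close> the inner sum is empty, whereas the general
    expression would leave \<open>- symb \<phi> UNIV x\<close>. The \<open>if\<close> term
    compensates, and it becomes the inhomogeneous term of the system.\<close>
  also have "\<dots> = (\<Sum>R\<in>Pow (- {i}). (if R = {} then symb \<phi> UNIV x else 0)
      - smult (?K R) (symb \<phi> (- R) x)
      - smult (?K R * (\<Sum>j\<in>R. inverse (x i - x j))) (?A R))"
  proof (rule sum.cong)
    fix R assume R: "R \<in> Pow (- {i})"
    then have iR: "i \<notin> R" by auto
    show "(\<Sum>l\<in>R. g l (R - {l}) + g l (insert i (R - {l}))) =
        (if R = {} then symb \<phi> UNIV x else 0) - smult (?K R) (symb \<phi> (- R) x)
        - smult (?K R * (\<Sum>j\<in>R. inverse (x i - x j))) (?A R)"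
    proof (cases "R = {}")
      case False
      have sgn: "(-1) ^ card (R - {l}) = - ((-1 :: real) ^ card R)"
          "(-1) ^ card (insert i (R - {l})) = (-1 :: real) ^ card R" if "l \<in> R" for l
      proof -
        have "card R = Suc (card (R - {l}))" "i \<notin> R - {l}"
          using that iR by (metis card_Suc_Diff1 finite, auto)
        then have "card (insert i (R - {l})) = card R"
          by (metis card_insert_disjoint finite)
        then show "(-1) ^ card (insert i (R - {l})) = (-1 :: real) ^ card R"
          by (rule arg_cong)
        show "(-1) ^ card (R - {l}) = - ((-1 :: real) ^ card R)"
          unfolding \<open>card R = Suc (card (R - {l}))\<close> by (simp del: card_Diff_insert)
      qed
      have 1: "g l (R - {l}) = smult (inverse (x i - x l) * pfrac x l (R - {l}))
          (smult (- ((-1) ^ card R)) (symb \<phi> (- R) x))" if "l \<in> R" for l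
        using that unfolding g_def sgn(1)[OF that] by (simp add: insert_absorb mult_ac)
      have 2: "g l (insert i (R - {l})) = smult ((inverse (x i - x l))\<^sup>2 * pfrac x l (R - {l}))
          (smult (- ((-1) ^ card R)) (?A R))" if "l \<in> R" for l
      proof -
        have "insert l (insert i (R - {l})) = insert i R" "i \<notin> R - {l}"
          using that iR by auto
        moreover have "pfrac x l (insert i (R - {l})) = - inverse (x i - x l) * pfrac x l (R - {l})"
          using iR by (simp add: pfrac_def flip: inverse_minus_eq)
        ultimately show ?thesis
          unfolding g_def sgn(2)[OF that] by (simp add: power2_eq_square mult_ac)
      qed
      have "(\<Sum>l\<in>R. g l (R - {l}) + g l (insert i (R - {l}))) =
        smult (\<Sum>l\<in>R. inverse (x i - x l) * pfrac x l (R - {l})) (smult (- ((-1) ^ card R)) (symb \<phi> (- R) x))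
       + smult (\<Sum>l\<in>R. (inverse (x i - x l))\<^sup>2 * pfrac x l (R - {l})) (smult (- ((-1) ^ card R)) (?A R))"
        by (simp only: 1 2 sum.distrib smult_sum cong: sum.cong)
      also have "\<dots> = smult (pfrac x i R) (smult (- ((-1) ^ card R)) (symb \<phi> (- R) x))
       + smult (pfrac x i R * (\<Sum>j\<in>R. inverse (x i - x j))) (smult (- ((-1) ^ card R)) (?A R))"
        unfolding pfrac_def[of x i R] partial_fractions_square[OF finite inj xi[OF PowD[OF R]]]
          partial_fractions[OF finite False inj xi[OF PowD[OF R]]] ..
      finally show ?thesis
        using False by (simp add: mult_ac)
    qed simp
  qed simp
  also have "\<dots> = symb \<phi> UNIV x - (\<Sum>R\<in>Pow (- {i}). smult (?K R) (symb \<phi> (- R) x))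
      - (\<Sum>R\<in>Pow (- {i}). smult (?K R * (\<Sum>j\<in>R. inverse (x i - x j))) (?A R))"
    by (simp add: sum_subtractf sum.delta)
  finally have A: "pCons 0 (colsymb \<phi> i x) + (\<Sum>l\<in>- {i}. smult (inverse (x i - x l)) (colsymb \<phi> l x))
      - symb \<phi> UNIV x
    = pCons 0 (colsymb \<phi> i x) - (\<Sum>R\<in>Pow (- {i}). smult (?K R) (symb \<phi> (- R) x))
      - (\<Sum>R\<in>Pow (- {i}). smult (?K R * (\<Sum>j\<in>R. inverse (x i - x j))) (?A R))"
    by simp
  have B: "pCons 0 (colsymb \<phi> i x) = (\<Sum>S\<in>Pow (- {i}). smult (?K S) (pCons 0 (?A S)))"
    unfolding colsymb_def by (rule poly_eqI) (simp add: coeff_pCons coeff_sum split: nat.split)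
  have "pCons 0 (colsymb \<phi> i x) - (\<Sum>R\<in>Pow (- {i}). smult (?K R) (symb \<phi> (- R) x))
      - (\<Sum>R\<in>Pow (- {i}). smult (?K R * (\<Sum>j\<in>R. inverse (x i - x j))) (?A R)) = (\<Sum>S\<in>Pow (- {i}). D S)"
    unfolding B by (simp add: D_def sum_subtractf sum.distrib smult_diff_right sum_negf)
  then show ?thesis unfolding A using d by simp
qed

text \<open>Having distinct entries is an open condition, so the coefficient is zero in a
  neighbourhood along \<open>x i\<close>, and its derivative is zero as well.\<close>

lemma coeff_deriv_coeff_0:
  fixes x :: "'m::finite \<Rightarrow> real"
  assumes "coeff_deriv i F G x" "inj x" "\<And>y. inj y \<Longrightarrow> coeff (F y) k = 0"
  shows "coeff G k = 0"
proof -
  have 0: "((\<lambda>h. coeff (F (x(i := h))) k) has_real_derivative coeff G k) (at (x i))"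
    using assms(1) by (simp add: coeff_deriv_def)
  have ev: "\<forall>\<^sub>F h in nhds (x i). coeff (F (x(i := h))) k = 0"
    using eventually_inj_upd[OF assms(2), of i] by eventually_elim (use assms(3) in auto)
  have "((\<lambda>h. 0) has_real_derivative coeff G k) (at (x i))"
    using 0 by (subst (asm) DERIV_cong_ev[OF refl ev refl])
  then show ?thesis
    by (metis DERIV_const DERIV_unique)
qed

text \<open>Two solutions of the same first-order system whose difference is a polynomial of degree
  \<open>< m\<close> in \<open>z\<close> agree: comparing coefficients of \<open>z\<^sup>k\<^sup>+\<^sup>1\<close>, the defect \<open>\<delta>\<close> satisfies
  \<open>m \<delta>\<^bsub>k+1\<^esub> = (k+1) \<delta>\<^bsub>k+1\<^esub>\<close>.\<close>

lemma symb_UNIV_eq: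
  fixes \<phi> :: "'m::finite set \<Rightarrow> ('m \<Rightarrow> real) \<Rightarrow> real"
    and b :: "'m \<Rightarrow> ('m \<Rightarrow> real) \<Rightarrow> real poly"
  assumes \<phi>: "\<And>i Q x. i \<notin> Q \<Longrightarrow>
      ((\<lambda>h. \<phi> Q (x(i := h))) has_real_derivative \<phi> (insert i Q) x) (at (x i))"
    and b: "\<And>i x. inj x \<Longrightarrow> coeff_deriv i (b i)
      (pCons 0 (b i x) + (\<Sum>c\<in>- {i}. smult (inverse (x i - x c)) (b c x)) - smult (\<phi> {} x) \<xi>) x"
    and b_sum: "\<And>x. inj x \<Longrightarrow> (\<Sum>i\<in>UNIV. b i x) = smult (\<phi> {} x) (pderiv \<xi>)"
    and b_degree: "\<And>i x. degree (b i x) < CARD('m)"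
    and \<xi>: "degree \<xi> = CARD('m)" "lead_coeff \<xi> = 1"
    and x: "inj x"
  shows "symb \<phi> UNIV x = smult (\<phi> {} x) \<xi>"
proof -
  let ?m = "CARD('m)"
  define d where "d i x = b i x - colsymb \<phi> i x" for i x
  define \<delta> where "\<delta> x = smult (\<phi> {} x) \<xi> - symb \<phi> UNIV x" for x
  have d_deriv: "coeff_deriv i (d i)
      (pCons 0 (d i x) + (\<Sum>c\<in>- {i}. smult (inverse (x i - x c)) (d c x)) - \<delta> x) x" if "inj x" for i x
  proof -
    have "coeff_deriv i (d i)
      ((pCons 0 (b i x) + (\<Sum>c\<in>- {i}. smult (inverse (x i - x c)) (b c x)) - smult (\<phi> {} x) \<xi>) -
       (pCons 0 (colsymb \<phi> i x) + (\<Sum>c\<in>- {i}. smult (inverse (x i - x c)) (colsymb \<phi> c x))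
        - symb \<phi> UNIV x)) x"
      unfolding d_def[abs_def] using that
      by (intro coeff_deriv_diff b colsymb_deriv \<phi>)
    also have "((pCons 0 (b i x) + (\<Sum>c\<in>- {i}. smult (inverse (x i - x c)) (b c x)) - smult (\<phi> {} x) \<xi>) -
       (pCons 0 (colsymb \<phi> i x) + (\<Sum>c\<in>- {i}. smult (inverse (x i - x c)) (colsymb \<phi> c x))
        - symb \<phi> UNIV x)) = pCons 0 (d i x) + (\<Sum>c\<in>- {i}. smult (inverse (x i - x c)) (d c x)) - \<delta> x"
      by (rule poly_eqI)
         (simp add: d_def \<delta>_def coeff_pCons coeff_sum sum_subtractf right_diff_distrib split: nat.split)
    finally show ?thesis .
  qed
  have d_sum: "(\<Sum>i\<in>UNIV. d i x) = pderiv (\<delta> x)" if "inj x" for x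
    using that by (simp add: d_def \<delta>_def sum_subtractf b_sum sum_colsymb pderiv_diff pderiv_smult)
  have d_degree: "coeff (d i x) k = 0" if "k \<ge> ?m" for i x k
  proof -
    have "coeff (symb \<phi> (- insert i S) x) k = 0" for S
    proof -
      have "card (- insert i S - Q) < ?m" for Q
        by (rule psubset_card_mono) auto
      then show ?thesis
        using that unfolding symb_def coeff_sum
        by (intro sum.neutral) (metis coeff_monom not_le)
    qed
    moreover have "coeff (b i x) k = 0"
      using b_degree[of i x] that by (intro coeff_eq_0) simp
    ultimately show ?thesis
      by (simp add: d_def colsymb_def coeff_sum)
  qed
  have \<delta>_degree: "coeff (\<delta> x) k = 0" if "k \<ge> ?m" for x k
  proof (cases "k = ?m")
    case True
    have card: "card (UNIV - Q) \<noteq> ?m" if "Q \<noteq> {}" for Q :: "'m set"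
    proof -
      have "card (UNIV - Q) < ?m"
        using that by (intro psubset_card_mono) auto
      then show ?thesis by simp
    qed
    have "coeff (symb \<phi> UNIV x) ?m = (\<Sum>Q\<in>Pow (UNIV :: 'm set). if Q = {} then \<phi> {} x else 0)"
      unfolding symb_def coeff_sum coeff_monom by (rule sum.cong) (use card in \<open>auto simp del: Diff_UNIV\<close>)
    also have "\<dots> = \<phi> {} x"
      by (subst sum.delta) auto
    finally have "coeff (symb \<phi> UNIV x) ?m = \<phi> {} x" .
    then show ?thesis
      using \<xi> True by (simp add: \<delta>_def)
  next
    case False
    then have "?m < k" using that by simp
    moreover have "card (UNIV - Q) \<le> ?m" for Q :: "'m set"
      by (rule card_mono) auto
    ultimately have "coeff (symb \<phi> UNIV x) k = 0"
      unfolding symb_def coeff_sum by (intro sum.neutral) (metis coeff_monom not_le)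
    moreover have "coeff \<xi> k = 0"
      using \<xi> \<open>?m < k\<close> by (intro coeff_eq_0) simp
    ultimately show ?thesis by (simp add: \<delta>_def)
  qed
  have main: "(\<forall>x. inj x \<longrightarrow> coeff (\<delta> x) (Suc k) = 0 \<and> (\<forall>i. coeff (d i x) k = 0))" for k
  proof (cases "k \<le> ?m")
    case True
    then show ?thesis
    proof (induction k rule: inc_induct)
      case base
      then show ?case using \<delta>_degree d_degree by simp
    next
      case (step k)
      have "coeff (\<delta> x) (Suc k) = 0 \<and> (\<forall>i. coeff (d i x) k = 0)" if x: "inj x" for x
      proof -
        \<comment> \<open>By induction the coefficient \<open>Suc k\<close> of every
          \<open>d i\<close> vanishes at all tuples of distinct entries, hence so does that of its
          derivative. In the system only the shift \<open>pCons 0\<close> and the defect survive in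
          this degree.\<close>
        have eq: "coeff (d i x) k = coeff (\<delta> x) (Suc k)" for i
          using coeff_deriv_coeff_0[OF d_deriv[OF x] x, of i "Suc k"] step.IH x
          by (simp add: coeff_sum)
        have "coeff (\<delta> x) (Suc k) = 0"
        \<comment> \<open>The relation obtained by summing over i is empty when \<open>Suc k\<close>
          is the number of variables. In that degree the defect vanishes because both polynomials
          have the coefficient \<open>\<phi> {} x\<close>.\<close>
        proof (cases "Suc k = ?m")
          case False
          have "real ?m * coeff (\<delta> x) (Suc k) = coeff (\<Sum>i\<in>UNIV. d i x) k"
            by (simp add: coeff_sum eq)
          also have "\<dots> = real (Suc k) * coeff (\<delta> x) (Suc k)"
            by (simp add: d_sum[OF x] coeff_pderiv)
          finally show ?thesis
            using False by (metis mult_cancel_right of_nat_eq_iff)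
        qed (simp add: \<delta>_degree)
        then show ?thesis using eq by simp
      qed
      then show ?case by blast
    qed
  next
    case False
    then show ?thesis using \<delta>_degree d_degree by simp
  qed
  have "coeff (\<delta> x) k = 0" for k
  proof (cases k)
    \<comment> \<open>\<open>pCons 0\<close> has no constant term, so the constant coefficient of
      the equation for any single \<open>d i\<close> gives that of the defect;
      \<open>undefined\<close> is an arbitrary index.\<close>
    case 0
    show ?thesis
      using coeff_deriv_coeff_0[OF d_deriv[OF x] x, of undefined 0] main x 0
      by (simp add: coeff_sum)
  qed (use main x in auto)
  then have "\<delta> x = 0" by (intro poly_eqI) simp
  then show ?thesis by (simp add: \<delta>_def)
qed

section \<open>Haar measure on the unitary group\<close>

lemma herm_conj_nth [simp]: "herm_conj A $ i $ j = cnj (A $ j $ i)"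
  by (simp add: herm_conj_def)

lemma herm_conj_herm_conj [simp]: "herm_conj (herm_conj A) = A"
  by (simp add: vec_eq_iff)

lemma herm_conj_mult: "herm_conj (A ** B) = herm_conj B ** herm_conj A"
  by (simp add: vec_eq_iff matrix_matrix_mult_def mult.commute)

lemma herm_conj_mat_1 [simp]: "herm_conj (mat 1) = mat 1"
  by (simp add: vec_eq_iff mat_def)

lemma unitary_group_mult:
  assumes "U \<in> unitary_group" "V \<in> unitary_group"
  shows "U ** V \<in> unitary_group"
proof -
  have "herm_conj V ** herm_conj U ** (U ** V) = herm_conj V ** (herm_conj U ** U) ** V"
    by (simp only: matrix_mul_assoc)
  moreover have "U ** V ** (herm_conj V ** herm_conj U) = U ** (V ** herm_conj V) ** herm_conj U"
    by (simp only: matrix_mul_assoc)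
  ultimately show ?thesis
    using assms by (simp add: unitary_group_def herm_conj_mult)
qed

lemma unitary_group_herm_conj: "U \<in> unitary_group \<Longrightarrow> herm_conj U \<in> unitary_group"
  by (simp add: unitary_group_def)

lemma unitary_groupI: "herm_conj U ** U = mat 1 \<Longrightarrow> U \<in> unitary_group"
  by (simp add: unitary_group_def matrix_left_right_inverse)

lemma unitary_columns:
  assumes "U \<in> unitary_group"
  shows "(\<Sum>i\<in>UNIV. cnj (U $ i $ j) * U $ i $ k) = (if j = k then 1 else 0)"
proof -
  have "(herm_conj U ** U) $ j $ k = mat 1 $ j $ k"
    using assms by (simp add: unitary_group_def)
  then show ?thesis by (simp add: matrix_matrix_mult_def mat_def)
qed

lemma unitary_column_norm:
  assumes "U \<in> unitary_group"
  shows "(\<Sum>i\<in>UNIV. (cmod (U $ i $ j))\<^sup>2) = 1"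
proof -
  have "complex_of_real (\<Sum>i\<in>UNIV. (cmod (U $ i $ j))\<^sup>2) = (\<Sum>i\<in>UNIV. cnj (U $ i $ j) * U $ i $ j)"
    by (simp only: of_real_sum complex_norm_square mult.commute)
  also have "\<dots> = 1" by (simp add: unitary_columns[OF assms])
  finally show ?thesis using of_real_eq_1_iff by blast
qed

lemma unitary_row_norm:
  assumes "U \<in> unitary_group"
  shows "(\<Sum>j\<in>UNIV. (cmod (U $ i $ j))\<^sup>2) = 1"
  using unitary_column_norm[OF unitary_group_herm_conj[OF assms], of i] by simp

lemma compact_unitary_group: "compact (unitary_group :: (complex^'m^'m) set)"
proof -
  have cont: "continuous_on UNIV (\<lambda>U :: complex^'m^'m. herm_conj U ** U)"
    "continuous_on UNIV (\<lambda>U :: complex^'m^'m. U ** herm_conj U)"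
    unfolding matrix_matrix_mult_def herm_conj_def by (auto intro!: continuous_intros)
  have "unitary_group = (\<lambda>U :: complex^'m^'m. herm_conj U ** U) -` {mat 1} \<inter> (\<lambda>U. U ** herm_conj U) -` {mat 1}"
    by (auto simp: unitary_group_def)
  moreover have "closed ((\<lambda>U :: complex^'m^'m. herm_conj U ** U) -` {mat 1} \<inter> (\<lambda>U. U ** herm_conj U) -` {mat 1})"
    by (intro closed_Int continuous_closed_vimage closed_singleton)
       (use cont in \<open>auto simp: continuous_on_eq_continuous_at\<close>)
  ultimately have cl: "closed (unitary_group :: (complex^'m^'m) set)"
    by simp
  have "norm U \<le> (\<Sum>i\<in>(UNIV :: 'm set). 1)" if "U \<in> unitary_group" for U :: "complex^'m^'m"
  proof -
    have "norm (U $ i) = 1" for i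
      using unitary_row_norm[OF that, of i] by (simp add: norm_vec_def L2_set_def)
    then show ?thesis
      unfolding norm_vec_def[of U] using L2_set_le_sum[of UNIV "\<lambda>i. norm (U $ i)"] by simp
  qed
  then have "bounded (unitary_group :: (complex^'m^'m) set)"
    by (auto simp: bounded_iff)
  then show ?thesis using cl compact_eq_bounded_closed by blast
qed

locale haar =
  fixes \<mu> :: "(complex^'m^'m) measure"
  assumes haar: "unitary_haar \<mu>"
begin

sublocale prob_space \<mu>
  using haar by (simp add: unitary_haar_def)

lemma space_haar [simp]: "space \<mu> = unitary_group"
  using haar by (simp add: unitary_haar_def)

lemma sets_haar: "sets \<mu> = sets (restrict_space borel unitary_group)"
  using haar by (simp add: unitary_haar_def)

lemma borel_measurable_haar:
  "f \<in> borel_measurable borel \<Longrightarrow> f \<in> borel_measurable \<mu>"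
  unfolding measurable_cong_sets[OF sets_haar refl] by (rule measurable_restrict_space1)

lemma measurable_haarI:
  assumes "f \<in> M \<rightarrow>\<^sub>M borel" "\<And>\<omega>. \<omega> \<in> space M \<Longrightarrow> f \<omega> \<in> unitary_group"
  shows "f \<in> M \<rightarrow>\<^sub>M \<mu>"
  unfolding measurable_cong_sets[OF refl sets_haar]
  using assms by (intro measurable_restrict_space2) auto

lemma continuous_measurable_haar:
  "continuous_on UNIV f \<Longrightarrow> f \<in> borel_measurable \<mu>"
  by (intro borel_measurable_haar borel_measurable_continuous_onI)

lemma integrable_haar:
  fixes f :: "complex^'m^'m \<Rightarrow> 'b::{banach, second_countable_topology}"
  assumes "continuous_on UNIV f"
  shows "integrable \<mu> f"
proof -
  have "compact (f ` unitary_group)"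
    by (rule compact_continuous_image[OF continuous_on_subset[OF assms] compact_unitary_group]) simp
  then have "bounded (f ` unitary_group)"
    by (rule compact_imp_bounded)
  then obtain B where "\<forall>z\<in>f ` unitary_group. norm z \<le> B"
    unfolding bounded_iff by blast
  then show ?thesis
    using continuous_measurable_haar[OF assms] by (intro integrable_const_bound[of _ B]) auto
qed

lemma left_mult_measurable:
  assumes "V \<in> unitary_group"
  shows "(\<lambda>U. V ** U) \<in> \<mu> \<rightarrow>\<^sub>M \<mu>"
proof (rule measurable_haarI)
  show "(\<lambda>U. V ** U) \<in> borel_measurable \<mu>"
    unfolding matrix_matrix_mult_def by (intro continuous_measurable_haar continuous_intros)
qed (use assms in \<open>auto intro: unitary_group_mult\<close>)

lemma integral_left_mult:
  fixes f :: "complex^'m^'m \<Rightarrow> 'b::{banach, second_countable_topology}"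
  assumes "V \<in> unitary_group" "f \<in> borel_measurable \<mu>"
  shows "(LINT U|\<mu>. f (V ** U)) = (LINT U|\<mu>. f U)"
proof -
  have "distr \<mu> \<mu> (\<lambda>U. V ** U) = \<mu>"
    using haar assms(1) by (simp add: unitary_haar_def)
  then show ?thesis
    using integral_distr[OF left_mult_measurable[OF assms(1)] assms(2)] by simp
qed

text \<open>Compactness of the unitary group bounds \<open>f'\<close> for parameters near
  \<open>a\<close>. By the mean value inequality this bound dominates the difference
  quotients.\<close>

lemma expectation_has_derivative:
  fixes f f' :: "real \<Rightarrow> complex^'m^'m \<Rightarrow> real"
  assumes f: "\<And>h. continuous_on UNIV (f h)"
    and f': "continuous_on UNIV (\<lambda>(h, U). f' h U)"
    and d: "\<And>h U. U \<in> unitary_group \<Longrightarrow> ((\<lambda>h. f h U) has_real_derivative f' h U) (at h)"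
  shows "((\<lambda>h. LINT U|\<mu>. f h U) has_real_derivative (LINT U|\<mu>. f' a U)) (at a)"
proof -
  have "compact ((\<lambda>(h, U). f' h U) ` (cball a 1 \<times> unitary_group))"
    by (rule compact_continuous_image[OF continuous_on_subset[OF f']])
       (auto intro: compact_Times compact_unitary_group)
  then have "bounded ((\<lambda>(h, U). f' h U) ` (cball a 1 \<times> unitary_group))"
    by (rule compact_imp_bounded)
  then obtain B where *: "\<forall>z\<in>(\<lambda>(h, U). f' h U) ` (cball a 1 \<times> unitary_group). norm z \<le> B"
    unfolding bounded_iff by blast
  have B: "\<bar>f' h U\<bar> \<le> B" if "h \<in> cball a 1" "U \<in> unitary_group" for h U
    using bspec[OF *, of "f' h U"] imageI[of "(h, U)" "cball a 1 \<times> unitary_group" "\<lambda>(h, U). f' h U"] that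
    by simp
  have Lip: "norm (f h U - f a U) \<le> B * norm (h - a)" if "h \<in> cball a 1" "U \<in> unitary_group" for h U
  proof (rule field_differentiable_bound[where S = "cball a 1" and f = "\<lambda>h. f h U" and f' = "\<lambda>h. f' h U"])
    show "((\<lambda>h. f h U) has_field_derivative f' z U) (at z within cball a 1)" for z
      by (rule has_field_derivative_at_within[OF d[OF that(2)]])
    show "norm (f' z U) \<le> B" if "z \<in> cball a 1" for z
      using B[OF that \<open>U \<in> unitary_group\<close>] by simp
  qed (use that in auto)
  have f'_cont: "continuous_on UNIV (f' a)"
    using continuous_on_compose2[OF f' continuous_on_Pair[OF continuous_on_const continuous_on_id]]
    by simp
  have "((\<lambda>h. ((LINT U|\<mu>. f h U) - (LINT U|\<mu>. f a U)) / (h - a)) \<longlongrightarrow> (LINT U|\<mu>. f' a U)) (at a)"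
    unfolding tendsto_at_iff_sequentially comp_def
  proof (intro allI impI)
    fix X assume X: "\<forall>n. X n \<in> UNIV - {a}" "X \<longlonglongrightarrow> a"
    then obtain N where N: "\<And>n. n \<ge> N \<Longrightarrow> dist (X n) a < 1"
      using metric_LIMSEQ_D[OF X(2), of 1] by auto
    let ?q = "\<lambda>n U. (f (X (n + N)) U - f a U) / (X (n + N) - a)"
    have "(\<lambda>n. LINT U|\<mu>. ?q n U) \<longlonglongrightarrow> (LINT U|\<mu>. f' a U)"
    proof (rule integral_dominated_convergence[where w = "\<lambda>_. B"])
      show "AE U in \<mu>. (\<lambda>n. ?q n U) \<longlonglongrightarrow> f' a U"
      proof (rule AE_I2)
        fix U assume "U \<in> space \<mu>"
        then have "((\<lambda>h. (f h U - f a U) / (h - a)) \<longlongrightarrow> f' a U) (at a)"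
          using d[of U a] by (simp add: has_field_derivative_iff)
        moreover have "filterlim X (at a) sequentially"
          using X by (simp add: filterlim_at)
        ultimately have "(\<lambda>n. (f (X n) U - f a U) / (X n - a)) \<longlonglongrightarrow> f' a U"
          by (rule filterlim_compose)
        then show "(\<lambda>n. ?q n U) \<longlonglongrightarrow> f' a U"
          by (rule LIMSEQ_ignore_initial_segment)
      qed
      show "AE U in \<mu>. norm (?q n U) \<le> B" for n
      proof (rule AE_I2)
        fix U assume "U \<in> space \<mu>"
        then have "norm (f (X (n + N)) U - f a U) \<le> B * norm (X (n + N) - a)"
          using Lip[of "X (n + N)" U] N[of "n + N"] by (simp add: dist_commute)
        moreover have "X (n + N) \<noteq> a" using spec[OF X(1), of "n + N"] by simp
        ultimately show "norm (?q n U) \<le> B"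
          by (simp add: norm_divide divide_le_eq)
      qed
      show "?q n \<in> borel_measurable \<mu>" for n
        by (intro borel_measurable_divide borel_measurable_diff continuous_measurable_haar f
            continuous_on_const)
    qed (auto intro: continuous_measurable_haar f'_cont)
    moreover have "(LINT U|\<mu>. ?q n U) =
        ((LINT U|\<mu>. f (X (n + N)) U) - (LINT U|\<mu>. f a U)) / (X (n + N) - a)" for n
      by (simp add: integrable_haar f Bochner_Integration.integral_diff)
    ultimately show "(\<lambda>n. ((LINT U|\<mu>. f (X n) U) - (LINT U|\<mu>. f a U)) / (X n - a)) \<longlonglongrightarrow> (LINT U|\<mu>. f' a U)"
      by - (rule LIMSEQ_offset[of _ N], simp only:)
  qed
  then show ?thesis by (simp add: has_field_derivative_iff)
qed

end

section \<open>A first-order system from rotation invariance\<close>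

text \<open>For M = U T U^*, \<open>row_weight\<close> and \<open>row_pairing\<close> are its
  diagonal and its general entries, and \<open>weight\<close> is tr (X M), the exponent as a real
  number. Rectangular \<open>U\<close> are allowed because the exponent is also needed for
  \<open>P v ** U\<close>.\<close>

definition row_weight :: "('n::finite \<Rightarrow> real) \<Rightarrow> complex^'n^'m \<Rightarrow> 'm \<Rightarrow> real" where
  "row_weight t U i = (\<Sum>k\<in>UNIV. t k * (cmod (U $ i $ k))\<^sup>2)"

definition weight :: "('m::finite \<Rightarrow> real) \<Rightarrow> ('n::finite \<Rightarrow> real) \<Rightarrow> complex^'n^'m \<Rightarrow> real" where
  "weight x t U = (\<Sum>i\<in>UNIV. x i * row_weight t U i)"

definition row_pairing :: "('n::finite \<Rightarrow> real) \<Rightarrow> complex^'n^'m \<Rightarrow> 'm \<Rightarrow> 'm \<Rightarrow> complex" where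
  "row_pairing t U c i = (\<Sum>k\<in>UNIV. t k * (U $ c $ k * cnj (U $ i $ k)))"

definition plane_rotation :: "'m::finite \<Rightarrow> 'm \<Rightarrow> real \<Rightarrow> real \<Rightarrow> complex^'m^'m" where
  "plane_rotation c i u v = (\<chi> a b.
     if a = c then (if b = c then of_real u else if b = i then of_real v else 0)
     else if a = i then (if b = i then of_real u else if b = c then - of_real v else 0)
     else if a = b then 1 else 0)"

lemma plane_rotation_mult:
  assumes "c \<noteq> i"
  shows "(plane_rotation c i u v ** U) $ a $ k =
    (if a = c then of_real u * U $ c $ k + of_real v * U $ i $ k
     else if a = i then of_real u * U $ i $ k - of_real v * U $ c $ k else U $ a $ k)"
proof -
  have two: "(\<Sum>b\<in>UNIV. (if b = p then r else if b = q then s else 0) * U $ b $ k)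
      = r * U $ p $ k + s * U $ q $ k" if "p \<noteq> q" for p q r s
  proof -
    have "(\<Sum>b\<in>UNIV. (if b = p then r else if b = q then s else 0) * U $ b $ k)
       = (\<Sum>b\<in>UNIV. (if b = p then r * U $ p $ k else 0) + (if b = q then s * U $ q $ k else 0))"
      by (rule sum.cong) (use that in auto)
    then show ?thesis by (simp add: sum.distrib)
  qed
  have one: "(\<Sum>b\<in>UNIV. (if a = b then 1 else 0) * U $ b $ k) = U $ a $ k"
  proof -
    have "(\<Sum>b\<in>UNIV. (if a = b then 1 else 0) * U $ b $ k) = (\<Sum>b\<in>UNIV. if a = b then U $ b $ k else 0)"
      by (rule sum.cong) auto
    then show ?thesis by simp
  qed
  consider "a = c" | "a = i" | "a \<noteq> c" "a \<noteq> i" by blast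
  then show ?thesis
  proof cases
    case 1
    then show ?thesis
      using two[OF assms, of "of_real u" "of_real v"]
      by (simp add: matrix_matrix_mult_def plane_rotation_def)
  next
    case 2
    then show ?thesis
      using two[OF assms[symmetric], of "of_real u" "- of_real v"] assms
      by (simp add: matrix_matrix_mult_def plane_rotation_def)
  next
    case 3
    then show ?thesis
      using one by (simp add: matrix_matrix_mult_def plane_rotation_def)
  qed
qed

lemma plane_rotation_unitary:
  assumes "c \<noteq> i" "u\<^sup>2 + v\<^sup>2 = 1"
  shows "plane_rotation c i u v \<in> unitary_group"
proof (rule unitary_groupI)
  have "herm_conj (plane_rotation c i u v) = plane_rotation c i u (- v)"
    using assms by (auto simp: vec_eq_iff plane_rotation_def)
  moreover have "plane_rotation c i u (- v) ** plane_rotation c i u v = mat 1"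
  proof -
    have 1: "complex_of_real u * complex_of_real u + complex_of_real v * complex_of_real v = 1"
      using assms(2) by (metis of_real_1 of_real_add of_real_mult power2_eq_square)
    show ?thesis
      unfolding vec_eq_iff plane_rotation_mult[OF assms(1)]
      using assms 1 by (auto simp: plane_rotation_def mat_def algebra_simps)
  qed
  ultimately show "herm_conj (plane_rotation c i u v) ** plane_rotation c i u v = mat 1"
    by simp
qed

definition phase :: "'m::finite \<Rightarrow> complex^'m^'m" where
  "phase c = (\<chi> a b. if a = b then if a = c then \<i> else 1 else 0)"

lemma phase_mult: "(phase c ** U) $ a $ k = (if a = c then \<i> * U $ a $ k else U $ a $ k)"
proof -
  have "(phase c ** U) $ a $ k = (\<Sum>b\<in>UNIV. if a = b then (if a = c then \<i> else 1) * U $ b $ k else 0)"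
    unfolding matrix_matrix_mult_def phase_def vec_lambda_beta by (rule sum.cong) auto
  then show ?thesis by simp
qed

lemma phase_unitary: "phase c \<in> unitary_group"
proof (rule unitary_groupI)
  have "(herm_conj (phase c) ** phase c) $ a $ k = mat 1 $ a $ k" for a k
  proof -
    have "(herm_conj (phase c) ** phase c) $ a $ k =
        (\<Sum>b\<in>UNIV. if b = a then (if a = k then 1 else 0) else 0)"
      unfolding matrix_matrix_mult_def vec_lambda_beta by (rule sum.cong) (auto simp: phase_def)
    then show ?thesis by (simp add: mat_def)
  qed
  then show "herm_conj (phase c) ** phase c = mat 1" by (simp add: vec_eq_iff)
qed

lemma continuous_on_weight [continuous_intros]:
  assumes "continuous_on S f"
  shows "continuous_on S (\<lambda>z. weight x t (f z))"
  unfolding weight_def row_weight_def by (intro continuous_intros assms)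

lemma weight_split:
  fixes x :: "'m::finite \<Rightarrow> real"
  assumes "c \<noteq> i"
  shows "weight x t U = x c * row_weight t U c + x i * row_weight t U i
    + (\<Sum>a\<in>- {c, i}. x a * row_weight t U a)"
proof -
  have "(UNIV :: 'm set) = insert c (insert i (- {c, i}))" by auto
  then have "weight x t U = (\<Sum>a\<in>insert c (insert i (- {c, i})). x a * row_weight t U a)"
    unfolding weight_def by simp
  then show ?thesis using assms by simp
qed

text \<open>Along the rotation the derivative of row \<open>c\<close> is row \<open>i\<close>, that
  of row \<open>i\<close> is minus row \<open>c\<close>, and the other rows are fixed.\<close>

lemma rotated_weight_has_derivative:
  fixes U :: "complex^'n^'m"
  assumes "c \<noteq> i"
  defines "V \<equiv> \<lambda>\<theta>. plane_rotation c i (cos \<theta>) (sin \<theta>) ** U"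
  shows "((\<lambda>\<theta>. weight x t (V \<theta>)) has_real_derivative
     2 * (x c - x i) * Re (row_pairing t (V \<theta>) c i)) (at \<theta>)"
    and "((\<lambda>\<theta>. Re (V \<theta> $ c $ j * cnj (V \<theta> $ i $ j))) has_real_derivative
     (cmod (V \<theta> $ i $ j))\<^sup>2 - (cmod (V \<theta> $ c $ j))\<^sup>2) (at \<theta>)"
proof -
  have gen: "Re ((plane_rotation c i u v ** U) $ c $ k) = u * Re (U $ c $ k) + v * Re (U $ i $ k)"
      "Im ((plane_rotation c i u v ** U) $ c $ k) = u * Im (U $ c $ k) + v * Im (U $ i $ k)"
      "Re ((plane_rotation c i u v ** U) $ i $ k) = u * Re (U $ i $ k) - v * Re (U $ c $ k)"
      "Im ((plane_rotation c i u v ** U) $ i $ k) = u * Im (U $ i $ k) - v * Im (U $ c $ k)" for u v k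
    using assms(1) by (simp_all add: plane_rotation_mult)
  have c: "Re (V \<theta> $ c $ k) = cos \<theta> * Re (U $ c $ k) + sin \<theta> * Re (U $ i $ k)"
      "Im (V \<theta> $ c $ k) = cos \<theta> * Im (U $ c $ k) + sin \<theta> * Im (U $ i $ k)" for \<theta> k
    unfolding V_def using gen by auto
  have i: "Re (V \<theta> $ i $ k) = cos \<theta> * Re (U $ i $ k) - sin \<theta> * Re (U $ c $ k)"
      "Im (V \<theta> $ i $ k) = cos \<theta> * Im (U $ i $ k) - sin \<theta> * Im (U $ c $ k)" for \<theta> k
    unfolding V_def using gen by auto
  have a: "a \<notin> {c, i} \<Longrightarrow> V \<theta> $ a $ k = U $ a $ k" for \<theta> a k
    using assms by (auto simp: plane_rotation_mult)
  have dc: "((\<lambda>\<theta>. (cmod (V \<theta> $ c $ k))\<^sup>2) has_real_derivative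
      2 * Re (V \<theta> $ c $ k * cnj (V \<theta> $ i $ k))) (at \<theta>)" for k
    unfolding cmod_power2 times_complex.simps cnj.simps c i
    by (auto intro!: derivative_eq_intros simp: algebra_simps)
  have di: "((\<lambda>\<theta>. (cmod (V \<theta> $ i $ k))\<^sup>2) has_real_derivative
      - 2 * Re (V \<theta> $ c $ k * cnj (V \<theta> $ i $ k))) (at \<theta>)" for k
    unfolding cmod_power2 times_complex.simps cnj.simps c i
    by (auto intro!: derivative_eq_intros simp: algebra_simps)
  show "((\<lambda>\<theta>. Re (V \<theta> $ c $ j * cnj (V \<theta> $ i $ j))) has_real_derivative
     (cmod (V \<theta> $ i $ j))\<^sup>2 - (cmod (V \<theta> $ c $ j))\<^sup>2) (at \<theta>)"
    unfolding cmod_power2 times_complex.simps cnj.simps c i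
    by (auto intro!: derivative_eq_intros simp: algebra_simps power2_eq_square)
  have ra: "row_weight t (V \<theta>) a = row_weight t U a" if "a \<notin> {c, i}" for \<theta> a
    unfolding row_weight_def using a[OF that] by simp
  have 1: "weight x t (V \<theta>) = x c * row_weight t (V \<theta>) c + x i * row_weight t (V \<theta>) i
    + (\<Sum>a\<in>- {c, i}. x a * row_weight t U a)" for \<theta>
    unfolding weight_split[OF assms(1)] by (simp add: ra)
  have "((\<lambda>\<theta>. row_weight t (V \<theta>) c) has_real_derivative 2 * Re (row_pairing t (V \<theta>) c i)) (at \<theta>)"
    unfolding row_weight_def row_pairing_def
    by (rule derivative_eq_intros dc refl)+ (simp add: sum_distrib_left algebra_simps)
  moreover have "((\<lambda>\<theta>. row_weight t (V \<theta>) i) has_real_derivative - 2 * Re (row_pairing t (V \<theta>) c i)) (at \<theta>)"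
    unfolding row_weight_def row_pairing_def
    by (rule derivative_eq_intros di refl)+ (simp add: sum_distrib_left sum_negf algebra_simps)
  ultimately show "((\<lambda>\<theta>. weight x t (V \<theta>)) has_real_derivative
     2 * (x c - x i) * Re (row_pairing t (V \<theta>) c i)) (at \<theta>)"
    unfolding 1 by (auto intro!: derivative_eq_intros simp: algebra_simps)
qed

text \<open>This is entry (i, i) of M P_j = t_j P_j, where P_j projects onto column \<open>j\<close>
  of \<open>U\<close> and has the entries \<open>U $ c $ j * cnj (U $ i $ j)\<close>. The summand c
  = i is split off because a rotation needs two different rows.\<close>

lemma sum_row_pairing:
  assumes "U \<in> unitary_group"
  shows "t j * (cmod (U $ i $ j))\<^sup>2 = row_weight t U i * (cmod (U $ i $ j))\<^sup>2 +
    (\<Sum>c\<in>- {i}. Re (cnj (row_pairing t U c i) * (U $ c $ j * cnj (U $ i $ j))))"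
proof -
  have "(\<Sum>c\<in>UNIV. cnj (row_pairing t U c i) * (U $ c $ j * cnj (U $ i $ j)))
      = (\<Sum>c\<in>UNIV. \<Sum>k\<in>UNIV. t k * U $ i $ k * cnj (U $ i $ j) * (cnj (U $ c $ k) * U $ c $ j))"
    by (simp add: row_pairing_def sum_distrib_left sum_distrib_right mult_ac)
  also have "\<dots> = (\<Sum>k\<in>UNIV. t k * U $ i $ k * cnj (U $ i $ j) * (\<Sum>c\<in>UNIV. cnj (U $ c $ k) * U $ c $ j))"
    by (subst sum.swap) (simp add: sum_distrib_left)
  also have "\<dots> = (\<Sum>k\<in>UNIV. if k = j then t k * U $ i $ k * cnj (U $ i $ j) else 0)"
    unfolding unitary_columns[OF assms] by (rule sum.cong) auto
  also have "\<dots> = complex_of_real (t j * (cmod (U $ i $ j))\<^sup>2)"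
    by (simp add: mult.assoc flip: complex_norm_square)
  finally have "t j * (cmod (U $ i $ j))\<^sup>2 =
      (\<Sum>c\<in>UNIV. Re (cnj (row_pairing t U c i) * (U $ c $ j * cnj (U $ i $ j))))"
    by (metis Re_complex_of_real Re_sum)
  also have "\<dots> = Re (cnj (row_pairing t U i i) * (U $ i $ j * cnj (U $ i $ j))) +
     (\<Sum>c\<in>- {i}. Re (cnj (row_pairing t U c i) * (U $ c $ j * cnj (U $ i $ j))))"
    by (subst sum.remove[of UNIV i]) (auto simp: Compl_eq_Diff_UNIV)
  also have "row_pairing t U i i = complex_of_real (row_weight t U i)"
    unfolding row_pairing_def row_weight_def
    by (simp only: of_real_sum of_real_mult complex_norm_square)
  also have "Re (cnj (complex_of_real (row_weight t U i)) * (U $ i $ j * cnj (U $ i $ j))) =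
      row_weight t U i * (cmod (U $ i $ j))\<^sup>2"
    by (simp flip: complex_norm_square)
  finally show ?thesis .
qed

context haar
begin

definition Zint :: "('m \<Rightarrow> real) \<Rightarrow> ('m \<Rightarrow> real) \<Rightarrow> real" where
  "Zint t x = (LINT U|\<mu>. exp (weight x t U))"

definition Yint :: "('m \<Rightarrow> real) \<Rightarrow> 'm \<Rightarrow> 'm \<Rightarrow> ('m \<Rightarrow> real) \<Rightarrow> real" where
  "Yint t i j x = (LINT U|\<mu>. (cmod (U $ i $ j))\<^sup>2 * exp (weight x t U))"

lemma sum_Yint_row: "(\<Sum>j\<in>UNIV. Yint t i j x) = Zint t x"
proof -
  have "(\<Sum>j\<in>UNIV. Yint t i j x) = (LINT U|\<mu>. (\<Sum>j\<in>UNIV. (cmod (U $ i $ j))\<^sup>2 * exp (weight x t U)))"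
    unfolding Yint_def
    by (rule Bochner_Integration.integral_sum[symmetric]) (intro integrable_haar continuous_intros)
  also have "\<dots> = Zint t x"
    unfolding Zint_def
    by (rule Bochner_Integration.integral_cong) (auto simp: unitary_row_norm simp flip: sum_distrib_right)
  finally show ?thesis .
qed

lemma sum_Yint_column: "(\<Sum>i\<in>UNIV. Yint t i j x) = Zint t x"
proof -
  have "(\<Sum>i\<in>UNIV. Yint t i j x) = (LINT U|\<mu>. (\<Sum>i\<in>UNIV. (cmod (U $ i $ j))\<^sup>2 * exp (weight x t U)))"
    unfolding Yint_def
    by (rule Bochner_Integration.integral_sum[symmetric]) (intro integrable_haar continuous_intros)
  also have "\<dots> = Zint t x"
    unfolding Zint_def
    by (rule Bochner_Integration.integral_cong) (auto simp: unitary_column_norm simp flip: sum_distrib_right)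
  finally show ?thesis .
qed

text \<open>By left invariance the expectation of \<open>g (R \<theta> ** U)\<close> is constant in
  the angle. Its derivative at 0 has one part from the bilinear factor, which gives the two
  \<open>Yint\<close>, and one from the exponent, which gives the factor x c - x i.\<close>

lemma rotation_identity:
  assumes "c \<noteq> i"
  shows "Yint t i j x - Yint t c j x = 2 * (x i - x c) *
    (LINT U|\<mu>. Re (row_pairing t U c i) * Re (U $ c $ j * cnj (U $ i $ j)) * exp (weight x t U))"
proof -
  define R where "R \<theta> = plane_rotation c i (cos \<theta>) (sin \<theta>)" for \<theta>
  define g where "g U = Re (U $ c $ j * cnj (U $ i $ j)) * exp (weight x t U)" for U :: "complex^'m^'m"
  define g' where "g' U = ((cmod (U $ i $ j))\<^sup>2 - (cmod (U $ c $ j))\<^sup>2) * exp (weight x t U) +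
    2 * (x c - x i) * (Re (row_pairing t U c i) * Re (U $ c $ j * cnj (U $ i $ j)) * exp (weight x t U))"
    for U :: "complex^'m^'m"
  have cont_R: "continuous_on UNIV (\<lambda>(\<theta>, U :: complex^'m^'m). R \<theta> ** U)"
  proof -
    have eq: "(\<lambda>(\<theta>, U :: complex^'m^'m). R \<theta> ** U) = (\<lambda>p. \<chi> a k.
        if a = c then of_real (cos (fst p)) * snd p $ c $ k + of_real (sin (fst p)) * snd p $ i $ k
        else if a = i then of_real (cos (fst p)) * snd p $ i $ k - of_real (sin (fst p)) * snd p $ c $ k
        else snd p $ a $ k)"
      by (auto simp: fun_eq_iff vec_eq_iff R_def plane_rotation_mult[OF assms])
    have cont: "continuous_on UNIV (\<lambda>p :: real \<times> (complex^'m^'m).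
        if a = c then of_real (cos (fst p)) * snd p $ c $ k + of_real (sin (fst p)) * snd p $ i $ k
        else if a = i then of_real (cos (fst p)) * snd p $ i $ k - of_real (sin (fst p)) * snd p $ c $ k
        else snd p $ a $ k)" for a k
    proof -
      consider "a = c" | "a = i" "a \<noteq> c" | "a \<noteq> c" "a \<noteq> i" by blast
      then show ?thesis
        by cases (simp_all only: if_True if_False refl, (intro continuous_intros)+)
    qed
    show ?thesis
      unfolding eq by (rule continuous_on_vec_lambda)+ (rule cont)
  qed
  have cont_g: "continuous_on UNIV g" and cont_g': "continuous_on UNIV g'"
    unfolding g_def g'_def row_pairing_def by (intro continuous_intros)+
  have "((\<lambda>\<theta>. LINT U|\<mu>. g (R \<theta> ** U)) has_real_derivative (LINT U|\<mu>. g' (R 0 ** U))) (at 0)"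
  proof (rule expectation_has_derivative)
    show "continuous_on UNIV (\<lambda>(\<theta>, U). g' (R \<theta> ** U))"
      using continuous_on_compose2[OF cont_g' cont_R] by (simp add: case_prod_beta)
    show "continuous_on UNIV (\<lambda>U. g (R \<theta> ** U))" for \<theta>
      by (rule continuous_on_compose2[OF cont_g])
         (auto simp: matrix_matrix_mult_def intro!: continuous_intros)
    show "((\<lambda>\<theta>. g (R \<theta> ** U)) has_real_derivative g' (R \<theta> ** U)) (at \<theta>)" for \<theta> U
      unfolding g_def g'_def R_def
      by (rule derivative_eq_intros rotated_weight_has_derivative[OF assms] refl)+
         (simp add: algebra_simps)
  qed
  moreover have "(LINT U|\<mu>. g (R \<theta> ** U)) = (LINT U|\<mu>. g U)" for \<theta>
    unfolding R_def
    by (intro integral_left_mult plane_rotation_unitary assms continuous_measurable_haar cont_g) simp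
  ultimately have "((\<lambda>\<theta>. LINT U|\<mu>. g U) has_real_derivative (LINT U|\<mu>. g' (R 0 ** U))) (at 0)"
    by simp
  then have "(LINT U|\<mu>. g' (R 0 ** U)) = 0"
    by (rule DERIV_unique[OF _ DERIV_const])
  moreover have "(LINT U|\<mu>. g' (R 0 ** U)) = (LINT U|\<mu>. g' U)"
    unfolding R_def
    by (intro integral_left_mult plane_rotation_unitary assms continuous_measurable_haar cont_g') simp
  ultimately have "(LINT U|\<mu>. g' U) = 0" by simp
  moreover have "(LINT U|\<mu>. g' U) = Yint t i j x - Yint t c j x + 2 * (x c - x i) *
    (LINT U|\<mu>. Re (row_pairing t U c i) * Re (U $ c $ j * cnj (U $ i $ j)) * exp (weight x t U))"
  proof -
    have *: "integrable \<mu> (\<lambda>U. (cmod (U $ i $ j))\<^sup>2 * exp (weight x t U))" for i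
      by (intro integrable_haar continuous_intros)
    have **: "integrable \<mu> (\<lambda>U. Re (row_pairing t U c i) * Re (U $ c $ j * cnj (U $ i $ j)) * exp (weight x t U))"
      unfolding row_pairing_def by (intro integrable_haar continuous_intros)
    show ?thesis
      unfolding g'_def Yint_def left_diff_distrib
      by (subst Bochner_Integration.integral_add Bochner_Integration.integral_diff
            integral_mult_right_zero; (intro Bochner_Integration.integrable_diff integrable_mult_right * **)?)+
         simp
  qed
  ultimately show ?thesis by (simp add: algebra_simps)
qed

text \<open>Multiplying row \<open>c\<close> by the imaginary unit keeps the weight and replaces the
  real parts of both factors by negated imaginary parts; the signs cancel.\<close>

lemma phase_identity:
  assumes "c \<noteq> i"
  shows "(LINT U|\<mu>. Im (row_pairing t U c i) * Im (U $ c $ j * cnj (U $ i $ j)) * exp (weight x t U)) =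
    (LINT U|\<mu>. Re (row_pairing t U c i) * Re (U $ c $ j * cnj (U $ i $ j)) * exp (weight x t U))"
proof -
  define g where "g U = Re (row_pairing t U c i) * Re (U $ c $ j * cnj (U $ i $ j)) * exp (weight x t U)"
    for U :: "complex^'m^'m"
  have cont_g: "continuous_on UNIV g"
    unfolding g_def row_pairing_def by (intro continuous_intros)+
  have "g (phase c ** U) =
      Im (row_pairing t U c i) * Im (U $ c $ j * cnj (U $ i $ j)) * exp (weight x t U)" for U
  proof -
    have "weight x t (phase c ** U) = weight x t U"
    proof -
      have "cmod ((phase c ** U) $ a $ k) = cmod (U $ a $ k)" for a k
        by (simp add: phase_mult norm_mult)
      then show ?thesis by (simp add: weight_def row_weight_def)
    qed
    moreover have "row_pairing t (phase c ** U) c i = \<i> * row_pairing t U c i"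
      using assms by (simp add: row_pairing_def phase_mult sum_distrib_left mult_ac)
    ultimately show ?thesis
      using assms by (simp add: g_def phase_mult mult.assoc algebra_simps)
  qed
  moreover have "(LINT U|\<mu>. g (phase c ** U)) = (LINT U|\<mu>. g U)"
    by (intro integral_left_mult phase_unitary continuous_measurable_haar cont_g)
  ultimately show ?thesis by (simp add: g_def)
qed

text \<open>The matrix of expectations \<open>Yint t i j\<close> solves a first-order system: \<open>M P\<^sub>j = t\<^sub>j P\<^sub>j\<close> for
  \<open>M = U T U\<^sup>\<dagger>\<close> and the spectral projections \<open>P\<^sub>j\<close>, and the off-diagonal terms of this matrix product
  are evaluated by invariance under rotations in coordinate planes.\<close>

lemma Yint_has_derivative:
  assumes x: "inj x"
  shows "((\<lambda>h. Yint t i j (x(i := h))) has_real_derivative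
    t j * Yint t i j x - (\<Sum>c\<in>- {i}. inverse (x i - x c) * (Yint t i j x - Yint t c j x))) (at (x i))"
proof -
  define f where "f h U = (cmod (U $ i $ j))\<^sup>2 * exp (weight (x(i := h)) t U)" for h and U :: "complex^'m^'m"
  define f' where "f' h U = row_weight t U i * (cmod (U $ i $ j))\<^sup>2 * exp (weight (x(i := h)) t U)"
    for h and U :: "complex^'m^'m"
  have upd: "weight (x(i := h)) t U = h * row_weight t U i + (\<Sum>a\<in>- {i}. x a * row_weight t U a)"
    for h and U :: "complex^'m^'m"
    unfolding weight_def by (subst sum.remove[of UNIV i]) (auto simp: Compl_eq_Diff_UNIV)
  have "((\<lambda>h. LINT U|\<mu>. f h U) has_real_derivative (LINT U|\<mu>. f' (x i) U)) (at (x i))"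
  proof (rule expectation_has_derivative)
    show "continuous_on UNIV (f h)" for h
      unfolding f_def by (intro continuous_intros)
    show "continuous_on UNIV (\<lambda>(h, U). f' h U)"
      unfolding f'_def upd row_weight_def case_prod_beta by (intro continuous_intros)
    show "((\<lambda>h. f h U) has_real_derivative f' h U) (at h)" for h U
      unfolding f_def f'_def upd by (auto intro!: derivative_eq_intros)
  qed
  moreover have double: "E + E = inverse d * (2 * d * E)" if "d \<noteq> 0" for d E :: real
    using that by simp
  moreover have "(LINT U|\<mu>. f' (x i) U) =
    t j * Yint t i j x - (\<Sum>c\<in>- {i}. inverse (x i - x c) * (Yint t i j x - Yint t c j x))"
  proof -
    \<comment> \<open>\<open>A\<close> and \<open>B\<close> come from Re (cnj p * q) = Re p * Re q +
      Im p * Im q. By \<open>phase_identity\<close> their expectations agree, which matches the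
      factor 2 in \<open>rotation_identity\<close>.\<close>
    define A where "A c U = Re (row_pairing t U c i) * Re (U $ c $ j * cnj (U $ i $ j)) * exp (weight x t U)"
      for c and U :: "complex^'m^'m"
    define B where "B c U = Im (row_pairing t U c i) * Im (U $ c $ j * cnj (U $ i $ j)) * exp (weight x t U)"
      for c and U :: "complex^'m^'m"
    have int: "integrable \<mu> (A c)" "integrable \<mu> (B c)" for c
      unfolding A_def B_def row_pairing_def by (intro integrable_haar continuous_intros)+
    have intY: "integrable \<mu> (\<lambda>U. (cmod (U $ i $ j))\<^sup>2 * exp (weight x t U))"
      by (intro integrable_haar continuous_intros)
    have "(LINT U|\<mu>. f' (x i) U) =
       (LINT U|\<mu>. t j * ((cmod (U $ i $ j))\<^sup>2 * exp (weight x t U)) - (\<Sum>c\<in>- {i}. A c U + B c U))"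
    proof (rule Bochner_Integration.integral_cong[OF refl])
      fix U assume "U \<in> space \<mu>"
      then have "t j * (cmod (U $ i $ j))\<^sup>2 = row_weight t U i * (cmod (U $ i $ j))\<^sup>2 +
         (\<Sum>c\<in>- {i}. Re (cnj (row_pairing t U c i) * (U $ c $ j * cnj (U $ i $ j))))"
        by (intro sum_row_pairing) simp
      then have "f' (x i) U = (t j * (cmod (U $ i $ j))\<^sup>2 -
         (\<Sum>c\<in>- {i}. Re (cnj (row_pairing t U c i) * (U $ c $ j * cnj (U $ i $ j))))) * exp (weight x t U)"
        by (simp add: f'_def)
      also have "\<dots> = t j * ((cmod (U $ i $ j))\<^sup>2 * exp (weight x t U)) -
         (\<Sum>c\<in>- {i}. Re (cnj (row_pairing t U c i) * (U $ c $ j * cnj (U $ i $ j))) * exp (weight x t U))"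
        by (simp only: left_diff_distrib sum_distrib_right mult.assoc)
      also have "(\<Sum>c\<in>- {i}. Re (cnj (row_pairing t U c i) * (U $ c $ j * cnj (U $ i $ j))) * exp (weight x t U))
         = (\<Sum>c\<in>- {i}. A c U + B c U)"
        by (rule sum.cong) (auto simp: A_def B_def algebra_simps)
      finally show "f' (x i) U =
        t j * ((cmod (U $ i $ j))\<^sup>2 * exp (weight x t U)) - (\<Sum>c\<in>- {i}. A c U + B c U)" .
    qed
    also have "\<dots> = t j * Yint t i j x - (\<Sum>c\<in>- {i}. (LINT U|\<mu>. A c U) + (LINT U|\<mu>. B c U))"
      unfolding Yint_def using int intY by simp
    also have "(\<Sum>c\<in>- {i}. (LINT U|\<mu>. A c U) + (LINT U|\<mu>. B c U)) =
        (\<Sum>c\<in>- {i}. inverse (x i - x c) * (Yint t i j x - Yint t c j x))"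
    proof (rule sum.cong[OF refl])
      fix c assume "c \<in> - {i}"
      then have "c \<noteq> i" "x i - x c \<noteq> 0" using x by (auto simp: inj_def)
      then show "(LINT U|\<mu>. A c U) + (LINT U|\<mu>. B c U) =
          inverse (x i - x c) * (Yint t i j x - Yint t c j x)"
        unfolding rotation_identity[OF \<open>c \<noteq> i\<close>] A_def B_def phase_identity[OF \<open>c \<noteq> i\<close>]
        by (intro double) simp
    qed
    finally show ?thesis .
  qed
  ultimately show ?thesis by (simp add: f_def Yint_def)
qed

end

section \<open>The partition function as an exponential sum in one variable\<close>

lemma det_row_has_derivative:
  fixes A :: "real^'m^'m"
  assumes "\<And>k. ((\<lambda>h. r h k) has_real_derivative r' k) (at a)"
  shows "((\<lambda>h. det (\<chi> b k. if b = i then r h k else A $ b $ k)) has_real_derivative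
    det (\<chi> b k. if b = i then r' k else A $ b $ k)) (at a)"
proof -
  have prod: "(\<Prod>b\<in>UNIV. (\<chi> b k. if b = i then s k else A $ b $ k) $ b $ p b) =
      s (p i) * (\<Prod>b\<in>- {i}. A $ b $ p b)" for s p
    by (subst prod.remove[of UNIV i]) (auto simp: Compl_eq_Diff_UNIV intro!: prod.cong)
  show ?thesis
    unfolding det_def prod by (rule DERIV_sum) (auto intro!: derivative_eq_intros assms)
qed

lemma continuous_on_det [continuous_intros]:
  fixes f :: "'a::topological_space \<Rightarrow> real^'m^'m"
  assumes "continuous_on S f"
  shows "continuous_on S (\<lambda>z. det (f z))"
  unfolding det_def by (intro continuous_intros assms)

lemma prod_diff_has_derivative:
  fixes x :: "'m \<Rightarrow> real"
  assumes "finite S" "w \<notin> x ` S"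
  shows "((\<lambda>h. \<Prod>j\<in>S. h - x j) has_real_derivative
     (\<Prod>j\<in>S. w - x j) * (\<Sum>j\<in>S. inverse (w - x j))) (at w)"
  using assms
proof (induction S)
  case (insert r S)
  then have "w \<noteq> x r" by auto
  have IH: "((\<lambda>h. \<Prod>j\<in>S. h - x j) has_real_derivative
     (\<Prod>j\<in>S. w - x j) * (\<Sum>j\<in>S. inverse (w - x j))) (at w)"
    using insert by auto
  have "((\<lambda>h. (h - x r) * (\<Prod>j\<in>S. h - x j)) has_real_derivative
      1 * (\<Prod>j\<in>S. w - x j)
       + ((\<Prod>j\<in>S. w - x j) * (\<Sum>j\<in>S. inverse (w - x j))) * (w - x r)) (at w)"
    by (rule DERIV_mult[OF _ IH]) (auto intro!: derivative_eq_intros)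
  moreover have "1 * p + (p * s) * d = (d * p) * (inverse d + s)" if "d \<noteq> 0" for d p s :: real
    using that by (simp add: distrib_left mult_ac)
  ultimately show ?case
    using insert.hyps \<open>w \<noteq> x r\<close> by simp
qed auto

lemma card_roots_le_degree:
  fixes p :: "real poly"
  assumes "p \<noteq> 0" "\<And>a. a \<in> A \<Longrightarrow> poly p a = 0"
  shows "card A \<le> degree p"
proof -
  have "card A \<le> card {a. poly p a = 0}"
    using assms by (intro card_mono poly_roots_finite) auto
  also have "\<dots> \<le> degree p"
    by (rule card_poly_roots_bound[OF assms(1)])
  finally show ?thesis .
qed

section \<open>Vandermonde determinants with exponential factors in the rows\<close>

definition pos :: "'m::finite \<Rightarrow> nat" where
  "pos = (SOME f. bij_betw f UNIV {..<CARD('m)})"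

lemma bij_pos: "bij_betw (pos :: 'm::finite \<Rightarrow> nat) UNIV {..<CARD('m)}"
proof -
  have "\<exists>f :: 'm \<Rightarrow> nat. bij_betw f UNIV {..<CARD('m)}"
    using ex_bij_betw_finite_nat[of "UNIV :: 'm set"] by (auto simp: atLeast0LessThan)
  then show ?thesis
    unfolding pos_def by (rule someI_ex)
qed

lemma pos_less: "pos (k :: 'm::finite) < CARD('m)"
  using bij_betwE[OF bij_pos] by auto

lemma inj_pos: "inj (pos :: 'm::finite \<Rightarrow> nat)"
  using bij_pos by (rule bij_betw_imp_inj_on)

text \<open>Row \<open>i\<close> of the determinant \<open>vdet w Q x\<close> is \<open>x\<^sub>i\<^sup>k exp (x\<^sub>i w\<^sub>i)\<close>, differentiated in \<open>x\<^sub>i\<close> if \<open>i \<in> Q\<close>.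
  The index type is not ordered, so \<open>pos\<close> numbers it arbitrarily.\<close>

definition vrow :: "'m set \<Rightarrow> 'm \<Rightarrow> real \<Rightarrow> real \<Rightarrow> 'm::finite \<Rightarrow> real" where
  "vrow Q i w h k =
     (if i \<in> Q then of_nat (pos k) * h ^ (pos k - 1) + w * h ^ pos k else h ^ pos k) * exp (h * w)"

definition vdet :: "('m::finite \<Rightarrow> real) \<Rightarrow> 'm set \<Rightarrow> ('m \<Rightarrow> real) \<Rightarrow> real" where
  "vdet w Q x = det (\<chi> i k. vrow Q i (w i) (x i) k)"

abbreviation vandermonde :: "('m::finite \<Rightarrow> real) \<Rightarrow> real" where
  "vandermonde x \<equiv> vdet (\<lambda>_. 0) {} x"

lemma vdet_empty: "vdet w {} x = vandermonde x * exp (\<Sum>i\<in>UNIV. x i * w i)"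
proof -
  have "(\<chi> i k. vrow {} i (w i) (x i) k) = (\<chi> i. exp (x i * w i) *s (\<chi> k. vrow {} i 0 (x i) k))"
    by (simp add: vec_eq_iff vrow_def)
  then have "vdet w {} x = det (\<chi> i. exp (x i * w i) *s (\<chi> k. vrow {} i 0 (x i) k))"
    by (simp only: vdet_def)
  then show ?thesis
    unfolding det_rows_mul by (simp add: vdet_def exp_sum mult.commute)
qed

lemma vdet_has_derivative:
  assumes "i \<notin> Q"
  shows "((\<lambda>h. vdet w Q (x(i := h))) has_real_derivative vdet w (insert i Q) (x(i := a))) (at a)"
proof -
  define A where "A = (\<chi> b k. vrow Q b (w b) (x b) k)"
  have 1: "vdet w Q (x(i := h)) = det (\<chi> b k. if b = i then vrow Q i (w i) h k else A $ b $ k)" for h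
    unfolding vdet_def A_def by (rule arg_cong[of _ _ det]) (auto simp: vec_eq_iff)
  have 2: "vdet w (insert i Q) (x(i := a)) =
      det (\<chi> b k. if b = i then vrow (insert i Q) i (w i) a k else A $ b $ k)"
    unfolding vdet_def A_def by (rule arg_cong[of _ _ det]) (auto simp: vec_eq_iff vrow_def)
  have "((\<lambda>h. vrow Q i (w i) h k) has_real_derivative vrow (insert i Q) i (w i) a k) (at a)" for k
    unfolding vrow_def using assms by (auto intro!: derivative_eq_intros simp: algebra_simps)
  then show ?thesis
    unfolding 1 2 by (rule det_row_has_derivative)
qed

text \<open>A kernel vector consists of the coefficients of a polynomial of degree below
  \<open>CARD('m)\<close> with \<open>CARD('m)\<close> distinct roots.\<close>

lemma vandermonde_nonzero:
  fixes x :: "'m::finite \<Rightarrow> real"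
  assumes "inj x"
  shows "vandermonde x \<noteq> 0"
proof -
  define A where "A = (\<chi> i k. x i ^ pos (k :: 'm))"
  have "v = 0" if "A *v v = 0" for v
  proof -
    define p where "p = (\<Sum>k\<in>UNIV. monom (v $ k) (pos k))"
    have "poly p (x i) = (A *v v) $ i" for i
      by (simp add: p_def A_def poly_sum poly_monom matrix_vector_mult_def mult.commute)
    then have roots: "poly p z = 0" if "z \<in> range x" for z
      using that \<open>A *v v = 0\<close> by auto
    have "degree (monom (v $ k) (pos k)) \<le> CARD('m) - 1" for k
      using pos_less[of k] degree_monom_le[of "v $ k" "pos k"] by linarith
    then have "degree p \<le> CARD('m) - 1"
      unfolding p_def by (intro degree_sum_le) auto
    then have deg: "degree p < CARD('m)"
      using zero_less_card_finite[where 'a = 'm] by linarith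
    have "p = 0"
    proof (rule ccontr)
      assume "p \<noteq> 0"
      then have "card (range x) \<le> degree p"
        using roots by (rule card_roots_le_degree)
      then show False
        using deg assms by (simp add: card_image)
    qed
    have "v $ k = coeff p (pos k)" for k
    proof -
      have "coeff p (pos k) = (\<Sum>l\<in>UNIV. if l = k then v $ l else 0)"
        unfolding p_def coeff_sum coeff_monom by (rule sum.cong) (use inj_pos in \<open>auto simp: inj_def\<close>)
      then show ?thesis by simp
    qed
    then show "v = 0"
      using \<open>p = 0\<close> by (simp add: vec_eq_iff)
  qed
  then have "invertible A"
    unfolding invertible_left_inverse matrix_left_invertible_ker by blast
  then have "det A \<noteq> 0"
    by (simp add: invertible_det_nz)
  then show ?thesis
    by (simp add: A_def vdet_def vrow_def)
qed

text \<open>As a polynomial in h the determinant has degree at most \<open>CARD('m) - 1\<close> and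
  vanishes at the other nodes, so only its leading coefficient is free. Distinctness is asked of the
  other nodes alone because h will run through all reals.\<close>

lemma vandermonde_upd:
  fixes x :: "'m::finite \<Rightarrow> real"
  assumes "inj_on x (- {i})"
  obtains \<kappa> where "\<And>h. vandermonde (x(i := h)) = \<kappa> * (\<Prod>c\<in>- {i}. h - x c)" "\<kappa> \<noteq> 0"
proof -
  define cof where "cof p = of_int (sign p) * (\<Prod>b\<in>- {i}. x b ^ pos (p b))" for p
  define P where "P = (\<Sum>p\<in>{p. p permutes (UNIV :: 'm set)}. monom (cof p) (pos (p i)))"
  have P: "poly P h = vandermonde (x(i := h))" for h
  proof -
    have "(\<Prod>b\<in>UNIV. (x(i := h)) b ^ pos (p b)) = h ^ pos (p i) * (\<Prod>b\<in>- {i}. x b ^ pos (p b))"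
      for p :: "'m \<Rightarrow> 'm"
      by (subst prod.remove[of UNIV i]) (auto simp: Compl_eq_Diff_UNIV intro!: prod.cong)
    then show ?thesis
      by (simp add: P_def cof_def vdet_def vrow_def det_def poly_sum poly_monom mult_ac)
  qed
  have "degree (monom (cof p) (pos (p i))) \<le> CARD('m) - 1" for p
    using pos_less[of "p i"] degree_monom_le[of "cof p" "pos (p i)"] by linarith
  then have deg_P: "degree P \<le> CARD('m) - 1"
    unfolding P_def by (intro degree_sum_le) auto
  have root: "poly P (x c) = 0" if "c \<noteq> i" for c
    unfolding P vdet_def by (rule det_identical_rows[of i c]) (use that in \<open>auto simp: vrow_def row_def\<close>)
  define q where "q = (\<Prod>c\<in>- {i}. [:- x c, 1:])"
  have card: "card (- {i}) = CARD('m) - 1"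
    by (simp add: Compl_eq_Diff_UNIV card_Diff_singleton)
  have q: "degree q = CARD('m) - 1" "lead_coeff q = 1"
  proof -
    show "degree q = CARD('m) - 1"
      by (simp add: q_def degree_prod_eq_sum_degree card)
    show "lead_coeff q = 1"
      unfolding q_def lead_coeff_prod by simp
  qed
  define \<kappa> where "\<kappa> = coeff P (CARD('m) - 1)"
  have "P - smult \<kappa> q = 0"
  proof (rule ccontr)
    assume nz: "P - smult \<kappa> q \<noteq> 0"
    have q_root: "poly q (x c) = 0" if "c \<noteq> i" for c
      using that by (auto simp: q_def poly_prod)
    have "poly (P - smult \<kappa> q) z = 0" if "z \<in> x ` (- {i})" for z
    proof -
      obtain c where "c \<noteq> i" "z = x c" using \<open>z \<in> x ` (- {i})\<close> by auto
      then show ?thesis using q_root root by simp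
    qed
    with nz have "card (x ` (- {i})) \<le> degree (P - smult \<kappa> q)"
      by (rule card_roots_le_degree)
    then have le: "CARD('m) - 1 \<le> degree (P - smult \<kappa> q)"
      using assms card by (simp add: card_image)
    have "degree (P - smult \<kappa> q) \<le> CARD('m) - 1"
      using deg_P q by (intro degree_diff_le) auto
    then have "degree (P - smult \<kappa> q) = CARD('m) - 1"
      using le by simp
    moreover have "coeff (P - smult \<kappa> q) (CARD('m) - 1) = 0"
      using q by (simp add: \<kappa>_def)
    ultimately show False
      using nz by (metis leading_coeff_0_iff)
  qed
  then have eq: "vandermonde (x(i := h)) = \<kappa> * (\<Prod>c\<in>- {i}. h - x c)" for h
    unfolding P[symmetric] by (simp add: q_def poly_prod)
  obtain h where "h \<notin> x ` (- {i})"
    using ex_new_if_finite[of "x ` (- {i})"] infinite_UNIV_char_0 by auto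
  then have "inj (x(i := h))"
    using assms by (auto simp: inj_def inj_on_def image_iff)
  then have "\<kappa> \<noteq> 0"
    using vandermonde_nonzero[of "x(i := h)"] eq[of h] by auto
  then show thesis using that eq by blast
qed

lemma vandermonde_has_derivative:
  fixes x :: "'m::finite \<Rightarrow> real"
  assumes "inj x"
  shows "((\<lambda>h. vandermonde (x(i := h))) has_real_derivative
     vandermonde x * (\<Sum>c\<in>- {i}. inverse (x i - x c))) (at (x i))"
proof -
  obtain \<kappa> where \<kappa>: "\<And>h. vandermonde (x(i := h)) = \<kappa> * (\<Prod>c\<in>- {i}. h - x c)"
    using vandermonde_upd[of x i] inj_on_subset[OF assms] by blast
  have "x i \<notin> x ` (- {i})" using assms by (auto simp: inj_def)
  then have "((\<lambda>h. \<Prod>c\<in>- {i}. h - x c) has_real_derivative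
     (\<Prod>c\<in>- {i}. x i - x c) * (\<Sum>c\<in>- {i}. inverse (x i - x c))) (at (x i))"
    by (intro prod_diff_has_derivative) auto
  from DERIV_cmult[OF this, of \<kappa>] show ?thesis
    unfolding \<kappa> using \<kappa>[of "x i"] by (simp add: mult.assoc)
qed

text \<open>Compare leading coefficients in Lagrange's interpolation formula at the nodes
  \<open>t\<close>.\<close>

lemma lagrange_lead_coeff:
  fixes t :: "'m::finite \<Rightarrow> real"
  assumes "inj t" "degree P < CARD('m)"
  shows "coeff P (CARD('m) - 1) = (\<Sum>j\<in>UNIV. pfrac t j (- {j}) * poly P (t j))"
proof -
  define q where "q j = (\<Prod>l\<in>- {j}. [:- t l, 1:])" for j
  define L where "L = (\<Sum>j\<in>UNIV. smult (pfrac t j (- {j}) * poly P (t j)) (q j))"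
  have card: "card (- {j}) = CARD('m) - 1" for j :: 'm
    by (simp add: Compl_eq_Diff_UNIV card_Diff_singleton)
  have q: "degree (q j) = CARD('m) - 1" "lead_coeff (q j) = 1" for j
  proof -
    show "degree (q j) = CARD('m) - 1"
      by (simp add: q_def degree_prod_eq_sum_degree card)
    show "lead_coeff (q j) = 1"
      unfolding q_def lead_coeff_prod by simp
  qed
  have q_val: "poly (q j) (t k) = (if k = j then \<Prod>l\<in>- {j}. t j - t l else 0)" for j k
    by (auto simp: q_def poly_prod)
  have "pfrac t j (- {j}) * (\<Prod>l\<in>- {j}. t j - t l) = 1" for j
  proof -
    have "(\<Prod>l\<in>- {j}. t j - t l) \<noteq> 0" using assms(1) by (auto simp: inj_def)
    then show ?thesis by (simp add: pfrac_def flip: prod.distrib)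
  qed
  then have L_val: "poly L (t k) = poly P (t k)" for k
    by (simp add: L_def poly_sum q_val mult.assoc mult.left_commute[of _ "poly P (t k)"] if_distrib
        cong: if_cong)
  have "P - L = 0"
  proof (rule ccontr)
    assume nz: "P - L \<noteq> 0"
    then have "card (range t) \<le> degree (P - L)"
      by (rule card_roots_le_degree) (use L_val in auto)
    moreover have "degree L \<le> CARD('m) - 1"
      unfolding L_def using q by (intro degree_sum_le) (auto intro: order_trans[OF degree_smult_le])
    then have "degree L < CARD('m)"
      using zero_less_card_finite[where 'a = 'm] by linarith
    ultimately show False
      using assms degree_diff_less[of P "CARD('m)" L] by (simp add: card_image)
  qed
  then have "P = L" by simp
  then have "coeff P (CARD('m) - 1) = coeff L (CARD('m) - 1)" by simp
  also have "\<dots> = (\<Sum>j\<in>UNIV. pfrac t j (- {j}) * poly P (t j))"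
    unfolding L_def coeff_sum coeff_smult using q by (intro sum.cong refl) (metis mult_1_right)
  finally show ?thesis .
qed


lemma continuous_on_vdet:
  assumes "\<And>b. continuous_on S (\<lambda>z. w z b)" "\<And>b. continuous_on S (\<lambda>z. x z b)"
  shows "continuous_on S (\<lambda>z. vdet (w z) Q (x z))"
proof -
  have "continuous_on S (\<lambda>z. vrow Q b (w z b) (x z b) k)" for b k
    unfolding vrow_def by (cases "b \<in> Q") (auto intro!: continuous_intros assms)
  then show ?thesis
    unfolding vdet_def by (intro continuous_on_det continuous_on_vec_lambda)
qed

context haar
begin

text \<open>The mixed partial derivative of D Z in the variables from \<open>Q\<close>. With the
  Vandermonde factor moved into the expectation, each row of the determinant depends on a single
  variable, so differentiating affects one row at a time.\<close>

definition phi :: "('m \<Rightarrow> real) \<Rightarrow> 'm set \<Rightarrow> ('m \<Rightarrow> real) \<Rightarrow> real" where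
  "phi t Q x = (LINT U|\<mu>. vdet (row_weight t U) Q x)"

lemma phi_empty: "phi t {} x = vandermonde x * Zint t x"
  by (simp add: phi_def Zint_def vdet_empty[of "row_weight _ _"] weight_def)

lemma phi_has_derivative:
  assumes "i \<notin> Q"
  shows "((\<lambda>h. phi t Q (x(i := h))) has_real_derivative phi t (insert i Q) (x(i := a))) (at a)"
  unfolding phi_def
proof (rule expectation_has_derivative)
  show "continuous_on UNIV (\<lambda>U :: complex^'m^'m. vdet (row_weight t U) Q (x(i := h)))" for h
    unfolding row_weight_def by (intro continuous_on_vdet continuous_intros)
  have "continuous_on UNIV (\<lambda>p :: real \<times> (complex^'m^'m). (x(i := fst p)) b)" for b
    by (cases "b = i") (auto intro!: continuous_intros)
  then show "continuous_on UNIV (\<lambda>(h, U :: complex^'m^'m). vdet (row_weight t U) (insert i Q) (x(i := h)))"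
    unfolding row_weight_def case_prod_beta by (intro continuous_on_vdet continuous_intros)
qed (rule vdet_has_derivative[OF assms])

text \<open>For M = U T U^*, this is the expectation of entry (i, i) of the resolvent (z - M)^(-1)
  times e^(tr (X M)), cleared of denominators by the product of all z - t_l.\<close>

definition resolvent_poly :: "('m \<Rightarrow> real) \<Rightarrow> 'm \<Rightarrow> ('m \<Rightarrow> real) \<Rightarrow> real poly" where
  "resolvent_poly t i x = (\<Sum>j\<in>UNIV. smult (Yint t i j x) (\<Prod>l\<in>- {j}. [:- t l, 1:]))"

text \<open>Let q_j be the product of z - t_l over l other than j, and q the full product. Then t_j
  q_j = z q_j - q: the eigenvalue in the system for \<open>Yint\<close> turns into the formal
  variable z, and the row sums of \<open>Yint\<close> collect the multiples of q into
  \<open>Zint t x\<close>.\<close>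

lemma resolvent_poly_deriv:
  assumes "inj x"
  shows "coeff_deriv i (resolvent_poly t i) (pCons 0 (resolvent_poly t i x)
     - smult (Zint t x) (\<Prod>l\<in>UNIV. [:- t l, 1:])
     - (\<Sum>c\<in>- {i}. smult (inverse (x i - x c)) (resolvent_poly t i x - resolvent_poly t c x))) x"
proof -
  define q where "q j = (\<Prod>l\<in>- {j}. [:- t l, 1:])" for j
  define \<xi> where "\<xi> = (\<Prod>l\<in>UNIV. [:- t l, 1:])"
  have q: "smult (t j) (q j) = pCons 0 (q j) - \<xi>" for j
  proof -
    have "\<xi> = [:- t j, 1:] * q j"
      unfolding \<xi>_def q_def by (subst prod.remove[of UNIV j]) (auto simp: Compl_eq_Diff_UNIV)
    then show ?thesis by simp
  qed
  let ?Y = "\<lambda>j. t j * Yint t i j x - (\<Sum>c\<in>- {i}. inverse (x i - x c) * (Yint t i j x - Yint t c j x))"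
  have "coeff_deriv i (resolvent_poly t i) (\<Sum>j\<in>UNIV. smult (?Y j) (q j)) x"
    unfolding resolvent_poly_def[abs_def] q_def[symmetric]
    by (rule coeff_deriv_sum, rule coeff_deriv_const_poly, rule Yint_has_derivative[OF assms])
  moreover have "(\<Sum>j\<in>UNIV. smult (?Y j) (q j)) = pCons 0 (resolvent_poly t i x) - smult (Zint t x) \<xi>
     - (\<Sum>c\<in>- {i}. smult (inverse (x i - x c)) (resolvent_poly t i x - resolvent_poly t c x))"
  proof -
    have "(\<Sum>j\<in>UNIV. smult (?Y j) (q j)) = (\<Sum>j\<in>UNIV. smult (Yint t i j x) (smult (t j) (q j)))
       - (\<Sum>j\<in>UNIV. \<Sum>c\<in>- {i}. smult (inverse (x i - x c)) (smult (Yint t i j x - Yint t c j x) (q j)))"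
      by (rule poly_eqI) (simp add: coeff_sum sum_subtractf sum_distrib_right sum_distrib_left
          sum.distrib algebra_simps)
    also have "(\<Sum>j\<in>UNIV. \<Sum>c\<in>- {i}. smult (inverse (x i - x c)) (smult (Yint t i j x - Yint t c j x) (q j)))
       = (\<Sum>c\<in>- {i}. smult (inverse (x i - x c)) (resolvent_poly t i x - resolvent_poly t c x))"
      by (subst sum.swap, rule sum.cong[OF refl], rule poly_eqI)
         (simp add: resolvent_poly_def q_def coeff_sum sum_distrib_left sum_subtractf algebra_simps)
    also have "(\<Sum>j\<in>UNIV. smult (Yint t i j x) (smult (t j) (q j)))
       = pCons 0 (resolvent_poly t i x) - smult (Zint t x) \<xi>"
      unfolding q sum_Yint_row[symmetric, of t x i]
      by (rule poly_eqI) (simp add: resolvent_poly_def q_def coeff_sum coeff_pCons sum_distrib_left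
          sum_subtractf algebra_simps split: nat.split)
    finally show ?thesis .
  qed
  ultimately show ?thesis by (simp add: \<xi>_def)
qed

text \<open>The equation \<open>\<Prod>\<^sub>j (z - \<partial>\<^sub>j) (\<Delta> Z) = \<Prod>\<^sub>j (z - t\<^sub>j) \<Delta> Z\<close>.\<close>

lemma symb_phi_UNIV:
  fixes t x :: "'m \<Rightarrow> real"
  assumes "inj x"
  shows "symb (phi t) UNIV x = smult (phi t {} x) (\<Prod>l\<in>UNIV. [:- t l, 1:])"
proof -
  define \<xi> where "\<xi> = (\<Prod>l\<in>UNIV. [:- t l, 1:])"
  \<comment> \<open>The logarithmic derivative of the Vandermonde factor cancels the multiples of
    \<open>resolvent_poly t i x\<close> in the sum over \<open>c\<close>. What remains is the system
    required by \<open>symb_UNIV_eq\<close>.\<close>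
  define b where "b i x = smult (vandermonde x) (resolvent_poly t i x)" for i x
  have "symb (phi t) UNIV x = smult (phi t {} x) \<xi>"
  proof (rule symb_UNIV_eq[where b = b])
    show "((\<lambda>h. phi t Q (x(i := h))) has_real_derivative phi t (insert i Q) x) (at (x i))"
      if "i \<notin> Q" for i Q x
      using phi_has_derivative[OF that, of t x "x i"] by simp
    show "coeff_deriv i (b i) (pCons 0 (b i x) + (\<Sum>c\<in>- {i}. smult (inverse (x i - x c)) (b c x))
        - smult (phi t {} x) \<xi>) x" if x: "inj x" for i x
    proof -
      have "coeff_deriv i (b i)
        (smult (vandermonde x * (\<Sum>c\<in>- {i}. inverse (x i - x c))) (resolvent_poly t i x) +
         smult (vandermonde x) (pCons 0 (resolvent_poly t i x) - smult (Zint t x) \<xi>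
          - (\<Sum>c\<in>- {i}. smult (inverse (x i - x c)) (resolvent_poly t i x - resolvent_poly t c x)))) x"
        unfolding b_def[abs_def] \<xi>_def
        by (rule coeff_deriv_smult[where f = vandermonde, OF vandermonde_has_derivative[OF x] resolvent_poly_deriv[OF x]])
      also have "(smult (vandermonde x * (\<Sum>c\<in>- {i}. inverse (x i - x c))) (resolvent_poly t i x) +
         smult (vandermonde x) (pCons 0 (resolvent_poly t i x) - smult (Zint t x) \<xi>
          - (\<Sum>c\<in>- {i}. smult (inverse (x i - x c)) (resolvent_poly t i x - resolvent_poly t c x)))) =
        pCons 0 (b i x) + (\<Sum>c\<in>- {i}. smult (inverse (x i - x c)) (b c x)) - smult (phi t {} x) \<xi>"
        by (rule poly_eqI)
           (simp add: b_def phi_empty coeff_sum coeff_pCons sum_distrib_left sum_distrib_right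
             sum_subtractf algebra_simps split: nat.split)
      finally show ?thesis .
    qed
    show "(\<Sum>i\<in>UNIV. b i x) = smult (phi t {} x) (pderiv \<xi>)" for x
    proof -
      have "(\<Sum>i\<in>UNIV. resolvent_poly t i x) =
          (\<Sum>j\<in>UNIV. \<Sum>i\<in>UNIV. smult (Yint t i j x) (\<Prod>l\<in>- {j}. [:- t l, 1:]))"
        unfolding resolvent_poly_def by (rule sum.swap)
      also have "\<dots> = (\<Sum>j\<in>UNIV. smult (Zint t x) (\<Prod>l\<in>- {j}. [:- t l, 1:]))"
        by (simp only: smult_sum[symmetric] sum_Yint_column)
      also have "\<dots> = smult (Zint t x) (pderiv \<xi>)"
        by (rule poly_eqI)
           (simp add: \<xi>_def pderiv_prod pderiv_pCons Compl_eq_Diff_UNIV coeff_sum sum_distrib_left)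
      finally have "smult (vandermonde x) (\<Sum>i\<in>UNIV. resolvent_poly t i x) =
          smult (phi t {} x) (pderiv \<xi>)"
        by (simp add: phi_empty)
      moreover have "smult (vandermonde x) (\<Sum>i\<in>UNIV. resolvent_poly t i x) = (\<Sum>i\<in>UNIV. b i x)"
        by (rule poly_eqI) (simp add: b_def coeff_sum sum_distrib_left)
      ultimately show ?thesis by simp
    qed
    show "degree (b i x) < CARD('m)" for i x
    proof -
      have "degree (\<Prod>l\<in>- {j}. [:- t l, 1:]) = CARD('m) - 1" for j
        by (simp add: degree_prod_eq_sum_degree Compl_eq_Diff_UNIV card_Diff_singleton)
      then have "degree (resolvent_poly t i x) \<le> CARD('m) - 1"
        unfolding resolvent_poly_def
        by (intro degree_sum_le) (auto intro: order_trans[OF degree_smult_le])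
      then have "degree (b i x) \<le> CARD('m) - 1"
        unfolding b_def by (rule order_trans[OF degree_smult_le])
      then show ?thesis
        using zero_less_card_finite[where 'a = 'm] by linarith
    qed
    show "degree \<xi> = CARD('m)"
      by (simp add: \<xi>_def degree_prod_eq_sum_degree)
    show "lead_coeff \<xi> = 1"
      unfolding \<xi>_def lead_coeff_prod by simp
  qed (rule assms)
  then show ?thesis by (simp add: \<xi>_def)
qed

lemma degree_symb_le: "degree (symb \<phi> (R :: 'm set) x) \<le> card R"
  unfolding symb_def
  by (intro degree_sum_le) (auto intro!: order_trans[OF degree_monom_le] card_mono)

text \<open>As a function of the single variable \<open>x e\<close>, the polynomial \<open>symb (phi t) (- {e})\<close> evaluated at \<open>t j\<close>
  is annihilated by \<open>d/dh - t j\<close>, and its leading coefficient is \<open>\<Delta> Z\<close>.\<close>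

lemma Zint_exp_sum:
  fixes t x :: "'m \<Rightarrow> real"
  assumes t: "inj t" and x: "inj_on x (- {e})"
  obtains \<beta> where "\<And>h. (\<Prod>c\<in>- {e}. h - x c) * Zint t (x(e := h)) = (\<Sum>j\<in>UNIV. \<beta> j * exp (t j * h))"
proof -
  define \<Psi> where "\<Psi> h = symb (phi t) (- {e}) (x(e := h))" for h
  have card: "card (- {e}) = CARD('m) - 1"
    by (simp add: Compl_eq_Diff_UNIV card_Diff_singleton)
  have deg: "degree (\<Psi> h) < CARD('m)" for h
    unfolding \<Psi>_def using degree_symb_le[of "phi t" "- {e}" "x(e := h)"] card
      zero_less_card_finite[where 'a = 'm] by linarith
  have lead: "coeff (\<Psi> h) (CARD('m) - 1) = phi t {} (x(e := h))" for h
  proof -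
    have "card (- {e} - Q) \<noteq> CARD('m) - 1" if "Q \<subseteq> - {e}" "Q \<noteq> {}" for Q
    proof -
      have "card (- {e} - Q) < card (- {e})"
        using that by (intro psubset_card_mono) auto
      then show ?thesis using card by simp
    qed
    then have "coeff (\<Psi> h) (CARD('m) - 1) =
        (\<Sum>Q\<in>Pow (- {e}). if Q = {} then phi t {} (x(e := h)) else 0)"
      unfolding \<Psi>_def symb_def coeff_sum coeff_monom
      by (intro sum.cong refl) (use card in auto)
    then show ?thesis by (simp add: sum.delta)
  qed
  \<comment> \<open>In contrast to the operator equation, this holds for every \<open>a\<close>,
    also where it coincides with another node.\<close>
  have deriv: "((\<lambda>h. poly (\<Psi> h) z) has_real_derivative
      z * poly (\<Psi> a) z - poly (symb (phi t) UNIV (x(e := a))) z) (at a)" for z a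
  proof -
    have un: "insert e (- {e}) = UNIV" by auto
    have "coeff_deriv e (symb (phi t) (- {e})) (pCons 0 (symb (phi t) (- {e}) (x(e := a)))
        - symb (phi t) (insert e (- {e})) (x(e := a))) (x(e := a))"
      by (rule symb_deriv) (use phi_has_derivative[of e _ t x a] in auto)
    then have "((\<lambda>h. coeff (\<Psi> h) k) has_real_derivative
        coeff (pCons 0 (\<Psi> a) - symb (phi t) UNIV (x(e := a))) k) (at a)" for k
      unfolding coeff_deriv_def un \<Psi>_def by simp
    then have d: "((\<lambda>h. \<Sum>k\<le>CARD('m). coeff (\<Psi> h) k * z ^ k) has_real_derivative
        (\<Sum>k\<le>CARD('m). coeff (pCons 0 (\<Psi> a) - symb (phi t) UNIV (x(e := a))) k * z ^ k)) (at a)"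
      by (intro DERIV_sum DERIV_cmult_right)
    have eval: "(\<Sum>k\<le>CARD('m). coeff p k * z ^ k) = poly p z" if "degree p \<le> CARD('m)" for p
      unfolding poly_altdef using that by (intro sum.mono_neutral_right) (auto simp: coeff_eq_0)
    have deg_diff: "degree (pCons 0 (\<Psi> a) - symb (phi t) UNIV (x(e := a))) \<le> CARD('m)"
      using deg[of a] degree_symb_le[of "phi t" UNIV "x(e := a)"]
      by (intro degree_diff_le) (auto simp: degree_pCons_le intro: order_trans[OF degree_pCons_le])
    show ?thesis
      using d unfolding eval[OF deg_diff] eval[OF less_imp_le[OF deg]] by simp
  qed
  have "\<exists>\<gamma>. \<forall>h. poly (\<Psi> h) (t j) = \<gamma> * exp (t j * h)" for j
  proof -
    define g where "g h = exp (- t j * h) * poly (\<Psi> h) (t j)" for h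
    have dg: "(g has_real_derivative - exp (- t j * h) * poly (symb (phi t) UNIV (x(e := h))) (t j)) (at h)" for h
      unfolding g_def by (auto intro!: derivative_eq_intros deriv simp: algebra_simps)
    \<comment> \<open>The derivative of \<open>g\<close> is known to vanish only where h avoids the
      other nodes; continuity bridges these finitely many points.\<close>
    have "g constant_on UNIV"
    proof (rule DERIV_zero_connected_constant_on)
      show "finite (x ` (- {e}))" by simp
      show "continuous_on UNIV g"
        using dg by (meson DERIV_isCont continuous_at_imp_continuous_on)
      show "\<forall>h\<in>UNIV - x ` (- {e}). (g has_real_derivative 0) (at h)"
      proof
        fix h assume "h \<in> UNIV - x ` (- {e})"
        then have "inj (x(e := h))"
          using x by (auto simp: inj_def inj_on_def image_iff)
        then have "poly (symb (phi t) UNIV (x(e := h))) (t j) = 0"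
          by (auto simp: symb_phi_UNIV poly_prod)
        then show "(g has_real_derivative 0) (at h)" using dg[of h] by simp
      qed
    qed auto
    then obtain \<gamma> where "\<And>h. g h = \<gamma>" by (auto simp: constant_on_def)
    then have "poly (\<Psi> h) (t j) = \<gamma> * exp (t j * h)" for h
      by (metis (no_types, lifting) g_def exp_minus_inverse minus_mult_left mult.assoc mult.commute
          mult.right_neutral)
    then show ?thesis by blast
  qed
  then obtain \<gamma> where \<gamma>: "\<And>j h. poly (\<Psi> h) (t j) = \<gamma> j * exp (t j * h)" by metis
  obtain \<kappa> where \<kappa>: "\<And>h. vandermonde (x(e := h)) = \<kappa> * (\<Prod>c\<in>- {e}. h - x c)" "\<kappa> \<noteq> 0"
    using vandermonde_upd[OF x] by blast
  show thesis
  proof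
    fix h
    have "\<kappa> * ((\<Prod>c\<in>- {e}. h - x c) * Zint t (x(e := h))) = coeff (\<Psi> h) (CARD('m) - 1)"
      unfolding lead phi_empty \<kappa>(1) by simp
    also have "\<dots> = (\<Sum>j\<in>UNIV. pfrac t j (- {j}) * (\<gamma> j * exp (t j * h)))"
      unfolding lagrange_lead_coeff[OF t deg] \<gamma> ..
    finally have "inverse \<kappa> * (\<kappa> * ((\<Prod>c\<in>- {e}. h - x c) * Zint t (x(e := h)))) =
        inverse \<kappa> * (\<Sum>j\<in>UNIV. pfrac t j (- {j}) * (\<gamma> j * exp (t j * h)))"
      by simp
    then show "(\<Prod>c\<in>- {e}. h - x c) * Zint t (x(e := h)) =
        (\<Sum>j\<in>UNIV. inverse \<kappa> * pfrac t j (- {j}) * \<gamma> j * exp (t j * h))"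
      using \<kappa>(2) by (simp add: mult.assoc[symmetric] sum_distrib_left)
  qed
qed

end

section \<open>The uniform measure on the sphere\<close>

lemma cball_borel [measurable]: "cball (c :: 'a::euclidean_space) r \<in> sets borel"
  by (intro borel_closed closed_cball)

lemma ball_emeasure: "emeasure lborel (cball 0 1 :: 'a::euclidean_space set) \<noteq> 0"
    "emeasure lborel (cball 0 1 :: 'a::euclidean_space set) \<noteq> \<infinity>"
proof -
  have "unit_ball_vol (real DIM('a)) \<noteq> 0"
    using unit_ball_vol_pos[of "real DIM('a)"] by linarith
  then show "emeasure lborel (cball 0 1 :: 'a set) \<noteq> 0"
    by (simp add: emeasure_cball)
  show "emeasure lborel (cball 0 1 :: 'a set) \<noteq> \<infinity>"
    using emeasure_lborel_cball_finite[of "0 :: 'a" 1] by simp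
qed

text \<open>Uniqueness of translation-invariant measures: compare \<open>M\<close> and \<open>lborel\<close> on the ball,
  which a linear isometry preserves.\<close>

lemma lborel_distr_isometry:
  fixes L :: "'a::euclidean_space \<Rightarrow> 'a"
  assumes L: "linear L" "\<And>x. norm (L x) = norm x"
  shows "distr lborel borel L = lborel"
proof (rule measure_eqI)
  define M where "M = distr lborel borel L"
  have [measurable]: "L \<in> borel_measurable borel"
    using L(1) by (intro borel_measurable_continuous_onI linear_continuous_on) (simp add: linear_conv_bounded_linear)
  have sets_M [measurable_cong]: "sets M = sets borel" by (simp add: M_def)
  have "inj L"
    using L linear_injective_0[OF L(1)] by (metis norm_eq_zero)
  then have "surj L"
    using L(1) linear_injective_imp_surjective by blast
  \<comment> \<open>Translating by \<open>L w\<close> after applying \<open>L\<close> is translating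
    by \<open>w\<close> before. By surjectivity of \<open>L\<close> every translation has this
    form.\<close>
  have M_plus: "distr M borel (\<lambda>x. x + y) = M" for y
  proof -
    obtain w where w: "y = L w" using \<open>surj L\<close> by (metis surjD)
    have "distr M borel (\<lambda>x. x + y) = distr lborel borel (\<lambda>u. L (w + u))"
      unfolding M_def by (subst distr_distr) (auto simp: comp_def w linear_add[OF L(1)] add.commute)
    also have "\<dots> = distr (distr lborel borel ((+) w)) borel L"
      by (subst distr_distr) (auto simp: comp_def)
    finally show ?thesis by (simp add: lborel_distr_plus M_def)
  qed
  let ?B = "cball 0 1 :: 'a set"
  have ball: "emeasure lborel (cball x 1) = emeasure lborel ?B" for x :: 'a
    by (simp add: emeasure_cball)
  have "L -` ?B = ?B" using L(2) by auto
  then have MB: "emeasure M ?B = emeasure lborel ?B"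
    by (simp add: M_def emeasure_distr)
  have "sigma_finite_measure M"
  proof (rule sigma_finite_measure.intro)
    let ?A = "range (\<lambda>n. cball 0 (real n)) :: 'a set set"
    have "emeasure M (cball 0 (real n)) \<noteq> \<infinity>" for n
    proof -
      have "L -` cball 0 (real n) = cball 0 (real n)" using L(2) by auto
      then show ?thesis
        using emeasure_lborel_cball_finite[of "0 :: 'a" "real n"] by (simp add: M_def emeasure_distr)
    qed
    moreover have "\<Union> ?A = UNIV"
      by (auto simp: real_arch_simple)
    ultimately show "\<exists>A. countable A \<and> A \<subseteq> sets M \<and> \<Union> A = space M \<and> (\<forall>a\<in>A. emeasure M a \<noteq> \<infinity>)"
      by (intro exI[of _ ?A]) (auto simp: M_def)
  qed
  then interpret pair_sigma_finite lborel M
    by (intro pair_sigma_finite.intro) (simp_all add: lborel.sigma_finite_measure_axioms)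
  show "sets (distr lborel borel L) = sets lborel" by simp
  fix A assume "A \<in> sets (distr lborel borel L)"
  then have [measurable]: "A \<in> sets borel" by simp
  \<comment> \<open>The indicator of x in A and x - y in the ball is integrated in both orders.
    Integrating over y first gives this product; shifting x by y and exchanging the order gives the
    measure of the ball under \<open>M\<close> times the Lebesgue measure of A.\<close>
  have "emeasure lborel ?B * emeasure M A = (\<integral>\<^sup>+x. \<integral>\<^sup>+y. indicator A x * indicator ?B (x - y) \<partial>lborel \<partial>M)"
  proof -
    have "(\<integral>\<^sup>+y. indicator A x * indicator ?B (x - y) \<partial>lborel) = emeasure lborel ?B * indicator A x" for x
    proof -
      have "(\<integral>\<^sup>+y. indicator A x * indicator ?B (x - y) \<partial>lborel) = (\<integral>\<^sup>+y. indicator A x * indicator (cball x 1) y \<partial>lborel)"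
        by (intro nn_integral_cong arg_cong2[of _ _ _ _ "(*)"]) (auto simp: indicator_def dist_norm norm_minus_commute)
      also have "\<dots> = indicator A x * emeasure lborel (cball x 1)"
        by (subst nn_integral_cmult) (auto simp: nn_integral_indicator)
      finally show ?thesis by (simp only: ball[of x] mult.commute)
    qed
    then show ?thesis by (simp add: nn_integral_cmult)
  qed
  also have "\<dots> = (\<integral>\<^sup>+y. \<integral>\<^sup>+x. indicator A x * indicator ?B (x - y) \<partial>M \<partial>lborel)"
    by (rule Fubini'[of "\<lambda>y x. indicator A x * indicator ?B (x - y)"]) measurable
  also have "\<dots> = (\<integral>\<^sup>+y. \<integral>\<^sup>+x. indicator A (x + y) * indicator ?B x \<partial>M \<partial>lborel)"
  proof (rule nn_integral_cong)
    fix y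
    have "(\<integral>\<^sup>+x. indicator A x * indicator ?B (x - y) \<partial>M) =
        (\<integral>\<^sup>+x. indicator A x * indicator ?B (x - y) \<partial>distr M borel (\<lambda>x. x + y))"
      by (simp add: M_plus)
    also have "\<dots> = (\<integral>\<^sup>+x. indicator A (x + y) * indicator ?B x \<partial>M)"
      by (subst nn_integral_distr) auto
    finally show "(\<integral>\<^sup>+x. indicator A x * indicator ?B (x - y) \<partial>M) =
        (\<integral>\<^sup>+x. indicator A (x + y) * indicator ?B x \<partial>M)" .
  qed
  also have "\<dots> = (\<integral>\<^sup>+x. \<integral>\<^sup>+y. indicator A (x + y) * indicator ?B x \<partial>lborel \<partial>M)"
    by (rule Fubini'[of "\<lambda>y x. indicator A (x + y) * indicator ?B x", symmetric]) measurable
  also have "\<dots> = (\<integral>\<^sup>+x. emeasure lborel A * indicator ?B x \<partial>M)"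
  proof (rule nn_integral_cong)
    fix x
    have "(\<integral>\<^sup>+y. indicator A (x + y) \<partial>lborel) = (\<integral>\<^sup>+y. indicator A y \<partial>distr lborel borel ((+) x))"
      by (subst nn_integral_distr) auto
    then have "(\<integral>\<^sup>+y. indicator A (x + y) \<partial>lborel) = emeasure lborel A"
      by (simp add: lborel_distr_plus)
    then show "(\<integral>\<^sup>+y. indicator A (x + y) * indicator ?B x \<partial>lborel) = emeasure lborel A * indicator ?B x"
      by (subst nn_integral_multc) auto
  qed
  also have "\<dots> = emeasure lborel ?B * emeasure lborel A"
    by (subst nn_integral_cmult) (auto simp: MB mult.commute)
  finally have eq: "emeasure lborel ?B * emeasure M A = emeasure lborel ?B * emeasure lborel A" .
  moreover have "emeasure lborel ?B \<noteq> 0" "emeasure lborel ?B \<noteq> top"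
    using ball_emeasure[where 'a = 'a] by auto
  ultimately show "emeasure (distr lborel borel L) A = emeasure lborel A"
    by (metis M_def ennreal_mult_cancel_left)
qed

definition ball_measure :: "'a::euclidean_space measure" where
  "ball_measure = uniform_measure lborel (cball 0 1)"

lemma prob_space_ball_measure: "prob_space ball_measure"
  unfolding ball_measure_def by (rule prob_space_uniform_measure[OF ball_emeasure])

lemma sets_ball_measure [measurable_cong, simp]: "sets ball_measure = sets borel"
  by (simp add: ball_measure_def)

lemma space_ball_measure [simp]: "space ball_measure = UNIV"
  by (simp add: ball_measure_def)

lemma AE_ball_measure_nonzero: "AE x in (ball_measure :: 'a::euclidean_space measure). x \<noteq> 0"
proof -
  have "emeasure ball_measure {0 :: 'a} = 0"
    by (simp add: ball_measure_def emeasure_uniform_measure)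
  then show ?thesis
    by (intro AE_I[of _ _ "{0}"]) auto
qed

lemma sgn_measurable [measurable]: "(sgn :: 'a::euclidean_space \<Rightarrow> 'a) \<in> borel_measurable borel"
  unfolding sgn_div_norm[abs_def] by measurable

lemma space_sphere_measure [simp]: "space sphere_measure = sphere 0 1"
  by (simp add: sphere_measure_def space_restrict_space)

lemma sets_sphere_measure: "sets sphere_measure = sets (restrict_space borel (sphere 0 1))"
  unfolding sphere_measure_def by (rule sets_restrict_space_cong) simp

lemma sphere_borel [measurable]: "sphere (c :: 'a::euclidean_space) r \<in> sets borel"
  by (intro borel_closed closed_sphere)

text \<open>The indicator on the right is there because \<open>sgn 0 = 0\<close> is not on the
  sphere; the origin is a null set of the ball.\<close>

lemma nn_integral_sphere_measure:
  fixes g :: "'a::euclidean_space \<Rightarrow> ennreal"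
  assumes "g \<in> borel_measurable sphere_measure"
  shows "(\<integral>\<^sup>+v. g v \<partial>sphere_measure) = (\<integral>\<^sup>+y. g (sgn y) * indicator (sphere 0 1) (sgn y) \<partial>ball_measure)"
proof -
  have "g \<in> borel_measurable (restrict_space borel (sphere 0 1))"
    using assms by (simp add: measurable_cong_sets[OF sets_sphere_measure refl])
  then have [measurable]: "(\<lambda>v. g v * indicator (sphere 0 1) v) \<in> borel_measurable borel"
    by (subst (asm) borel_measurable_restrict_space_iff_ennreal) auto
  have "(\<integral>\<^sup>+v. g v \<partial>sphere_measure) =
      (\<integral>\<^sup>+v. g v * indicator (sphere 0 1) v \<partial>distr ball_measure borel sgn)"
    unfolding sphere_measure_def ball_measure_def
    by (rule nn_integral_restrict_space) simp
  also have "\<dots> = (\<integral>\<^sup>+y. g (sgn y) * indicator (sphere 0 1) (sgn y) \<partial>ball_measure)"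
    by (subst nn_integral_distr) auto
  finally show ?thesis .
qed

lemma prob_space_sphere_measure: "prob_space (sphere_measure :: 'a::euclidean_space measure)"
proof
  have "emeasure (sphere_measure :: 'a measure) (space sphere_measure) = (\<integral>\<^sup>+v. 1 \<partial>(sphere_measure :: 'a measure))"
    by simp
  also have "\<dots> = (\<integral>\<^sup>+y. 1 * indicator (sphere 0 1) (sgn y) \<partial>(ball_measure :: 'a measure))"
    by (rule nn_integral_sphere_measure) simp
  also have "\<dots> = (\<integral>\<^sup>+y. 1 \<partial>(ball_measure :: 'a measure))"
    by (rule nn_integral_cong_AE) (use AE_ball_measure_nonzero in \<open>auto simp: norm_sgn indicator_def\<close>)
  also have "\<dots> = 1"
    using prob_space.emeasure_space_1[OF prob_space_ball_measure] by simp
  finally show "emeasure (sphere_measure :: 'a measure) (space sphere_measure) = 1" .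
qed

text \<open>A linear isometry preserves the ball and Lebesgue measure, and it commutes with the
  radial projection \<open>sgn\<close>.\<close>

lemma sphere_measure_isometry:
  fixes L :: "'a::euclidean_space \<Rightarrow> 'a"
  assumes L: "linear L" "\<And>x. norm (L x) = norm x"
  shows "L \<in> sphere_measure \<rightarrow>\<^sub>M sphere_measure" "distr sphere_measure sphere_measure L = sphere_measure"
proof -
  have [measurable]: "L \<in> borel_measurable borel"
    using L(1) by (intro borel_measurable_continuous_onI linear_continuous_on) (simp add: linear_conv_bounded_linear)
  show meas [measurable]: "L \<in> sphere_measure \<rightarrow>\<^sub>M sphere_measure"
    unfolding measurable_cong_sets[OF sets_sphere_measure sets_sphere_measure]
    by (intro measurable_restrict_space3) (use L(2) in auto)
  have ball: "distr ball_measure borel L = ball_measure"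
  proof (rule measure_eqI)
    fix A assume "A \<in> sets (distr (ball_measure :: 'a measure) borel L)"
    then have [measurable]: "A \<in> sets borel" by simp
    have "emeasure lborel (cball 0 1 \<inter> L -` A) = emeasure lborel (L -` (cball 0 1 \<inter> A))"
      by (rule arg_cong[of _ _ "emeasure lborel"]) (use L(2) in auto)
    also have "\<dots> = emeasure (distr lborel borel L) (cball 0 1 \<inter> A)"
      by (simp add: emeasure_distr)
    also have "\<dots> = emeasure lborel (cball 0 1 \<inter> A)"
      by (simp add: lborel_distr_isometry[OF L])
    finally show "emeasure (distr ball_measure borel L) A = emeasure ball_measure A"
      using measurable_sets[OF \<open>L \<in> borel_measurable borel\<close> \<open>A \<in> sets borel\<close>]
      by (simp add: emeasure_distr ball_measure_def emeasure_uniform_measure)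
  qed simp
  have sgn_L: "sgn (L y) = L (sgn y)" for y
    by (simp add: sgn_div_norm L linear_scale)
  show "distr sphere_measure sphere_measure L = sphere_measure"
  proof (rule measure_eqI)
    fix A assume "A \<in> sets (distr sphere_measure sphere_measure L)"
    then have [measurable]: "A \<in> sets sphere_measure" by simp
    have [measurable]: "(\<lambda>y. indicator A (sgn y) * indicator (sphere 0 1) (sgn y) :: ennreal) \<in> borel_measurable borel"
    proof -
      have "A \<in> sets borel"
        using \<open>A \<in> sets sphere_measure\<close> unfolding sets_sphere_measure
        by (auto simp: sets_restrict_space)
      then show ?thesis by measurable
    qed
    have "emeasure (distr sphere_measure sphere_measure L) A = (\<integral>\<^sup>+v. indicator A (L v) \<partial>sphere_measure)"
      by (subst nn_integral_indicator[symmetric], simp, subst nn_integral_distr) auto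
    also have "\<dots> = (\<integral>\<^sup>+y. indicator A (L (sgn y)) * indicator (sphere 0 1) (sgn y) \<partial>ball_measure)"
      by (rule nn_integral_sphere_measure) measurable
    also have "\<dots> = (\<integral>\<^sup>+y. indicator A (sgn (L y)) * indicator (sphere 0 1) (sgn (L y)) \<partial>ball_measure)"
      by (simp add: sgn_L indicator_def L(2))
    also have "\<dots> = (\<integral>\<^sup>+y. indicator A (sgn y) * indicator (sphere 0 1) (sgn y) \<partial>distr ball_measure borel L)"
      by (subst nn_integral_distr) auto
    also have "\<dots> = emeasure sphere_measure A"
      unfolding ball by (subst nn_integral_sphere_measure[symmetric]) auto
    finally show "emeasure (distr sphere_measure sphere_measure L) A = emeasure sphere_measure A" .
  qed simp
qed

section \<open>Haar measure on \<open>U(n + 1)\<close> from a random unit vector\<close>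

context haar
begin

lemma nn_integral_left_mult:
  assumes "V \<in> unitary_group" "f \<in> borel_measurable \<mu>"
  shows "(\<integral>\<^sup>+U. f (V ** U) \<partial>\<mu>) = (\<integral>\<^sup>+U. f U \<partial>\<mu>)"
proof -
  have "distr \<mu> \<mu> (\<lambda>U. V ** U) = \<mu>"
    using haar assms(1) by (simp add: unitary_haar_def)
  then show ?thesis
    using nn_integral_distr[of "\<lambda>U. V ** U" \<mu> \<mu> f] left_mult_measurable[OF assms(1)] assms(2) by simp
qed

lemma prob_unitary_group [simp]: "prob unitary_group = 1"
  using prob_space by simp

lemma id_borel_measurable: "(\<lambda>U. U) \<in> borel_measurable \<mu>"
  by (rule borel_measurable_haar) simp

text \<open>Integrate \<open>f (V\<^sup>\<dagger> U)\<close> over \<open>U\<close> and \<open>V\<close> in both orders.\<close>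

lemma integral_herm_conj:
  fixes f :: "complex^'m^'m \<Rightarrow> real"
  assumes f: "continuous_on UNIV f"
  shows "(LINT U|\<mu>. f (herm_conj U)) = (LINT U|\<mu>. f U)"
proof -
  interpret pair_sigma_finite \<mu> \<mu> ..
  interpret P: pair_prob_space \<mu> \<mu> ..
  have cont: "continuous_on UNIV (\<lambda>p :: (complex^'m^'m) \<times> (complex^'m^'m). f (herm_conj (fst p) ** snd p))"
    by (rule continuous_on_compose2[OF f])
       (auto simp: matrix_matrix_mult_def herm_conj_def intro!: continuous_intros)
  have cont': "continuous_on UNIV (\<lambda>U. f (herm_conj U))"
    by (rule continuous_on_compose2[OF f]) (auto simp: herm_conj_def intro!: continuous_intros)
  have "(\<lambda>p. f (herm_conj (fst p) ** snd p)) \<in> borel_measurable (\<mu> \<Otimes>\<^sub>M \<mu>)"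
    by (rule borel_measurable_continuous_Pair[OF _ _ cont])
       (auto intro: measurable_compose[OF measurable_fst id_borel_measurable]
         measurable_compose[OF measurable_snd id_borel_measurable])
  moreover
  have "bounded (f ` unitary_group)"
    by (intro compact_imp_bounded compact_continuous_image continuous_on_subset[OF f] compact_unitary_group) simp
  then obtain B where B: "\<forall>z\<in>f ` unitary_group. norm z \<le> B"
    unfolding bounded_iff by blast
  ultimately have int: "integrable (\<mu> \<Otimes>\<^sub>M \<mu>) (\<lambda>(V, U). f (herm_conj V ** U))"
    by (intro P.integrable_const_bound[of _ B])
       (auto simp: space_pair_measure case_prod_beta intro!: AE_I2 bspec[OF B] imageI unitary_group_mult
         unitary_group_herm_conj)
  have "(LINT U|\<mu>. f U) = (LINT V|\<mu>. LINT U|\<mu>. f (herm_conj V ** U))"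
  proof -
    have "(LINT V|\<mu>. LINT U|\<mu>. f (herm_conj V ** U)) = (LINT V|\<mu>. LINT U|\<mu>. f U)"
      by (rule Bochner_Integration.integral_cong[OF refl])
         (simp add: integral_left_mult[OF unitary_group_herm_conj continuous_measurable_haar[OF f]])
    then show ?thesis by (simp add: prob_space)
  qed
  also have "\<dots> = (LINT U|\<mu>. LINT V|\<mu>. f (herm_conj V ** U))"
    by (rule Fubini_integral[OF int, symmetric])
  also have "\<dots> = (LINT U|\<mu>. LINT V|\<mu>. f (herm_conj V))"
  proof (rule Bochner_Integration.integral_cong[OF refl])
    fix U assume "U \<in> space \<mu>"
    then have U: "herm_conj U \<in> unitary_group" by (simp add: unitary_group_herm_conj)
    have "(LINT V|\<mu>. f (herm_conj V ** U)) = (LINT V|\<mu>. f (herm_conj (herm_conj U ** V)))"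
      by (simp add: herm_conj_mult)
    also have "\<dots> = (LINT V|\<mu>. f (herm_conj V))"
      by (rule integral_left_mult[OF U continuous_measurable_haar[OF cont']])
    finally show "(LINT V|\<mu>. f (herm_conj V ** U)) = (LINT V|\<mu>. f (herm_conj V))" .
  qed
  also have "\<dots> = (LINT V|\<mu>. f (herm_conj V))"
    by (simp add: prob_space)
  finally show ?thesis by simp
qed

end

lemma weight_herm_conj: "weight x t (herm_conj U) = weight t x U"
proof -
  have "weight x t (herm_conj U) = (\<Sum>i\<in>UNIV. \<Sum>k\<in>UNIV. t k * (x i * (cmod (U $ k $ i))\<^sup>2))"
    by (simp add: weight_def row_weight_def sum_distrib_left mult.left_commute)
  also have "\<dots> = weight t x U"
    by (subst sum.swap) (simp add: weight_def row_weight_def sum_distrib_left)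
  finally show ?thesis .
qed

text \<open>Passing to the adjoint exchanges rows and columns. The distinguished variable may thus
  belong to a row, as in \<open>Zint_exp_sum\<close>, or to a column, as in
  \<open>Zint_laplace\<close>.\<close>

lemma (in haar) Zint_swap: "Zint t x = Zint x t"
  unfolding Zint_def
  using integral_herm_conj[of "\<lambda>U. exp (weight t x U)"]
  by (simp add: weight_herm_conj continuous_intros)

section \<open>Hermitian forms, isometries, and unitary matrices with a prescribed column\<close>

lemma Re_herm_form: "Re (herm_form a b) = a \<bullet> b"
  by (simp add: herm_form_def inner_vec_def inner_complex_def)

lemma herm_form_self: "herm_form v v = complex_of_real ((norm v)\<^sup>2)"
  by (simp add: herm_form_def norm_vec_def L2_set_def sum_nonneg complex_norm_square mult.commute
      flip: of_real_power)

lemma herm_form_scale: "herm_form a (c *s b) = c * herm_form a b"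
  by (simp add: herm_form_def sum_distrib_left mult_ac)

lemma matrix_vector_scale: "P *v (c *s w) = c *s (P *v (w :: complex^'n))"
  by (simp add: vec_eq_iff matrix_vector_mult_def sum_distrib_left mult_ac)

lemma matrix_vector_linear: "linear ((*v) (P :: complex^'n^'m))"
  by (rule linearI)
     (simp_all add: vec_eq_iff matrix_vector_mult_def sum.distrib distrib_left scaleR_sum_right)

lemma herm_form_matrix: "herm_form v (A *v w) = herm_form (herm_conj A *v v) w"
proof -
  have "herm_form v (A *v w) = (\<Sum>i\<in>UNIV. \<Sum>j\<in>UNIV. cnj (v $ i) * (A $ i $ j * w $ j))"
    by (simp add: herm_form_def matrix_vector_mult_def sum_distrib_left)
  also have "\<dots> = (\<Sum>j\<in>UNIV. \<Sum>i\<in>UNIV. cnj (v $ i) * (A $ i $ j * w $ j))"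
    by (rule sum.swap)
  also have "\<dots> = herm_form (herm_conj A *v v) w"
    by (simp add: herm_form_def matrix_vector_mult_def sum_distrib_left sum_distrib_right mult_ac)
  finally show ?thesis .
qed

lemma unitary_norm:
  assumes "V \<in> unitary_group"
  shows "norm (V *v v) = norm v"
proof -
  have "complex_of_real ((norm (V *v v))\<^sup>2) = herm_form ((herm_conj V ** V) *v v) v"
    unfolding herm_form_self[symmetric] by (simp add: herm_form_matrix matrix_vector_mul_assoc)
  also have "\<dots> = complex_of_real ((norm v)\<^sup>2)"
    using assms by (simp add: unitary_group_def herm_form_self)
  finally show ?thesis
    by (metis norm_ge_zero of_real_eq_iff power2_eq_imp_eq)
qed

text \<open>Real polarization gives the real part. The imaginary part is the real part with one
  argument multiplied by the imaginary unit, and \<open>P\<close> is complex linear.\<close>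

lemma isometry_herm_form:
  assumes "\<And>w. norm (P *v w) = norm w"
  shows "herm_form (P *v a) (P *v b) = herm_form a b"
proof -
  have inner: "(P *v a) \<bullet> (P *v b) = a \<bullet> b" for a b
    unfolding dot_norm by (simp add: assms flip: matrix_vector_right_distrib)
  have im: "Im (herm_form a b) = - (a \<bullet> (\<i> *s b))" for a b :: "complex^'k"
    by (simp add: herm_form_scale flip: Re_herm_form)
  show ?thesis
    by (rule complex_eqI) (simp_all add: Re_herm_form im inner flip: matrix_vector_scale)
qed

lemma matrix_vector_axis: "P *v axis k 1 = column k (P :: complex^'n^'m)"
proof -
  have "(\<Sum>j\<in>UNIV. P $ i $ j * (axis k 1 :: complex^'n) $ j) = (\<Sum>j\<in>UNIV. if j = k then P $ i $ j else 0)" for i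
    by (rule sum.cong) (auto simp: axis_def)
  then show ?thesis by (simp add: vec_eq_iff matrix_vector_mult_def column_def)
qed

lemma isometry_herm_conj_mult:
  assumes "\<And>w. norm (P *v w) = norm w"
  shows "herm_conj P ** P = mat 1"
proof -
  have "(herm_conj P ** P) $ j $ k = mat 1 $ j $ k" for j k
  proof -
    have "(herm_conj P ** P) $ j $ k = herm_form (P *v axis j 1) (P *v axis k 1)"
      unfolding matrix_vector_axis by (simp add: matrix_matrix_mult_def herm_form_def column_def)
    also have "\<dots> = herm_form (axis j 1) (axis k 1)"
      by (rule isometry_herm_form[OF assms])
    also have "\<dots> = mat 1 $ j $ k"
    proof -
      have "herm_form (axis j 1) (axis k 1 :: complex^'a) = (\<Sum>i\<in>UNIV. if i = j then (if j = k then 1 else 0) else 0)"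
        unfolding herm_form_def by (rule sum.cong) (auto simp: axis_def)
      then show ?thesis by (simp add: mat_def)
    qed
    finally show ?thesis .
  qed
  then show ?thesis by (simp add: vec_eq_iff)
qed

definition glue :: "complex^'m \<Rightarrow> complex^'n^'m \<Rightarrow> complex^('n option)^'m" where
  "glue v Y = (\<chi> a k. case k of None \<Rightarrow> v $ a | Some k \<Rightarrow> Y $ a $ k)"

lemma glue_nth [simp]: "glue v Y $ a $ None = v $ a" "glue v Y $ a $ Some k = Y $ a $ k"
  by (simp_all add: glue_def)

lemma sum_option: "(\<Sum>k\<in>(UNIV :: 'n::finite option set). f k) = f None + (\<Sum>k\<in>UNIV. f (Some k))"
  by (simp add: UNIV_option_conv sum.reindex)

lemma row_weight_glue:
  "row_weight t (glue v Y) a = t None * (cmod (v $ a))\<^sup>2 + row_weight (\<lambda>k. t (Some k)) Y a"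
  by (simp add: row_weight_def sum_option)

lemma weight_glue:
  "weight x t (glue v Y) = t None * (\<Sum>a\<in>UNIV. x a * (cmod (v $ a))\<^sup>2) + weight x (\<lambda>k. t (Some k)) Y"
  by (simp add: weight_def row_weight_glue sum.distrib distrib_left sum_distrib_left mult.left_commute)

lemma matrix_mult_glue: "V ** glue v Y = glue (V *v v) (V ** Y)"
proof -
  have "(V ** glue v Y) $ a $ k = glue (V *v v) (V ** Y) $ a $ k" for a k
    by (cases k) (simp_all add: matrix_matrix_mult_def matrix_vector_mult_def)
  then show ?thesis by (simp add: vec_eq_iff)
qed

text \<open>When the glued matrix is unitary, this resolves the identity into the projections onto
  the line of \<open>v\<close> and onto the range of \<open>Y\<close>.\<close>

lemma glue_herm_conj:
  "glue v Y *v (herm_conj (glue v Y) *v u) = herm_form v u *s v + Y *v (herm_conj Y *v u)"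
  by (simp add: vec_eq_iff matrix_vector_mult_def sum_option herm_form_def mult.commute)

lemma glue_unitary:
  fixes v :: "complex^('n::finite option)" and P :: "complex^'n^('n option)"
  assumes "norm v = 1" "\<And>w. norm (P *v w) = norm w" "\<And>w. herm_form v (P *v w) = 0"
  shows "glue v P \<in> unitary_group"
proof (rule unitary_groupI)
  have PP: "(herm_conj P ** P) $ j $ k = mat 1 $ j $ k" for j k
    by (simp add: isometry_herm_conj_mult assms(2))
  have vP: "(\<Sum>a\<in>UNIV. cnj (v $ a) * P $ a $ k) = 0" for k
    using assms(3)[of "axis k 1"] by (simp add: matrix_vector_axis herm_form_def column_def)
  have Pv: "(\<Sum>a\<in>UNIV. cnj (P $ a $ k) * v $ a) = 0" for k
    using arg_cong[OF vP[of k], of cnj] by (simp add: mult.commute)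
  have vv: "(\<Sum>a\<in>UNIV. cnj (v $ a) * v $ a) = 1"
    using herm_form_self[of v] assms(1) by (simp add: herm_form_def)
  have "(herm_conj (glue v P) ** glue v P) $ j $ k = mat 1 $ j $ k" for j k
    using PP vP Pv vv
    by (cases j; cases k) (simp_all add: matrix_matrix_mult_def mat_def)
  then show "herm_conj (glue v P) ** glue v P = mat 1" by (simp add: vec_eq_iff)
qed

lemma continuous_on_glue [continuous_intros]:
  assumes "continuous_on S f" "continuous_on S g"
  shows "continuous_on S (\<lambda>z. glue (f z) (g z))"
  unfolding glue_def
proof (intro continuous_on_vec_lambda)
  fix a k
  show "continuous_on S (\<lambda>z. case k of None \<Rightarrow> f z $ a | Some k \<Rightarrow> g z $ a $ k)"
    by (cases k) (auto intro!: continuous_intros assms)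
qed

locale haar_extension = haar \<mu> for \<mu> :: "(complex^'n^'n) measure" +
  fixes P :: "complex^('n option) \<Rightarrow> complex^'n^('n option)"
  assumes P_meas [measurable]: "P \<in> borel_measurable sphere_measure"
    and P_isom: "\<And>v. norm v = 1 \<Longrightarrow> isometry_onto_compl v (P v)"
begin

lemma P_norm: "norm v = 1 \<Longrightarrow> norm (P v *v w) = norm w"
  and P_orth: "norm v = 1 \<Longrightarrow> herm_form v (P v *v w) = 0"
  using P_isom[of v] by (auto simp: isometry_onto_compl_def)

abbreviation sph :: "(complex^('n option)) measure" where "sph \<equiv> sphere_measure"

definition frame :: "(complex^('n option)) \<times> (complex^'n^'n) \<Rightarrow> complex^('n option)^('n option)" where
  "frame p = glue (fst p) (P (fst p) ** snd p)"

definition ext_haar :: "(complex^('n option)^('n option)) measure" where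
  "ext_haar = distr (sph \<Otimes>\<^sub>M \<mu>) (restrict_space borel unitary_group) frame"

sublocale sph: prob_space sph
  by (rule prob_space_sphere_measure)

sublocale pair_prob_space sph \<mu> ..

lemma frame_unitary: "norm v = 1 \<Longrightarrow> U \<in> unitary_group \<Longrightarrow> frame (v, U) \<in> unitary_group"
  unfolding frame_def fst_conv snd_conv
  by (rule glue_unitary)
     (auto simp: P_norm P_orth unitary_norm simp flip: matrix_vector_mul_assoc)

lemma sigma_finite_haar: "sigma_finite_measure \<mu>"
  using haar by (auto simp: unitary_haar_def intro: prob_space_imp_sigma_finite)

lemmas nn_integral_fst_haar = sigma_finite_measure.nn_integral_fst[OF sigma_finite_haar]
lemmas borel_measurable_fst_haar = sigma_finite_measure.borel_measurable_nn_integral_fst[OF sigma_finite_haar]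

lemma borel_measurable_sphere: "(\<lambda>v. v) \<in> borel_measurable sph"
  unfolding measurable_cong_sets[OF sets_sphere_measure refl] by (rule measurable_restrict_space1) simp

lemma frame_measurable [measurable]: "frame \<in> sph \<Otimes>\<^sub>M \<mu> \<rightarrow>\<^sub>M restrict_space borel unitary_group"
proof (rule measurable_restrict_space2)
  show "frame \<in> space (sph \<Otimes>\<^sub>M \<mu>) \<rightarrow> unitary_group"
    using frame_unitary by (auto simp: space_pair_measure)
  have 1: "(\<lambda>p. (fst p, P (fst p))) \<in> borel_measurable (sph \<Otimes>\<^sub>M \<mu>)"
    by (intro borel_measurable_Pair measurable_compose[OF measurable_fst borel_measurable_sphere]
        measurable_compose[OF measurable_fst P_meas])
  have 2: "snd \<in> borel_measurable (sph \<Otimes>\<^sub>M \<mu>)"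
    by (rule measurable_compose[OF measurable_snd id_borel_measurable])
  have "continuous_on UNIV (\<lambda>q :: ((complex^('n option)) \<times> (complex^'n^('n option))) \<times> (complex^'n^'n).
      glue (fst (fst q)) (snd (fst q) ** snd q))"
    unfolding matrix_matrix_mult_def by (intro continuous_intros)
  from borel_measurable_continuous_Pair[OF 1 2 this]
  show "frame \<in> borel_measurable (sph \<Otimes>\<^sub>M \<mu>)"
    by (simp add: frame_def[abs_def])
qed

text \<open>Both P_{Vv} and V P_v are isometries onto the complement of V v, so they differ by the
  unitary R = P_{Vv}^* V P_v. It depends on \<open>v\<close> but not on \<open>U\<close>.\<close>

lemma frame_change:
  assumes V: "V \<in> unitary_group" and v: "norm v = 1"
  obtains R where "R \<in> unitary_group" "\<And>U. V ** frame (v, U) = frame (V *v v, R ** U)"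
proof
  let ?v = "V *v v"
  have v': "norm ?v = 1" using V v by (simp add: unitary_norm)
  let ?R = "herm_conj (P ?v) ** (V ** P v)"
  have G: "glue ?v (P ?v) \<in> unitary_group"
    by (rule glue_unitary) (simp_all add: v' P_norm P_orth)
  have "P ?v *v (herm_conj (P ?v) *v u) = u - herm_form ?v u *s ?v" for u
  proof -
    have "u = (glue ?v (P ?v) ** herm_conj (glue ?v (P ?v))) *v u"
      using G by (simp add: unitary_group_def)
    also have "\<dots> = glue ?v (P ?v) *v (herm_conj (glue ?v (P ?v)) *v u)"
      by (simp add: matrix_vector_mul_assoc)
    also have "\<dots> = herm_form ?v u *s ?v + P ?v *v (herm_conj (P ?v) *v u)"
      by (rule glue_herm_conj)
    finally show ?thesis by (metis add_diff_cancel_left')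
  qed
  moreover have "herm_form ?v (V *v (P v *v w)) = 0" for w
    by (simp add: isometry_herm_form[OF unitary_norm[OF V]] P_orth v)
  ultimately have PR: "P ?v *v (?R *v w) = V *v (P v *v w)" for w
    by (simp flip: matrix_vector_mul_assoc)
  have "norm (?R *v w) = norm w" for w
    using PR[of w] P_norm[OF v', of "?R *v w"] by (simp add: unitary_norm[OF V] P_norm[OF v])
  then have "herm_conj ?R ** ?R = mat 1"
    by (rule isometry_herm_conj_mult)
  then show "?R \<in> unitary_group"
    by (rule unitary_groupI)
  have "P ?v ** ?R = V ** P v"
    using PR unfolding matrix_eq by (simp add: matrix_vector_mul_assoc)
  then show "V ** frame (v, U) = frame (?v, ?R ** U)" for U
    by (simp add: frame_def matrix_mult_glue matrix_mul_assoc)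
qed

text \<open>By \<open>frame_change\<close>, left multiplication by \<open>V\<close> moves
  \<open>v\<close> to V v and, for fixed \<open>v\<close>, multiplies \<open>U\<close> from the left
  by a unitary. The Haar measure absorbs the latter for each \<open>v\<close>; invariance of the
  sphere measure then takes care of the former.\<close>

lemma unitary_haar_ext_haar: "unitary_haar ext_haar"
  unfolding unitary_haar_def
proof (intro conjI ballI)
  show "prob_space ext_haar"
    unfolding ext_haar_def by (rule prob_space_distr[OF frame_measurable])
  show space: "space ext_haar = unitary_group"
    by (simp add: ext_haar_def space_restrict_space)
  show sets: "sets ext_haar = sets (restrict_space borel unitary_group)"
    by (simp add: ext_haar_def)
  fix V :: "complex^('n option)^('n option)" assume V: "V \<in> unitary_group"
  have L: "(*v) V \<in> sph \<rightarrow>\<^sub>M sph" "distr sph sph ((*v) V) = sph"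
    using sphere_measure_isometry[OF matrix_vector_linear unitary_norm[OF V]] by auto
  have V_meas [measurable]: "(\<lambda>U. V ** U) \<in> restrict_space borel unitary_group \<rightarrow>\<^sub>M restrict_space borel unitary_group"
  proof (rule measurable_restrict_space3)
    have "continuous_on UNIV (\<lambda>U. V ** U)"
      unfolding matrix_matrix_mult_def by (intro continuous_intros)
    then show "(\<lambda>U. V ** U) \<in> borel_measurable borel"
      by (rule borel_measurable_continuous_onI)
  qed (use V in \<open>auto intro: unitary_group_mult\<close>)
  show "distr ext_haar ext_haar (\<lambda>U. V ** U) = ext_haar"
  proof (rule measure_eqI)
    fix A assume "A \<in> sets (distr ext_haar ext_haar (\<lambda>U. V ** U))"
    then have A: "A \<in> sets (restrict_space borel unitary_group)" by (simp add: sets)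
    then have [measurable]: "indicator A \<in> borel_measurable (restrict_space borel unitary_group)"
      by (rule borel_measurable_indicator)
    define g where "g v = (\<integral>\<^sup>+U. indicator A (frame (v, U)) \<partial>\<mu>)" for v
    have ind: "(\<lambda>p. indicator A (frame p) :: ennreal) \<in> borel_measurable (sph \<Otimes>\<^sub>M \<mu>)"
      by measurable
    then have g [measurable]: "g \<in> borel_measurable sph"
      unfolding g_def by (rule borel_measurable_fst_haar)
    have "emeasure (distr ext_haar ext_haar (\<lambda>U. V ** U)) A = (\<integral>\<^sup>+W. indicator A (V ** W) \<partial>ext_haar)"
    proof -
      have "(\<lambda>U. V ** U) \<in> ext_haar \<rightarrow>\<^sub>M ext_haar"
        using V_meas by (simp add: measurable_cong_sets[OF sets sets])
      moreover have "indicator A \<in> borel_measurable (ext_haar)"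
        using A by (intro borel_measurable_indicator) (simp add: sets)
      ultimately have "(\<integral>\<^sup>+W. indicator A W \<partial>distr ext_haar ext_haar (\<lambda>U. V ** U)) = (\<integral>\<^sup>+W. indicator A (V ** W) \<partial>ext_haar)"
        by (intro nn_integral_distr) auto
      then show ?thesis
        using A by (simp add: sets)
    qed
    also have "\<dots> = (\<integral>\<^sup>+p. indicator A (V ** frame p) \<partial>(sph \<Otimes>\<^sub>M \<mu>))"
      unfolding ext_haar_def by (rule nn_integral_distr) measurable
    also have "\<dots> = (\<integral>\<^sup>+v. \<integral>\<^sup>+U. indicator A (V ** frame (v, U)) \<partial>\<mu> \<partial>sph)"
      by (rule nn_integral_fst_haar[of "\<lambda>p. indicator A (V ** frame p)", symmetric]) measurable
    also have "\<dots> = (\<integral>\<^sup>+v. g (V *v v) \<partial>sph)"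
    proof (rule nn_integral_cong)
      fix v :: "complex^('n option)" assume "v \<in> space sph"
      then have v: "norm v = 1" by simp
      then obtain R where R: "R \<in> unitary_group" "\<And>U. V ** frame (v, U) = frame (V *v v, R ** U)"
        using frame_change[OF V] by blast
      have Vv: "V *v v \<in> space sph" using v V by (simp add: unitary_norm)
      have "(\<integral>\<^sup>+U. indicator A (frame (V *v v, R ** U)) \<partial>\<mu>) = (\<integral>\<^sup>+U. indicator A (frame (V *v v, U)) \<partial>\<mu>)"
        by (rule nn_integral_left_mult[OF R(1)])
           (rule measurable_compose[OF measurable_Pair1'[OF Vv] ind])
      then show "(\<integral>\<^sup>+U. indicator A (V ** frame (v, U)) \<partial>\<mu>) = g (V *v v)"
        by (simp add: R(2) g_def)
    qed
    also have "\<dots> = (\<integral>\<^sup>+v. g v \<partial>distr sph sph ((*v) V))"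
      by (rule nn_integral_distr[symmetric]) (use L in auto)
    also have "\<dots> = (\<integral>\<^sup>+v. g v \<partial>sph)"
      by (simp only: L(2))
    also have "\<dots> = (\<integral>\<^sup>+p. indicator A (frame p) \<partial>(sph \<Otimes>\<^sub>M \<mu>))"
      unfolding g_def by (rule nn_integral_fst_haar[of "\<lambda>p. indicator A (frame p)"]) measurable
    also have "\<dots> = (\<integral>\<^sup>+W. indicator A W \<partial>ext_haar)"
      unfolding ext_haar_def by (rule nn_integral_distr[symmetric]) measurable
    also have "\<dots> = emeasure ext_haar A"
      using A by (simp add: sets)
    finally show "emeasure (distr ext_haar ext_haar (\<lambda>U. V ** U)) A = emeasure ext_haar A" .
  qed simp
qed

sublocale ext: haar ext_haar
  by unfold_locales (rule unitary_haar_ext_haar)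

lemma integral_ext_haar:
  fixes f :: "complex^('n option)^('n option) \<Rightarrow> real"
  assumes f: "continuous_on UNIV f"
  shows "(LINT W|ext_haar. f W) = (LINT v|sph. LINT U|\<mu>. f (frame (v, U)))"
proof -
  have f_meas: "f \<in> borel_measurable (restrict_space borel unitary_group)"
    by (intro measurable_restrict_space1 borel_measurable_continuous_onI f)
  have "integrable ext_haar f"
    by (rule ext.integrable_haar[OF f])
  then have int: "integrable (sph \<Otimes>\<^sub>M \<mu>) (\<lambda>p. f (frame p))"
    unfolding ext_haar_def by (subst (asm) integrable_distr_eq[OF frame_measurable f_meas])
  have "(LINT W|ext_haar. f W) = (LINT p|(sph \<Otimes>\<^sub>M \<mu>). f (frame p))"
    unfolding ext_haar_def by (rule integral_distr[OF frame_measurable f_meas])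
  also have "\<dots> = (LINT v|sph. LINT U|\<mu>. f (frame (v, U)))"
    using integral_fst'[OF int] by simp
  finally show ?thesis .
qed

end

section \<open>The Laplace method on the sphere\<close>

lemma (in haar) continuous_on_expectation:
  fixes f :: "'a::metric_space \<Rightarrow> complex^'m^'m \<Rightarrow> real"
  assumes K: "compact K" and f: "continuous_on UNIV (\<lambda>(y, U). f y U)"
  shows "continuous_on K (\<lambda>y. LINT U|\<mu>. f y U)"
  unfolding continuous_on_sequentially comp_def
proof (intro allI ballI impI, elim conjE)
  fix X a assume X: "\<forall>n. X n \<in> K" "X \<longlonglongrightarrow> a" and a: "a \<in> K"
  have "bounded ((\<lambda>(y, U). f y U) ` (K \<times> unitary_group))"
    by (intro compact_imp_bounded compact_continuous_image continuous_on_subset[OF f] compact_Times K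
        compact_unitary_group) simp
  then obtain B where B: "\<forall>z\<in>(\<lambda>(y, U). f y U) ` (K \<times> unitary_group). norm z \<le> B"
    unfolding bounded_iff by blast
  have cont: "continuous_on UNIV (f y)" for y
    using continuous_on_compose2[OF f continuous_on_Pair[OF continuous_on_const continuous_on_id]]
    by simp
  show "(\<lambda>n. LINT U|\<mu>. f (X n) U) \<longlonglongrightarrow> (LINT U|\<mu>. f a U)"
  proof (rule integral_dominated_convergence[where w = "\<lambda>_. B"])
    show "AE U in \<mu>. norm (f (X n) U) \<le> B" for n
      using X(1) by (intro AE_I2 bspec[OF B]) (auto intro!: image_eqI[of _ _ "(X n, _)"])
    show "AE U in \<mu>. (\<lambda>n. f (X n) U) \<longlonglongrightarrow> f a U"
    proof (rule AE_I2)
      fix U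
      have "isCont (\<lambda>(y, U). f y U) (a, U)"
        using f by (simp add: continuous_on_eq_continuous_at)
      then have "(\<lambda>n. (\<lambda>(y, U). f y U) (X n, U)) \<longlonglongrightarrow> (\<lambda>(y, U). f y U) (a, U)"
        by (rule isCont_tendsto_compose) (intro tendsto_Pair X(2) tendsto_const)
      then show "(\<lambda>n. f (X n) U) \<longlonglongrightarrow> f a U" by simp
    qed
  qed (auto intro: continuous_measurable_haar cont)
qed

section \<open>Gaussian and radial integrals in complex coordinates\<close>

lemma prod_Basis_vec:
  "(\<Prod>b\<in>(Basis :: (complex^'k) set). f b) = (\<Prod>k\<in>UNIV. f (axis k 1) * f (axis k \<i>))"
proof -
  have "(Basis :: (complex^'k) set) = (\<Union>k\<in>UNIV. {axis k 1, axis k \<i>})"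
    by (auto simp: Basis_vec_def Basis_complex_def)
  then have "(\<Prod>b\<in>(Basis :: (complex^'k) set). f b) = (\<Prod>b\<in>(\<Union>k\<in>UNIV. {axis k 1, axis k \<i>}). f b)"
    by simp
  also have "\<dots> = (\<Prod>k\<in>UNIV. \<Prod>b\<in>{axis k 1, axis k \<i>}. f b)"
    by (rule prod.UNION_disjoint) (auto simp: axis_eq_axis)
  also have "\<dots> = (\<Prod>k\<in>UNIV. f (axis k 1) * f (axis k \<i>))"
    by (rule prod.cong) (auto simp: axis_eq_axis)
  finally show ?thesis .
qed

lemma prod_option: "(\<Prod>k\<in>(UNIV :: 'n::finite option set). f k) = f None * (\<Prod>k\<in>UNIV. f (Some k))"
  by (simp add: UNIV_option_conv prod.reindex)

definition opt_vec :: "complex \<times> (complex^'n) \<Rightarrow> complex^('n option)" where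
  "opt_vec p = (\<chi> i. case i of None \<Rightarrow> fst p | Some k \<Rightarrow> snd p $ k)"

lemma opt_vec_nth [simp]: "opt_vec p $ None = fst p" "opt_vec p $ Some k = snd p $ k"
  by (simp_all add: opt_vec_def)

lemma opt_vec_measurable [measurable]: "opt_vec \<in> borel_measurable borel"
proof -
  have "continuous_on UNIV (opt_vec :: complex \<times> (complex^'n) \<Rightarrow> complex^('n option))"
    unfolding opt_vec_def
  proof (intro continuous_on_vec_lambda)
    fix i
    show "continuous_on UNIV (\<lambda>p :: complex \<times> (complex^'n). case i of None \<Rightarrow> fst p | Some k \<Rightarrow> snd p $ k)"
      by (cases i) (auto intro!: continuous_intros)
  qed
  then show ?thesis by (rule borel_measurable_continuous_onI)
qed

lemma lborel_opt_vec:
  "distr (lborel \<Otimes>\<^sub>M lborel) borel opt_vec = (lborel :: (complex^('n::finite option)) measure)"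
proof (rule lborel_eqI[symmetric])
  fix l u :: "complex^('n option)"
  assume le: "\<And>b. b \<in> Basis \<Longrightarrow> l \<bullet> b \<le> u \<bullet> b"
  define l' where "l' = (\<chi> k. l $ Some k)"
  define u' where "u' = (\<chi> k. u $ Some k)"
  have le1: "l $ None \<bullet> b \<le> u $ None \<bullet> b" if "b \<in> Basis" for b
    using le[of "axis None b"] that by (simp add: inner_axis axis_in_Basis_iff)
  have le2: "l' \<bullet> b \<le> u' \<bullet> b" if b: "b \<in> Basis" for b
  proof -
    obtain k c where "b = axis k c" "c \<in> Basis" using b unfolding Basis_vec_def by blast
    then show ?thesis
      using le[of "axis (Some k) c"] by (simp add: inner_axis axis_in_Basis_iff l'_def u'_def)
  qed
  have all_Basis: "(\<forall>b\<in>(Basis :: (complex^'k) set). Q b) \<longleftrightarrow> (\<forall>k. \<forall>c\<in>Basis. Q (axis k c))" for Q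
    by (auto simp: Basis_vec_def)
  have "opt_vec -` box l u = box (l $ None) (u $ None) \<times> box l' u'"
    by (auto simp: box_def all_Basis inner_axis l'_def u'_def split_option_all)
  then have "emeasure (distr (lborel \<Otimes>\<^sub>M lborel) borel opt_vec) (box l u) =
      emeasure (lborel \<Otimes>\<^sub>M lborel) (box (l $ None) (u $ None) \<times> box l' u')"
    using opt_vec_measurable by (subst emeasure_distr) (simp_all add: lborel_prod)
  also have "\<dots> = emeasure lborel (box (l $ None) (u $ None)) * emeasure lborel (box l' u')"
    by (rule lborel.emeasure_pair_measure_Times) auto
  also have "\<dots> = (\<Prod>b\<in>Basis. (u - l) \<bullet> b)"
  proof -
    have "0 \<le> (\<Prod>b\<in>Basis. (u $ None - l $ None) \<bullet> b)"
      using le1 by (intro prod_nonneg) (auto simp: inner_diff_left)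
    moreover have "emeasure lborel (box (l $ None) (u $ None)) = ennreal (\<Prod>b\<in>Basis. (u $ None - l $ None) \<bullet> b)"
      by (rule emeasure_lborel_box) (rule le1)
    moreover have "emeasure lborel (box l' u') = ennreal (\<Prod>b\<in>Basis. (u' - l') \<bullet> b)"
      by (rule emeasure_lborel_box) (rule le2)
    ultimately have "emeasure lborel (box (l $ None) (u $ None)) * emeasure lborel (box l' u') =
        ennreal ((\<Prod>b\<in>Basis. (u $ None - l $ None) \<bullet> b) * (\<Prod>b\<in>Basis. (u' - l') \<bullet> b))"
      by (simp only: ennreal_mult')
    also have "(\<Prod>b\<in>Basis. (u $ None - l $ None) \<bullet> b) * (\<Prod>b\<in>Basis. (u' - l') \<bullet> b) =
        (\<Prod>b\<in>Basis. (u - l) \<bullet> b)"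
      by (simp add: prod_Basis_vec prod_option inner_axis l'_def u'_def Basis_complex_def)
    finally show ?thesis .
  qed
  finally show "emeasure (distr (lborel \<Otimes>\<^sub>M lborel) borel opt_vec) (box l u) = (\<Prod>b\<in>Basis. (u - l) \<bullet> b)" .
qed (simp add: borel_prod)

lemma nn_integral_gauss:
  assumes "c > 0"
  shows "(\<integral>\<^sup>+x. ennreal (exp (- c * x\<^sup>2)) \<partial>lborel) = ennreal (sqrt (pi / c))"
proof -
  define s where "s = sqrt (1 / (2 * c))"
  have s: "s > 0" "s\<^sup>2 = 1 / (2 * c)" using assms by (auto simp: s_def)
  have "exp (- c * x\<^sup>2) = sqrt (pi / c) * normal_density 0 s x" for x
    using assms by (simp add: normal_density_def s field_simps real_sqrt_divide)
  then have "(\<integral>\<^sup>+x. ennreal (exp (- c * x\<^sup>2)) \<partial>lborel) =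
      (\<integral>\<^sup>+x. ennreal (sqrt (pi / c)) * ennreal (normal_density 0 s x) \<partial>lborel)"
    using assms by (simp add: ennreal_mult')
  also have "\<dots> = ennreal (sqrt (pi / c)) * (\<integral>\<^sup>+x. ennreal (normal_density 0 s x) \<partial>lborel)"
    by (rule nn_integral_cmult) simp
  also have "(\<integral>\<^sup>+x. ennreal (normal_density 0 s x) \<partial>lborel) = 1"
    using s by (subst nn_integral_eq_integral) auto
  finally show ?thesis by simp
qed

lemma nn_integral_gauss_vec:
  fixes c :: "'n::finite \<Rightarrow> real"
  assumes c: "\<And>k. c k > 0"
  shows "(\<integral>\<^sup>+z. ennreal (exp (- (\<Sum>k\<in>UNIV. c k * (cmod (z $ k))\<^sup>2))) \<partial>(lborel :: (complex^'n) measure))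
    = ennreal (\<Prod>k\<in>UNIV. pi / c k)"
proof -
  \<comment> \<open>The product formula has one factor for each real basis vector;
    \<open>SOME\<close> recovers the complex coordinate to which a basis vector belongs.\<close>
  define d where "d b = c (SOME k. b $ k \<noteq> 0)" for b :: "complex^'n"
  have d: "d (axis k u) = c k" if "u \<noteq> 0" for k u
  proof -
    have "(SOME j. axis k u $ j \<noteq> 0) = k"
      using that by (intro some_equality) (auto simp: axis_def split: if_splits)
    then show ?thesis by (simp add: d_def)
  qed
  have d_pos: "d b > 0" for b by (simp add: d_def c)
  have "ennreal (exp (- (\<Sum>k\<in>UNIV. c k * (cmod (z $ k))\<^sup>2))) = (\<Prod>b\<in>Basis. ennreal (exp (- d b * (z \<bullet> b)\<^sup>2)))"
    for z :: "complex^'n"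
  proof -
    have "(\<Prod>b\<in>Basis. exp (- d b * (z \<bullet> b)\<^sup>2)) = (\<Prod>k\<in>UNIV. exp (- (c k * (cmod (z $ k))\<^sup>2)))"
      unfolding prod_Basis_vec
      by (rule prod.cong) (auto simp: d inner_axis inner_complex_def cmod_power2 algebra_simps simp flip: exp_add)
    also have "\<dots> = exp (- (\<Sum>k\<in>UNIV. c k * (cmod (z $ k))\<^sup>2))"
      by (simp add: exp_sum flip: sum_negf)
    finally show ?thesis by (simp add: prod_ennreal)
  qed
  then have "(\<integral>\<^sup>+z. ennreal (exp (- (\<Sum>k\<in>UNIV. c k * (cmod (z $ k))\<^sup>2))) \<partial>(lborel :: (complex^'n) measure))
    = (\<integral>\<^sup>+z. (\<Prod>b\<in>Basis. ennreal (exp (- d b * (z \<bullet> b)\<^sup>2))) \<partial>lborel)"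
    by simp
  also have "\<dots> = (\<Prod>b\<in>Basis. \<integral>\<^sup>+x. ennreal (exp (- d b * x\<^sup>2)) \<partial>lborel)"
    by (rule nn_integral_lborel_prod) auto
  also have "\<dots> = ennreal (\<Prod>b\<in>Basis. sqrt (pi / d b))"
    unfolding nn_integral_gauss[OF d_pos] by (rule prod_ennreal) (simp add: d_pos less_imp_le)
  also have "(\<Prod>b\<in>Basis. sqrt (pi / d b)) = (\<Prod>k\<in>UNIV. pi / c k)"
    unfolding prod_Basis_vec using c by (intro prod.cong) (auto simp: d less_imp_le)
  finally show ?thesis .
qed

lemma ball_borel [measurable]: "ball (c :: 'a::euclidean_space) r \<in> sets borel"
  by (intro borel_open open_ball)

text \<open>Write |y|^(2n) as the integral of its derivative 2n u^(2n-1) over u from 0 to |y|,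
  exchange the integrals, and use the area pi (1 - u^2) of the annulus u <= |y| < 1.\<close>

lemma nn_integral_disc_power:
  assumes "n > 0"
  shows "(\<integral>\<^sup>+y. ennreal (cmod y ^ (2 * n)) * indicator (ball 0 1) y \<partial>lborel) = ennreal (pi / (real n + 1))"
proof -
  let ?p = "\<lambda>u :: real. 2 * real n * u ^ (2 * n - 1)"
  have p: "((\<lambda>u. u ^ (2 * n)) has_real_derivative ?p u) (at u within S)" for u S
    using assms by (auto intro!: derivative_eq_intros)
  let ?i = "\<lambda>u (y :: complex). if 0 \<le> u \<and> u \<le> cmod y \<and> cmod y < 1 then 1 else 0 :: ennreal"
  have pow: "ennreal (cmod y ^ (2 * n)) * indicator (ball 0 1) y = (\<integral>\<^sup>+u. ennreal (?p u) * ?i u y \<partial>lborel)"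
    for y :: complex
  proof (cases "cmod y < 1")
    case True
    have "(\<integral>\<^sup>+u. ennreal (?p u) * indicator {0..cmod y} u \<partial>lborel) = ennreal (cmod y ^ (2 * n) - 0 ^ (2 * n))"
      by (rule nn_integral_FTC_Icc) (use p in auto)
    moreover have "(\<integral>\<^sup>+u. ennreal (?p u) * indicator {0..cmod y} u \<partial>lborel) = (\<integral>\<^sup>+u. ennreal (?p u) * ?i u y \<partial>lborel)"
      using True by (intro nn_integral_cong) (auto simp: indicator_def)
    moreover have "0 ^ (2 * n) = (0 :: real)"
      using assms by simp
    ultimately show ?thesis using True by simp
  qed simp
  have area: "emeasure lborel {y :: complex. u \<le> cmod y \<and> cmod y < 1} = ennreal (pi * (1 - u\<^sup>2))"
    if "0 \<le> u" "u \<le> 1" for u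
  proof -
    have "{y :: complex. u \<le> cmod y \<and> cmod y < 1} = ball 0 1 - ball 0 u"
      by auto
    moreover have "emeasure lborel (ball 0 1 - ball (0 :: complex) u) =
        emeasure lborel (ball (0 :: complex) 1) - emeasure lborel (ball (0 :: complex) u)"
      by (rule emeasure_Diff) (use that emeasure_lborel_ball_finite[of "0 :: complex" u] in auto)
    ultimately have "emeasure lborel {y :: complex. u \<le> cmod y \<and> cmod y < 1} =
        emeasure lborel (ball (0 :: complex) 1) - emeasure lborel (ball (0 :: complex) u)"
      by (simp only:)
    also have "\<dots> = ennreal (pi * (1 - u\<^sup>2))"
      using that by (simp add: emeasure_ball unit_ball_vol_2 ennreal_minus algebra_simps power2_eq_square)
    finally show ?thesis .
  qed
  have "(\<integral>\<^sup>+y. ennreal (cmod y ^ (2 * n)) * indicator (ball 0 1) y \<partial>lborel) =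
    (\<integral>\<^sup>+y. \<integral>\<^sup>+u. ennreal (?p u) * ?i u y \<partial>lborel \<partial>lborel)"
    unfolding pow ..
  also have "\<dots> = (\<integral>\<^sup>+u. \<integral>\<^sup>+y. ennreal (?p u) * ?i u y \<partial>lborel \<partial>lborel)"
    by (rule lborel_pair.Fubini') measurable
  also have "\<dots> = (\<integral>\<^sup>+u. ennreal (?p u * (pi * (1 - u\<^sup>2))) * indicator {0..1} u \<partial>lborel)"
  proof (rule nn_integral_cong)
    fix u :: real
    show "(\<integral>\<^sup>+y. ennreal (?p u) * ?i u y \<partial>lborel) =
      ennreal (?p u * (pi * (1 - u\<^sup>2))) * indicator {0..1} u"
    proof (cases "0 \<le> u \<and> u \<le> 1")
      case True
      have "(\<integral>\<^sup>+y. ennreal (?p u) * ?i u y \<partial>lborel) =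
        (\<integral>\<^sup>+y. ennreal (?p u) * indicator {y :: complex. u \<le> cmod y \<and> cmod y < 1} y \<partial>lborel)"
        using True by (intro nn_integral_cong) (auto simp: indicator_def)
      also have "\<dots> = ennreal (?p u) * emeasure lborel {y :: complex. u \<le> cmod y \<and> cmod y < 1}"
        by (rule nn_integral_cmult_indicator) measurable
      finally show ?thesis
        using True by (simp add: area ennreal_mult')
    next
      case False
      then have "?i u y = 0" for y
        by auto
      then show ?thesis using False by auto
    qed
  qed
  also have "\<dots> = ennreal (pi * (1 ^ (2 * n) - real n / (real n + 1) * 1 ^ (2 * n + 2))
     - pi * (0 ^ (2 * n) - real n / (real n + 1) * 0 ^ (2 * n + 2)))"
  proof (rule nn_integral_FTC_Icc[where f = "\<lambda>u. ?p u * (pi * (1 - u\<^sup>2))" and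
        F = "\<lambda>u. pi * (u ^ (2 * n) - real n / (real n + 1) * u ^ (2 * n + 2))"])
    fix u :: real assume "u \<in> {0..1}"
    then have u: "0 \<le> u" "u \<le> 1" by auto
    have "u ^ (2 * n + 1) = u ^ (2 * n - 1) * u\<^sup>2"
      using assms by (simp flip: power_add)
    moreover have "((\<lambda>u. pi * (u ^ (2 * n) - real n / (real n + 1) * u ^ (2 * n + 2))) has_real_derivative
        pi * (?p u - real n / (real n + 1) * (real (2 * n + 2) * u ^ (2 * n + 1)))) (at u)"
      by (rule derivative_eq_intros p refl)+ simp
    moreover have "real n / (real n + 1) * (real (2 * n + 2) * c) = 2 * real n * c" for c
      by (simp add: field_simps)
    moreover have "pi * (2 * real n * p - 2 * real n * (p * q)) = 2 * real n * p * (pi * (1 - q))" for p q :: real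
      by (simp add: algebra_simps)
    ultimately show "((\<lambda>u. pi * (u ^ (2 * n) - real n / (real n + 1) * u ^ (2 * n + 2))) has_real_derivative
        ?p u * (pi * (1 - u\<^sup>2))) (at u)"
      by (simp only:)
    show "0 \<le> ?p u * (pi * (1 - u\<^sup>2))"
      using u by (simp add: power_le_one)
  qed auto
  also have "pi * (1 ^ (2 * n) - real n / (real n + 1) * 1 ^ (2 * n + 2))
     - pi * (0 ^ (2 * n) - real n / (real n + 1) * 0 ^ (2 * n + 2)) = pi / (real n + 1)"
    using assms by (cases n) (simp_all add: field_simps)
  finally show ?thesis .
qed

text \<open>For fixed y in the coordinate \<open>None\<close>, the others give a Gaussian integral,
  the product of all pi |y|^2 / a_k; \<open>nn_integral_disc_power\<close> then integrates |y|^(2n).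
  This is the limit integral in the Laplace method.\<close>

lemma nn_integral_cone:
  fixes a :: "'n::finite \<Rightarrow> real"
  assumes a: "\<And>k. a k > 0"
  shows "(\<integral>\<^sup>+z. ennreal (exp (- (\<Sum>k\<in>UNIV. a k * (cmod (z $ Some k))\<^sup>2) / (cmod (z $ None))\<^sup>2)) *
      indicator {z. z $ None \<noteq> 0 \<and> cmod (z $ None) < 1} z \<partial>(lborel :: (complex^('n option)) measure))
    = ennreal (pi ^ (CARD('n) + 1) / ((real CARD('n) + 1) * (\<Prod>k\<in>UNIV. a k)))" (is "?I = _")
proof -
  let ?n = "CARD('n)"
  let ?f = "\<lambda>y z. ennreal (exp (- (\<Sum>k\<in>UNIV. a k * (cmod (z $ k))\<^sup>2) / (cmod y)\<^sup>2)) *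
      indicator {y. y \<noteq> 0 \<and> cmod y < 1} y"
  have nn: "0 \<le> pi ^ ?n / (\<Prod>k\<in>UNIV. a k)"
    using a by (intro divide_nonneg_nonneg prod_nonneg) (auto intro: less_imp_le)
  have vec_meas [measurable]: "(\<lambda>z :: complex^'k. z $ k) \<in> borel_measurable borel" for k
    by (intro borel_measurable_continuous_onI continuous_intros)
  have "?I = (\<integral>\<^sup>+p. ?f (fst p) (snd p) \<partial>(lborel \<Otimes>\<^sub>M lborel))"
    unfolding lborel_opt_vec[symmetric]
    by (subst nn_integral_distr)
       (use opt_vec_measurable in \<open>auto simp: lborel_prod intro!: nn_integral_cong simp: indicator_def\<close>)
  also have "\<dots> = (\<integral>\<^sup>+y. \<integral>\<^sup>+z. ?f y z \<partial>lborel \<partial>lborel)"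
    by (subst lborel.nn_integral_fst[symmetric]) auto
  also have "\<dots> = (\<integral>\<^sup>+y. ennreal (pi ^ ?n / (\<Prod>k\<in>UNIV. a k)) * (ennreal (cmod y ^ (2 * ?n)) * indicator (ball 0 1) y) \<partial>lborel)"
  proof (rule nn_integral_cong)
    fix y :: complex
    show "(\<integral>\<^sup>+z. ?f y z \<partial>lborel) = ennreal (pi ^ ?n / (\<Prod>k\<in>UNIV. a k)) * (ennreal (cmod y ^ (2 * ?n)) * indicator (ball 0 1) y)"
    proof (cases "y = 0")
      case False
      define c where "c k = a k / (cmod y)\<^sup>2" for k
      have c: "c k > 0" for k using a False by (simp add: c_def)
      have "(\<integral>\<^sup>+z. ?f y z \<partial>lborel) =
        (\<integral>\<^sup>+z. ennreal (exp (- (\<Sum>k\<in>UNIV. c k * (cmod (z $ k))\<^sup>2))) * indicator (ball 0 1) y \<partial>(lborel :: (complex^'n) measure))"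
        using False by (intro nn_integral_cong) (auto simp: c_def sum_divide_distrib indicator_def)
      also have "\<dots> = ennreal (\<Prod>k\<in>UNIV. pi / c k) * indicator (ball 0 1) y"
        by (subst nn_integral_multc) (auto simp: nn_integral_gauss_vec c)
      also have "(\<Prod>k\<in>UNIV. pi / c k) = pi ^ ?n / (\<Prod>k\<in>UNIV. a k) * cmod y ^ (2 * ?n)"
        by (simp add: c_def prod_dividef prod_constant power_mult power_mult_distrib)
      also have "ennreal (pi ^ ?n / (\<Prod>k\<in>UNIV. a k) * cmod y ^ (2 * ?n)) =
          ennreal (pi ^ ?n / (\<Prod>k\<in>UNIV. a k)) * ennreal (cmod y ^ (2 * ?n))"
        by (rule ennreal_mult) (simp_all add: nn)
      finally show ?thesis by (simp add: mult.assoc)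
    qed simp
  qed
  also have "\<dots> = ennreal (pi ^ ?n / (\<Prod>k\<in>UNIV. a k)) * ennreal (pi / (real ?n + 1))"
  proof -
    have "(\<lambda>y :: complex. ennreal (cmod y ^ (2 * ?n)) * indicator (ball 0 1) y) \<in> borel_measurable borel"
      by (intro borel_measurable_times_ennreal borel_measurable_indicator ball_borel) measurable
    then show ?thesis
      by (subst nn_integral_cmult) (simp_all add: nn_integral_disc_power)
  qed
  also have "\<dots> = ennreal (pi ^ ?n / (\<Prod>k\<in>UNIV. a k) * (pi / (real ?n + 1)))"
    by (rule ennreal_mult[symmetric]) (simp_all add: nn)
  finally show ?thesis by (simp add: mult.commute)
qed

lemma measure_cball_pos: "measure lborel (cball 0 1 :: 'a::euclidean_space set) > 0"
  using ball_emeasure[where 'a = 'a]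
  by (simp add: measure_def enn2real_positive_iff top.not_eq_extremum less_top zero_less_iff_neq_zero)

lemma integral_sphere_measure:
  fixes g :: "'a::euclidean_space \<Rightarrow> real"
  assumes "g \<in> borel_measurable sphere_measure"
  shows "(\<lambda>v. indicator (sphere 0 1) v * g v) \<in> borel_measurable borel"
    and "(LINT v|sphere_measure. g v) =
      (LINT y|lborel. indicator (cball 0 1) y / measure lborel (cball 0 1 :: 'a set) * (indicator (sphere 0 1) (sgn y) * g (sgn y)))"
proof -
  have "g \<in> borel_measurable (restrict_space borel (sphere 0 1))"
    using assms by (simp add: measurable_cong_sets[OF sets_sphere_measure refl])
  then have *: "(\<lambda>v. indicator (sphere 0 1) v *\<^sub>R g v) \<in> borel_measurable borel"
    by (subst (asm) borel_measurable_restrict_space_iff) auto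
  then show meas [measurable]: "(\<lambda>v. indicator (sphere 0 1) v * g v) \<in> borel_measurable borel"
    by simp
  have ball: "(ball_measure :: 'a measure) = density lborel (\<lambda>y. ennreal (indicator (cball 0 1) y / measure lborel (cball 0 1 :: 'a set)))"
    unfolding ball_measure_def uniform_measure_def
  proof (rule density_cong)
    have c: "measure lborel (cball 0 1 :: 'a set) > 0"
      by (rule measure_cball_pos)
    have "emeasure lborel (cball 0 1 :: 'a set) = ennreal (measure lborel (cball 0 1 :: 'a set))"
      using ball_emeasure[where 'a = 'a] by (simp add: emeasure_eq_ennreal_measure)
    then show "AE y in lborel. indicator (cball 0 1) y / emeasure lborel (cball 0 1 :: 'a set) =
        ennreal (indicator (cball 0 1) y / measure lborel (cball 0 1 :: 'a set))"
      using c by (intro AE_I2) (auto simp: indicator_def divide_ennreal[symmetric])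
  qed auto
  have "(LINT v|sphere_measure. g v) = (LINT v|distr ball_measure borel sgn. indicator (sphere 0 1) v *\<^sub>R g v)"
    unfolding sphere_measure_def ball_measure_def by (rule integral_restrict_space) simp
  also have "\<dots> = (LINT y|ball_measure. indicator (sphere 0 1) (sgn y) *\<^sub>R g (sgn y))"
    by (rule integral_distr) (use * in auto)
  also have "\<dots> = (LINT y|lborel. (indicator (cball 0 1) y / measure lborel (cball 0 1 :: 'a set)) *\<^sub>R
      (indicator (sphere 0 1) (sgn y) *\<^sub>R g (sgn y)))"
    unfolding ball
  proof (rule integral_density)
    show "(\<lambda>y. indicator (sphere 0 1) (sgn y) *\<^sub>R g (sgn y)) \<in> borel_measurable lborel"
      using measurable_compose[OF sgn_measurable *] by simp
  qed auto
  finally show "(LINT v|sphere_measure. g v) =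
      (LINT y|lborel. indicator (cball 0 1) y / measure lborel (cball 0 1 :: 'a set) * (indicator (sphere 0 1) (sgn y) * g (sgn y)))"
    by simp
qed

definition shrink :: "real \<Rightarrow> complex^('n option) \<Rightarrow> complex^('n::finite option)" where
  "shrink h z = (\<chi> i. case i of None \<Rightarrow> z $ None | Some k \<Rightarrow> (1 / sqrt h) *\<^sub>R z $ Some k)"

lemma shrink_nth [simp]: "shrink h z $ None = z $ None" "shrink h z $ Some k = (1 / sqrt h) *\<^sub>R z $ Some k"
  by (simp_all add: shrink_def)

lemma shrink_measurable [measurable]:
  "(shrink h :: complex^('n::finite option) \<Rightarrow> _) \<in> borel_measurable borel"
proof -
  have "continuous_on UNIV (shrink h :: complex^('n option) \<Rightarrow> _)"
    unfolding shrink_def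
  proof (intro continuous_on_vec_lambda)
    fix i :: "'n option"
    show "continuous_on UNIV (\<lambda>z :: complex^('n option). case i of None \<Rightarrow> z $ None | Some k \<Rightarrow> (1 / sqrt h) *\<^sub>R z $ Some k)"
      by (cases i) (auto intro!: continuous_intros)
  qed
  then show ?thesis by (rule borel_measurable_continuous_onI)
qed

text \<open>The scaled coordinates are 2n real ones, each multiplied by 1 / sqrt h, so the Jacobian
  is h^(-n).\<close>

lemma integral_shrink:
  fixes f :: "complex^('n::finite option) \<Rightarrow> real"
  assumes h: "h > 0" and f: "f \<in> borel_measurable borel"
  shows "h ^ CARD('n) * (LINT y|lborel. f y) = (LINT z|lborel. f (shrink h z))"
proof -
  define c where "c b = (if b $ None \<noteq> 0 then 1 else 1 / sqrt h)" for b :: "complex^('n option)"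
  have c: "c b \<noteq> 0" for b using h by (simp add: c_def)
  have shrink: "0 + (\<Sum>j\<in>Basis. (c j * (z \<bullet> j)) *\<^sub>R j) = shrink h z" for z
  proof (rule euclidean_eqI)
    fix b :: "complex^('n option)" assume b: "b \<in> Basis"
    then obtain i u where iu: "b = axis i u" "u \<in> Basis" unfolding Basis_vec_def by blast
    then have "u \<noteq> 0" by (auto simp: Basis_complex_def)
    have "(0 + (\<Sum>j\<in>Basis. (c j * (z \<bullet> j)) *\<^sub>R j)) \<bullet> b = c b * (z \<bullet> b)"
      using b by simp
    also have "\<dots> = shrink h z \<bullet> b"
    proof -
      have "axis None u $ None = u" "axis (Some k) u $ None = 0" for k :: 'n
        by (simp_all add: axis_def)
      then show ?thesis
        using \<open>u \<noteq> 0\<close> unfolding iu(1) c_def by (cases i) (auto simp: inner_axis)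
    qed
    finally show "(0 + (\<Sum>j\<in>Basis. (c j * (z \<bullet> j)) *\<^sub>R j)) \<bullet> b = shrink h z \<bullet> b" .
  qed
  have "(\<Prod>j\<in>Basis. \<bar>c j\<bar>) = (\<Prod>k\<in>(UNIV :: 'n set). 1 / h)"
    using h by (simp add: prod_Basis_vec prod_option c_def axis_def)
  also have "\<dots> = 1 / h ^ CARD('n)"
    by (simp add: power_one_over)
  finally have prod: "(\<Prod>j\<in>Basis. \<bar>c j\<bar>) = 1 / h ^ CARD('n)" .
  have "(LINT y|lborel. f y) = (LINT y|density (distr lborel borel (shrink h)) (\<lambda>_. ennreal (1 / h ^ CARD('n))). f y)"
    using lborel_affine_euclidean[of c 0] c unfolding shrink prod by metis
  also have "\<dots> = (LINT y|distr lborel borel (shrink h). (1 / h ^ CARD('n)) *\<^sub>R f y)"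
    by (rule integral_density) (use f h in auto)
  also have "\<dots> = (LINT z|lborel. (1 / h ^ CARD('n)) *\<^sub>R f (shrink h z))"
    by (rule integral_distr) (use f in auto)
  finally show ?thesis using h by simp
qed

lemma norm_option_vec:
  fixes z :: "complex^('n::finite option)"
  shows "(norm z)\<^sup>2 = (cmod (z $ None))\<^sup>2 + (\<Sum>k\<in>UNIV. (cmod (z $ Some k))\<^sup>2)"
  by (simp add: norm_vec_def L2_set_def sum_nonneg sum_option)

lemma AE_coordinate_nonzero: "AE z in (lborel :: (complex^'k) measure). z $ i \<noteq> 0"
proof -
  have "negligible {z :: complex^'k. z \<bullet> axis i 1 = 0}"
    by (rule negligible_standard_hyperplane) (simp add: axis_in_Basis_iff Basis_complex_def)
  then have "AE z in lebesgue. z \<notin> {z :: complex^'k. z \<bullet> axis i 1 = 0}"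
    unfolding negligible_iff_null_sets by (rule AE_not_in)
  then have "AE z in (lborel :: (complex^'k) measure). z \<notin> {z. z \<bullet> axis i 1 = 0}"
    by (simp add: AE_completion_iff)
  then show ?thesis
    by eventually_elim (auto simp: inner_axis)
qed

text \<open>Scaling the coordinates other than \<open>None\<close> by \<open>h\<^sup>-\<^sup>1\<^sup>/\<^sup>2\<close> in the ball turns Laplace's method into
  dominated convergence, with no reparametrization of the sphere.\<close>

lemma sphere_laplace:
  fixes a :: "'n::finite \<Rightarrow> real" and J :: "complex^('n option) \<Rightarrow> real"
  assumes a: "\<And>k. a k > 0"
    and J: "J \<in> borel_measurable sphere_measure"
    and C: "\<And>v. norm v = 1 \<Longrightarrow> \<bar>J v\<bar> \<le> C"
    and lim: "\<And>e. e > 0 \<Longrightarrow> \<exists>\<delta>>0. \<forall>v. norm v = 1 \<longrightarrow> 1 - (cmod (v $ None))\<^sup>2 < \<delta> \<longrightarrow> \<bar>J v - Z\<bar> < e"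
  shows "((\<lambda>h. h ^ CARD('n) *
      (LINT v|sphere_measure. exp (- h * (\<Sum>k\<in>UNIV. a k * (cmod (v $ Some k))\<^sup>2)) * J v))
    \<longlongrightarrow> fact CARD('n) * Z / (\<Prod>k\<in>UNIV. a k)) at_top"
proof -
  let ?E = "UNIV :: (complex^('n option)) set"
  define q where "q z = (\<Sum>k\<in>UNIV. a k * (cmod (z $ Some k))\<^sup>2)" for z :: "complex^('n option)"
  define vol where "vol = measure lborel (cball 0 1 :: (complex^('n option)) set)"
  have vec_meas [measurable]: "(\<lambda>z :: complex^('n option). z $ k) \<in> borel_measurable borel" for k
    by (intro borel_measurable_continuous_onI continuous_intros)
  have q_meas [measurable]: "q \<in> borel_measurable borel"
    unfolding q_def[abs_def] by measurable
  have q_nonneg: "q z \<ge> 0" for z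
    unfolding q_def using a by (intro sum_nonneg mult_nonneg_nonneg) (auto intro: less_imp_le)
  define g where "g h v = exp (- h * q v) * J v" for h v
  have id_meas: "(\<lambda>v. v) \<in> borel_measurable (sphere_measure :: (complex^('n option)) measure)"
    unfolding measurable_cong_sets[OF sets_sphere_measure refl] by (rule measurable_restrict_space1) simp
  have g_meas: "g h \<in> borel_measurable sphere_measure" for h
    unfolding g_def using measurable_compose[OF id_meas q_meas] J by measurable
  \<comment> \<open>\<open>J\<close> is measurable on the sphere only; the extension by zero is a
    Borel function on the whole space.\<close>
  define J' where "J' v = indicator (sphere 0 1) v * J v" for v
  have J'_meas [measurable]: "J' \<in> borel_measurable borel"
    unfolding J'_def by (rule integral_sphere_measure(1)[OF J])
  define G where "G h y = indicator (cball 0 1) y / vol * (exp (- h * q (sgn y)) * J' (sgn y))" for h y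
  have G_meas [measurable]: "G h \<in> borel_measurable borel" for h
    unfolding G_def by measurable
  have q_sgn: "q (sgn y) = q y / (norm y)\<^sup>2" for y
    by (simp add: q_def sgn_div_norm norm_divide power_divide sum_divide_distrib norm_mult power_mult_distrib
        divide_inverse sum_distrib_right sum_distrib_left mult_ac power_inverse)
  have q_shrink: "h > 0 \<Longrightarrow> h * q (shrink h z) = q z" for h z
    by (simp add: q_def norm_mult power_mult_distrib sum_distrib_left power_divide)
  have sph: "h ^ CARD('n) * (LINT v|sphere_measure. g h v) = (LINT z|lborel. G h (shrink h z))" if "h > 0" for h
  proof -
    have "(LINT v|sphere_measure. g h v) = (LINT y|lborel. G h y)"
      by (subst integral_sphere_measure(2)[OF g_meas]) (simp add: G_def[abs_def] vol_def J'_def g_def mult_ac)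
    then show ?thesis using integral_shrink[OF that G_meas] by simp
  qed
  \<comment> \<open>In the limit the scaled coordinates drop out of the norm: the ball becomes the
    cylinder |z_None| < 1 and the squared norm becomes |z_None|^2.\<close>
  define L where "L z = (if z $ None \<noteq> 0 \<and> cmod (z $ None) < 1
      then exp (- q z / (cmod (z $ None))\<^sup>2) else 0) * (Z / vol)" for z
  have "((\<lambda>h. LINT z|lborel. G h (shrink h z)) \<longlongrightarrow> (LINT z|lborel. L z)) at_top"
  \<comment> \<open>Inside the ball, h q (sgn y) = q z / |y|^2 is at least \<open>q z\<close>. There
    |z_None| <= 1 as well, so the factor \<open>exp 1\<close> pays for exp (- |z_None|^2), which
    makes the majorant a Gaussian in all coordinates.\<close>
  proof (rule integral_dominated_convergence_at_top[where
      w = "\<lambda>z. (C / vol * exp 1) * exp (- (\<Sum>i\<in>UNIV. (case i of None \<Rightarrow> 1 | Some k \<Rightarrow> a k) * (cmod (z $ i))\<^sup>2))"])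
    show "L \<in> borel_measurable lborel"
      unfolding L_def by measurable
    show "(\<lambda>z. G h (shrink h z)) \<in> borel_measurable lborel" for h
      by measurable
    have "(\<integral>\<^sup>+z. ennreal (exp (- (\<Sum>i\<in>UNIV. (case i of None \<Rightarrow> 1 | Some k \<Rightarrow> a k) * (cmod (z $ i))\<^sup>2)))
        \<partial>(lborel :: (complex^('n option)) measure)) < \<infinity>"
      by (subst nn_integral_gauss_vec) (auto simp: a split: option.split)
    then have "integrable lborel (\<lambda>z :: complex^('n option).
        exp (- (\<Sum>i\<in>UNIV. (case i of None \<Rightarrow> 1 | Some k \<Rightarrow> a k) * (cmod (z $ i))\<^sup>2)))"
      by (intro integrableI_nonneg) (auto intro!: AE_I2)
    then show "integrable lborel (\<lambda>z :: complex^('n option). (C / vol * exp 1) *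
        exp (- (\<Sum>i\<in>UNIV. (case i of None \<Rightarrow> 1 | Some k \<Rightarrow> a k) * (cmod (z $ i))\<^sup>2)))"
      by (rule integrable_mult_right)
    show "\<forall>\<^sub>F h in at_top. AE z in lborel. norm (G h (shrink h z)) \<le> (C / vol * exp 1) *
        exp (- (\<Sum>i\<in>UNIV. (case i of None \<Rightarrow> 1 | Some k \<Rightarrow> a k) * (cmod (z $ i))\<^sup>2))"
      using eventually_gt_at_top[of 0]
    proof eventually_elim
      case (elim h)
      show ?case
      proof (rule AE_mp[OF AE_coordinate_nonzero[of None]], rule AE_I2, rule impI)
        fix z :: "complex^('n option)" assume z0: "z $ None \<noteq> 0"
        define y where "y = shrink h z"
        have "y \<noteq> 0" using z0 by (auto simp: y_def vec_eq_iff intro!: exI[of _ None])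
        have sum_eq: "(\<Sum>i\<in>UNIV. (case i of None \<Rightarrow> 1 | Some k \<Rightarrow> a k) * (cmod (z $ i))\<^sup>2)
            = (cmod (z $ None))\<^sup>2 + q z"
          by (simp add: sum_option q_def)
        have "C \<ge> 0" using C[of "sgn y"] \<open>y \<noteq> 0\<close> by (simp add: norm_sgn)
        have "vol \<ge> 0" by (simp add: vol_def)
        show "norm (G h (shrink h z)) \<le> (C / vol * exp 1) *
            exp (- (\<Sum>i\<in>UNIV. (case i of None \<Rightarrow> 1 | Some k \<Rightarrow> a k) * (cmod (z $ i))\<^sup>2))"
        proof (cases "norm y \<le> 1")
          case True
          have "(cmod (z $ None))\<^sup>2 \<le> (norm y)\<^sup>2"
            unfolding norm_option_vec[of y] by (simp add: y_def sum_nonneg)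
          also have y1: "(norm y)\<^sup>2 \<le> 1" using True by (simp add: power_le_one)
          finally have z1: "(cmod (z $ None))\<^sup>2 \<le> 1" .
          have "h * q (sgn y) = q z / (norm y)\<^sup>2"
            using q_shrink[OF elim, of z] by (simp add: q_sgn y_def)
          moreover have "q z \<le> q z / (norm y)\<^sup>2"
            using \<open>y \<noteq> 0\<close> y1 q_nonneg[of z] by (simp add: le_divide_eq mult_left_le)
          ultimately have "exp (- h * q (sgn y)) \<le> exp 1 * exp (- ((cmod (z $ None))\<^sup>2 + q z))"
            using z1 by (simp flip: exp_add)
          moreover have "\<bar>J' (sgn y)\<bar> \<le> C"
            using C[of "sgn y"] \<open>y \<noteq> 0\<close> by (simp add: J'_def norm_sgn)
          ultimately have "exp (- h * q (sgn y)) * \<bar>J' (sgn y)\<bar> \<le> exp 1 * exp (- ((cmod (z $ None))\<^sup>2 + q z)) * C"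
            by (intro mult_mono) auto
          then have "exp (- h * q (sgn y)) * \<bar>J' (sgn y)\<bar> / vol \<le> exp 1 * exp (- ((cmod (z $ None))\<^sup>2 + q z)) * C / vol"
            using \<open>vol \<ge> 0\<close> by (rule divide_right_mono)
          then show ?thesis
            using True \<open>vol \<ge> 0\<close> unfolding sum_eq y_def[symmetric] by (simp add: G_def abs_mult mult_ac)
        next
          case False
          then show ?thesis
            using \<open>vol \<ge> 0\<close> \<open>C \<ge> 0\<close> unfolding y_def[symmetric] by (simp add: G_def)
        qed
      qed
    qed
    show "AE z in lborel. ((\<lambda>h. G h (shrink h z)) \<longlongrightarrow> L z) at_top"
    \<comment> \<open>A nonzero coordinate besides \<open>None\<close> makes \<open>r\<close>
      positive. On the boundary |z_None| = 1 this keeps the scaled point outside the ball.\<close>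
    proof (rule AE_mp[OF AE_coordinate_nonzero[of None]],
        rule AE_mp[OF AE_coordinate_nonzero[of "Some undefined"]], rule AE_I2, intro impI)
      fix z :: "complex^('n option)" assume z1: "z $ Some undefined \<noteq> 0" and z0: "z $ None \<noteq> 0"
      define r where "r = (\<Sum>k\<in>UNIV. (cmod (z $ Some k))\<^sup>2)"
      have "r > 0"
        unfolding r_def using z1 by (intro sum_pos2[of _ undefined]) auto
      define N where "N h = (cmod (z $ None))\<^sup>2 + r / h" for h
      have N: "(norm (shrink h z))\<^sup>2 = N h" if "h > 0" for h
        using that unfolding norm_option_vec
        by (simp add: N_def r_def power_mult_distrib power_divide sum_divide_distrib)
      have N_lim: "(N \<longlongrightarrow> (cmod (z $ None))\<^sup>2) at_top"
        unfolding N_def by real_asymp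
      have shrink_nz: "shrink h z \<noteq> 0" for h
        using z0 by (auto simp: vec_eq_iff intro!: exI[of _ None])
      show "((\<lambda>h. G h (shrink h z)) \<longlongrightarrow> L z) at_top"
      proof (cases "cmod (z $ None) < 1")
        case False
        have "\<forall>\<^sub>F h in at_top. G h (shrink h z) = 0"
          using eventually_gt_at_top[of 0]
        proof eventually_elim
          case (elim h)
          have "1 \<le> (cmod (z $ None))\<^sup>2" using False by simp
          then have "1 < (norm (shrink h z))\<^sup>2"
            unfolding N[OF elim] N_def using \<open>r > 0\<close> elim divide_pos_pos[of r h] by linarith
          then have "\<not> norm (shrink h z) \<le> 1"
            by (metis norm_ge_zero not_le power_le_one)
          then show ?case by (simp add: G_def)
        qed
        then show ?thesis using False by (simp add: L_def tendsto_eventually)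
      next
        case True
        have "(cmod (z $ None))\<^sup>2 < 1" using True by (simp add: power_less_one_iff abs_square_less_1)
        then have "\<forall>\<^sub>F h in at_top. N h < 1"
          using N_lim by (rule order_tendstoD(2)[rotated])
        then have ev: "\<forall>\<^sub>F h in at_top. exp (- q z / N h) * J (sgn (shrink h z)) / vol = G h (shrink h z)"
          using eventually_gt_at_top[of 0]
        proof eventually_elim
          case (elim h)
          have "norm (shrink h z) \<le> 1"
            using elim N[of h] by (metis abs_norm_cancel abs_square_le_1 less_imp_le)
          moreover have "h * q (sgn (shrink h z)) = q z / N h"
            using q_shrink[of h z] elim by (simp add: q_sgn N)
          ultimately show ?case
            using shrink_nz by (simp add: G_def J'_def norm_sgn)
        qed
        have J_lim: "((\<lambda>h. J (sgn (shrink h z))) \<longlongrightarrow> Z) at_top"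
        proof (rule tendstoI)
          fix e :: real assume "e > 0"
          then obtain \<delta> where \<delta>: "\<delta> > 0"
            "\<And>v. norm v = 1 \<Longrightarrow> 1 - (cmod (v $ None))\<^sup>2 < \<delta> \<Longrightarrow> \<bar>J v - Z\<bar> < e"
            using lim by blast
          have "((\<lambda>h. 1 - (cmod (z $ None))\<^sup>2 / N h) \<longlongrightarrow> 1 - (cmod (z $ None))\<^sup>2 / (cmod (z $ None))\<^sup>2) at_top"
            using z0 by (intro tendsto_intros N_lim) simp
          then have "\<forall>\<^sub>F h in at_top. 1 - (cmod (z $ None))\<^sup>2 / N h < \<delta>"
            using z0 \<delta>(1) by (intro order_tendstoD(2)) auto
          then show "\<forall>\<^sub>F h in at_top. dist (J (sgn (shrink h z))) Z < e"
            using eventually_gt_at_top[of 0]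
          proof eventually_elim
            case (elim h)
            have "cmod (sgn (shrink h z) $ None) = cmod (z $ None) / norm (shrink h z)"
              by (simp add: sgn_div_norm divide_inverse norm_mult mult.commute)
            then have "(cmod (sgn (shrink h z) $ None))\<^sup>2 = (cmod (z $ None))\<^sup>2 / N h"
              using elim by (simp add: power_divide N)
            then show ?case
              using \<delta>(2)[of "sgn (shrink h z)"] elim shrink_nz by (simp add: dist_real_def norm_sgn)
          qed
        qed
        have "((\<lambda>h. exp (- q z / N h) * J (sgn (shrink h z)) / vol) \<longlongrightarrow>
            exp (- q z / (cmod (z $ None))\<^sup>2) * Z / vol) at_top"
          using z0 by (intro tendsto_intros N_lim J_lim) (auto simp: vol_def less_imp_neq[OF measure_cball_pos, symmetric])
        then show ?thesis
          using Lim_transform_eventually[OF _ ev] True z0 by (simp add: L_def)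
      qed
    qed
  qed
  moreover have "(LINT z|lborel. L z) = fact CARD('n) * Z / (\<Prod>k\<in>UNIV. a k)"
  proof -
    let ?k = "\<lambda>z. if z $ None \<noteq> 0 \<and> cmod (z $ None) < 1 then exp (- q z / (cmod (z $ None))\<^sup>2) else 0"
    have "(LINT z|lborel. ?k z) = enn2real (\<integral>\<^sup>+z. ennreal (?k z) \<partial>lborel)"
      by (rule integral_eq_nn_integral) auto
    also have "(\<integral>\<^sup>+z. ennreal (?k z) \<partial>lborel) =
        (\<integral>\<^sup>+z. ennreal (exp (- (\<Sum>k\<in>UNIV. a k * (cmod (z $ Some k))\<^sup>2) / (cmod (z $ None))\<^sup>2)) *
      indicator {z. z $ None \<noteq> 0 \<and> cmod (z $ None) < 1} z \<partial>(lborel :: (complex^('n option)) measure))"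
      by (intro nn_integral_cong) (auto simp: q_def indicator_def)
    also have "\<dots> = ennreal (pi ^ (CARD('n) + 1) / ((real CARD('n) + 1) * (\<Prod>k\<in>UNIV. a k)))"
      by (rule nn_integral_cone[OF a])
    finally have "(LINT z|lborel. ?k z) = pi ^ (CARD('n) + 1) / ((real CARD('n) + 1) * (\<Prod>k\<in>UNIV. a k))"
      using a by (simp add: prod_nonneg less_imp_le)
    \<comment> \<open>The volume pi^(n+1) / (n+1)! against pi^(n+1) / (n+1) from the cone integral
      leaves the factor n!.\<close>
    moreover have "vol = pi ^ (CARD('n) + 1) / fact (CARD('n) + 1)"
      using unit_ball_vol_even[of "CARD('n) + 1"] by (simp add: vol_def content_cball algebra_simps)
    moreover have "(LINT z|lborel. L z) = (LINT z|lborel. ?k z) * (Z / vol)"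
      unfolding L_def by (rule integral_mult_left_zero)
    moreover have "p / (m * A) * (Z / (p / (m * F))) = F * Z / A" if "p \<noteq> 0" "m \<noteq> 0" for p m A F :: real
      using that by simp
    moreover have "fact (CARD('n) + 1) = (real CARD('n) + 1) * fact CARD('n)"
      by simp
    ultimately show ?thesis
      by (simp only:) simp
  qed
  ultimately have "((\<lambda>h. LINT z|lborel. G h (shrink h z)) \<longlongrightarrow> fact CARD('n) * Z / (\<Prod>k\<in>UNIV. a k)) at_top"
    by simp
  moreover have "\<forall>\<^sub>F h in at_top. (LINT z|lborel. G h (shrink h z)) = h ^ CARD('n) * (LINT v|sphere_measure. g h v)"
    using eventually_gt_at_top[of 0] by eventually_elim (simp add: sph)
  ultimately show ?thesis
    unfolding g_def q_def by (rule Lim_transform_eventually)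
qed

section \<open>Asymptotics of the partition function\<close>

lemma isometry_column_norm:
  assumes "herm_conj Y ** Y = mat 1"
  shows "(\<Sum>i\<in>UNIV. (cmod (Y $ i $ k))\<^sup>2) = 1"
proof -
  have "complex_of_real (\<Sum>i\<in>UNIV. (cmod (Y $ i $ k))\<^sup>2) = (herm_conj Y ** Y) $ k $ k"
    by (simp only: of_real_sum complex_norm_square matrix_matrix_mult_def vec_lambda_beta herm_conj_nth
        mult.commute)
  also have "\<dots> = 1" by (simp add: assms mat_def)
  finally show ?thesis using of_real_eq_1_iff by blast
qed

lemma compact_isometries: "compact {Y :: complex^'n^'m. herm_conj Y ** Y = mat 1}"
proof -
  have "continuous_on UNIV (\<lambda>Y :: complex^'n^'m. herm_conj Y ** Y)"
    unfolding matrix_matrix_mult_def herm_conj_def by (intro continuous_intros continuous_on_vec_lambda)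
  then have "closed ((\<lambda>Y :: complex^'n^'m. herm_conj Y ** Y) -` {mat 1})"
    by (intro continuous_closed_vimage closed_singleton) (simp add: continuous_on_eq_continuous_at)
  moreover have "(\<lambda>Y :: complex^'n^'m. herm_conj Y ** Y) -` {mat 1} = {Y. herm_conj Y ** Y = mat 1}"
    by auto
  moreover have "bounded {Y :: complex^'n^'m. herm_conj Y ** Y = mat 1}"
    unfolding bounded_iff
  proof (intro exI ballI)
    fix Y :: "complex^'n^'m" assume "Y \<in> {Y. herm_conj Y ** Y = mat 1}"
    then have "(\<Sum>k\<in>(UNIV :: 'n set). \<Sum>i\<in>UNIV. (cmod (Y $ i $ k))\<^sup>2) = real CARD('n)"
      by (simp add: isometry_column_norm)
    then have "(\<Sum>i\<in>UNIV. \<Sum>k\<in>UNIV. (cmod (Y $ i $ k))\<^sup>2) = real CARD('n)"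
      by (subst sum.swap)
    then have "(norm Y)\<^sup>2 = real CARD('n)"
      by (simp add: norm_vec_def L2_set_def sum_nonneg)
    then show "norm Y \<le> sqrt (real CARD('n))"
      by (simp add: real_le_rsqrt)
  qed
  ultimately show ?thesis
    by (simp add: compact_eq_bounded_closed)
qed

context haar_extension
begin

definition Jint :: "('n option \<Rightarrow> real) \<Rightarrow> ('n \<Rightarrow> real) \<Rightarrow> complex^('n option) \<Rightarrow> real" where
  "Jint tt x v = (LINT U|\<mu>. exp (weight tt x (P v ** U)))"

lemma weight_frame: "weight tt (case_option h x) (frame (v, U)) =
    h * (\<Sum>a\<in>UNIV. tt a * (cmod (v $ a))\<^sup>2) + weight tt x (P v ** U)"
  by (simp add: frame_def weight_glue)

text \<open>With weight 0 on the column \<open>None\<close> the integrand becomes a function of the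
  whole unitary matrix. Measurability and bounds then come from \<open>frame\<close>, although
  \<open>P\<close> need not be continuous.\<close>

lemma Jint_frame: "Jint tt x v = (LINT U|\<mu>. exp (weight tt (case_option 0 x) (frame (v, U))))"
  by (simp add: Jint_def weight_frame)

lemma Jint_measurable [measurable]: "Jint tt x \<in> borel_measurable sph"
proof -
  have "continuous_on UNIV (\<lambda>W. exp (weight tt (case_option 0 x) W))"
    by (intro continuous_intros)
  then have "(\<lambda>W. exp (weight tt (case_option 0 x) W)) \<in> borel_measurable (restrict_space borel unitary_group)"
    by (intro measurable_restrict_space1 borel_measurable_continuous_onI)
  then have "(\<lambda>(v, U). exp (weight tt (case_option 0 x) (frame (v, U)))) \<in> borel_measurable (sph \<Otimes>\<^sub>M \<mu>)"
    using measurable_compose[OF frame_measurable] by (simp add: case_prod_beta)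
  then show ?thesis
    unfolding Jint_frame[abs_def]
    by (rule sigma_finite_measure.borel_measurable_lebesgue_integral[OF sigma_finite_haar])
qed

lemma Jint_bounded: obtains C where "\<And>v. norm v = 1 \<Longrightarrow> \<bar>Jint tt x v\<bar> \<le> C"
proof -
  have cont: "continuous_on UNIV (\<lambda>W :: complex^('n option)^('n option). exp (weight tt (case_option 0 x) W))"
    by (intro continuous_intros)
  have "bounded ((\<lambda>W :: complex^('n option)^('n option). exp (weight tt (case_option 0 x) W)) ` unitary_group)"
    by (intro compact_imp_bounded compact_continuous_image continuous_on_subset[OF cont] compact_unitary_group) simp
  then obtain C where C: "\<forall>z\<in>(\<lambda>W :: complex^('n option)^('n option). exp (weight tt (case_option 0 x) W)) ` unitary_group. norm z \<le> C"
    unfolding bounded_iff by blast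
  have "\<bar>Jint tt x v\<bar> \<le> C" if v: "norm v = 1" for v
  proof -
    have le: "exp (weight tt (case_option 0 x) (frame (v, U))) \<le> C" if "U \<in> unitary_group" for U
      using bspec[OF C imageI[OF frame_unitary[OF v that]]] by simp
    have "integrable \<mu> (\<lambda>U. exp (weight tt x (P v ** U)))"
      unfolding matrix_matrix_mult_def by (intro integrable_haar continuous_intros)
    then have "integrable \<mu> (\<lambda>U. exp (weight tt (case_option 0 x) (frame (v, U))))"
      by (simp add: weight_frame)
    then have "Jint tt x v \<le> (LINT U|\<mu>. C)"
      unfolding Jint_frame using le by (intro integral_mono) auto
    moreover have "Jint tt x v \<ge> 0"
      unfolding Jint_def by (intro Bochner_Integration.integral_nonneg) simp
    ultimately show ?thesis by simp
  qed
  then show thesis using that by blast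
qed

text \<open>If the row \<open>None\<close> of an isometry vanishes, the remaining square block is unitary and is absorbed
  by the Haar measure; compactness of the set of isometries turns this into a limit statement.\<close>

lemma Jint_limit:
  assumes "e > 0"
  shows "\<exists>\<delta>>0. \<forall>v. norm v = 1 \<longrightarrow> 1 - (cmod (v $ None))\<^sup>2 < \<delta> \<longrightarrow>
    \<bar>Jint (case_option s t) x v - Zint t x\<bar> < e"
proof -
  define K where "K = {Y :: complex^'n^('n option). herm_conj Y ** Y = mat 1}"
  define j where "j Y = (LINT U|\<mu>. exp (weight (case_option s t) x (Y ** U)))" for Y :: "complex^'n^('n option)"
  define \<rho> where "\<rho> Y = (\<Sum>k\<in>UNIV. (cmod (Y $ None $ k))\<^sup>2)" for Y :: "complex^'n^('n option)"
  have K: "compact K" unfolding K_def by (rule compact_isometries)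
  have "continuous_on UNIV (\<lambda>(Y :: complex^'n^('n option), U). exp (weight (case_option s t) x (Y ** U)))"
    unfolding case_prod_beta matrix_matrix_mult_def by (intro continuous_intros)
  then have j: "continuous_on K j"
    unfolding j_def by (intro continuous_on_expectation K)
  have zero: "j Y = Zint t x" if Y: "Y \<in> K" "\<rho> Y = 0" for Y
  proof -
    define Q where "Q = (\<chi> k l. Y $ Some k $ l)"
    have Y0: "Y $ None $ k = 0" for k
      using Y(2) unfolding \<rho>_def by (subst (asm) sum_nonneg_eq_0_iff) auto
    have "herm_conj Q ** Q = herm_conj Y ** Y"
      by (simp add: vec_eq_iff matrix_matrix_mult_def Q_def sum_option Y0)
    then have Q: "Q \<in> unitary_group"
      using Y(1) by (intro unitary_groupI) (simp add: K_def)
    have "weight (case_option s t) x (Y ** U) = weight t x (Q ** U)" for U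
      by (simp add: weight_def sum_option row_weight_def matrix_matrix_mult_def Q_def Y0)
    then have "j Y = (LINT U|\<mu>. exp (weight t x (Q ** U)))"
      by (simp add: j_def)
    also have "\<dots> = (LINT U|\<mu>. exp (weight t x U))"
      by (intro integral_left_mult[OF Q] continuous_measurable_haar continuous_intros)
    also have "\<dots> = Zint t x"
      using Zint_swap[of t x] by (simp add: Zint_def)
    finally show ?thesis .
  qed
  \<comment> \<open>\<open>B\<close> is the compact set of isometries for which \<open>j\<close> is
    off by at least e. There \<open>\<rho>\<close> has no zero, so its minimum is the required
    positive \<open>\<delta>\<close>.\<close>
  define B where "B = {Y \<in> K. e \<le> \<bar>j Y - Zint t x\<bar>}"
  have "closed B"
    unfolding B_def using compact_imp_closed[OF K]
    by (intro continuous_on_closed_Collect_le continuous_intros j)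
  then have "compact B"
    using compact_Int_closed[OF K, of B] by (simp add: B_def Int_absorb1 Int_commute inf.absorb2 Collect_conj_eq)
  have \<rho>: "continuous_on B \<rho>"
    unfolding \<rho>_def by (intro continuous_intros)
  obtain \<delta> where \<delta>: "\<delta> > 0" "\<And>Y. Y \<in> B \<Longrightarrow> \<delta> \<le> \<rho> Y"
  proof (cases "B = {}")
    case False
    then obtain Y0 where Y0: "Y0 \<in> B" "\<And>Y. Y \<in> B \<Longrightarrow> \<rho> Y0 \<le> \<rho> Y"
      using continuous_attains_inf[OF \<open>compact B\<close> _ \<rho>] by blast
    have "\<rho> Y0 \<noteq> 0" using zero[of Y0] Y0(1) assms by (auto simp: B_def)
    moreover have "\<rho> Y0 \<ge> 0" by (simp add: \<rho>_def sum_nonneg)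
    ultimately show thesis using that[of "\<rho> Y0"] Y0(2) by auto
  qed (use that[of 1] in auto)
  show ?thesis
  proof (intro exI[of _ \<delta>] conjI allI impI \<delta>(1))
    fix v :: "complex^('n option)" assume v: "norm v = 1" and less: "1 - (cmod (v $ None))\<^sup>2 < \<delta>"
    have "glue v (P v) \<in> unitary_group"
      by (rule glue_unitary) (simp_all add: v P_norm P_orth)
    \<comment> \<open>Row \<open>None\<close> of the glued matrix has norm 1, that is, |v_None|^2 +
      \<open>\<rho> (P v)\<close> = 1.\<close>
    from unitary_row_norm[OF this, of None] have "\<rho> (P v) < \<delta>"
      using less by (simp add: \<rho>_def sum_option)
    moreover have "P v \<in> K"
      unfolding K_def using isometry_herm_conj_mult[of "P v"] P_norm[OF v] by simp
    ultimately have "\<not> e \<le> \<bar>j (P v) - Zint t x\<bar>"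
      using \<delta>(2)[of "P v"] by (auto simp: B_def)
    then show "\<bar>Jint (case_option s t) x v - Zint t x\<bar> < e"
      by (simp add: Jint_def j_def)
  qed
qed

text \<open>\<open>Zint_swap\<close> attaches h to the column \<open>v\<close>, so the exponent
  contains h times the sum of \<open>tt a\<close> |v_a|^2. On the sphere this sum is at most
  \<open>s\<close>, with equality only if all coordinates but \<open>None\<close> vanish, as
  \<open>s\<close> exceeds every \<open>t k\<close>. Hence \<open>sphere_laplace\<close> applies
  with the coefficients s - t k, and each (h - x k) / h tends to 1.\<close>

lemma Zint_laplace:
  assumes s: "\<And>k. t k < s"
  shows "((\<lambda>h. (\<Prod>k\<in>UNIV. h - x k) * exp (- s * h) * ext.Zint (case_option s t) (case_option h x))
    \<longlongrightarrow> fact CARD('n) * Zint t x / (\<Prod>k\<in>UNIV. s - t k)) at_top"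
proof -
  define tt where "tt = case_option s t"
  obtain C where C: "\<And>v. norm v = 1 \<Longrightarrow> \<bar>Jint tt x v\<bar> \<le> C"
    using Jint_bounded by blast
  have Z: "exp (- s * h) * ext.Zint tt (case_option h x) =
      (LINT v|sph. exp (- h * (\<Sum>k\<in>UNIV. (s - t k) * (cmod (v $ Some k))\<^sup>2)) * Jint tt x v)" for h
  proof -
    have cont: "continuous_on UNIV (\<lambda>W :: complex^('n option)^('n option). exp (weight tt (case_option h x) W))"
      by (intro continuous_intros)
    have "ext.Zint tt (case_option h x) = (LINT W|ext_haar. exp (weight tt (case_option h x) W))"
      unfolding ext.Zint_swap[of tt] by (simp add: ext.Zint_def)
    also have "\<dots> = (LINT v|sph. LINT U|\<mu>. exp (weight tt (case_option h x) (frame (v, U))))"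
      by (rule integral_ext_haar[OF cont])
    finally have "exp (- s * h) * ext.Zint tt (case_option h x) =
        (LINT v|sph. exp (- s * h) * (LINT U|\<mu>. exp (weight tt (case_option h x) (frame (v, U)))))"
      by simp
    also have "\<dots> = (LINT v|sph. exp (- h * (\<Sum>k\<in>UNIV. (s - t k) * (cmod (v $ Some k))\<^sup>2)) * Jint tt x v)"
    proof (rule Bochner_Integration.integral_cong[OF refl])
      fix v :: "complex^('n option)" assume "v \<in> space sph"
      then have N: "(cmod (v $ None))\<^sup>2 = 1 - (\<Sum>k\<in>UNIV. (cmod (v $ Some k))\<^sup>2)"
        using norm_option_vec[of v] by simp
      define R where "R = (\<Sum>k\<in>UNIV. (s - t k) * (cmod (v $ Some k))\<^sup>2)"
      have eq: "(\<Sum>a\<in>UNIV. tt a * (cmod (v $ a))\<^sup>2) = s - R"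
        by (simp add: tt_def R_def sum_option N left_diff_distrib right_diff_distrib sum_subtractf sum_distrib_left)
      have "exp (weight tt (case_option h x) (frame (v, U))) =
          exp (s * h) * exp (- h * R) * exp (weight tt x (P v ** U))" for U
        unfolding weight_frame eq by (simp add: right_diff_distrib mult.commute flip: exp_add)
      moreover have "exp (- s * h) * (exp (s * h) * exp (- h * R) * y) = exp (- h * R) * y" for y
        by (simp add: mult.assoc[symmetric] flip: exp_add)
      ultimately show "exp (- s * h) * (LINT U|\<mu>. exp (weight tt (case_option h x) (frame (v, U)))) =
          exp (- h * (\<Sum>k\<in>UNIV. (s - t k) * (cmod (v $ Some k))\<^sup>2)) * Jint tt x v"
        unfolding Jint_def R_def[symmetric] by (simp only: integral_mult_right_zero)
    qed
    finally show ?thesis .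
  qed
  have lim: "((\<lambda>h. h ^ CARD('n) * (exp (- s * h) * ext.Zint tt (case_option h x)))
      \<longlongrightarrow> fact CARD('n) * Zint t x / (\<Prod>k\<in>UNIV. s - t k)) at_top"
    unfolding Z by (rule sphere_laplace) (use s C Jint_limit in \<open>auto simp: tt_def\<close>)
  have "((\<lambda>h. \<Prod>k\<in>UNIV. (h - x k) / h) \<longlongrightarrow> (\<Prod>k\<in>(UNIV :: 'n set). 1)) at_top"
    by (intro tendsto_prod) real_asymp
  then have "((\<lambda>h. (\<Prod>k\<in>UNIV. (h - x k) / h) * (h ^ CARD('n) * (exp (- s * h) * ext.Zint tt (case_option h x))))
      \<longlongrightarrow> 1 * (fact CARD('n) * Zint t x / (\<Prod>k\<in>UNIV. s - t k))) at_top"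
    using lim by (intro tendsto_mult) simp_all
  moreover have "\<forall>\<^sub>F h in at_top. (\<Prod>k\<in>UNIV. (h - x k) / h) * (h ^ CARD('n) * (exp (- s * h) * ext.Zint tt (case_option h x)))
     = (\<Prod>k\<in>UNIV. h - x k) * exp (- s * h) * ext.Zint tt (case_option h x)"
    using eventually_gt_at_top[of 0] by eventually_elim (simp add: prod_dividef prod_constant)
  ultimately show ?thesis
    unfolding tt_def by (auto intro: Lim_transform_eventually)
qed

lemma Zint_pos: "Zint t x > 0"
proof -
  have cont: "continuous_on UNIV (\<lambda>U :: complex^'n^'n. weight x t U)"
    by (intro continuous_intros)
  have "bounded ((\<lambda>U :: complex^'n^'n. weight x t U) ` unitary_group)"
    by (intro compact_imp_bounded compact_continuous_image continuous_on_subset[OF cont] compact_unitary_group) simp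
  then obtain C where C: "\<forall>z\<in>(\<lambda>U :: complex^'n^'n. weight x t U) ` unitary_group. norm z \<le> C"
    unfolding bounded_iff by blast
  have "(LINT U|\<mu>. exp (- C)) \<le> Zint t x"
    unfolding Zint_def
  proof (rule integral_mono)
    show "integrable \<mu> (\<lambda>U. exp (weight x t U))"
      by (intro integrable_haar continuous_intros)
    show "exp (- C) \<le> exp (weight x t U)" if "U \<in> space \<mu>" for U
      using bspec[OF C imageI, of U] that by simp
  qed simp
  then show ?thesis by (simp add: less_le_trans[OF exp_gt_zero])
qed

end

section \<open>Exponential interpolation\<close>

text \<open>Induction by Rolle's theorem: after division by e^(t_j y), differentiation removes the
  term j and costs one zero.\<close>

lemma exp_sum_zeros:
  fixes c t :: "'k \<Rightarrow> real"
  assumes "finite K" "inj_on t K" "finite A" "card A = card K"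
    "\<And>y. y \<in> A \<Longrightarrow> (\<Sum>k\<in>K. c k * exp (t k * y)) = 0"
  shows "\<forall>k\<in>K. c k = 0"
  using assms
proof (induction K arbitrary: c t A rule: finite_induct)
  case (insert j K)
  define f where "f y = c j + (\<Sum>k\<in>K. c k * exp ((t k - t j) * y))" for y
  define f' where "f' y = (\<Sum>k\<in>K. (c k * (t k - t j)) * exp ((t k - t j) * y))" for y
  have df: "(f has_real_derivative f' y) (at y)" for y
    unfolding f_def f'_def by (auto intro!: derivative_eq_intros sum.cong)
  have f0: "f y = 0" if "y \<in> A" for y
  proof -
    have "(\<Sum>k\<in>insert j K. c k * exp (t k * y)) = exp (t j * y) * f y"
    proof -
      have e: "exp (t k * y) = exp (t j * y) * exp ((t k - t j) * y)" for k
        by (simp add: algebra_simps flip: exp_add)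
      show ?thesis
        using insert.hyps unfolding f_def distrib_left sum_distrib_left
        by (simp add: mult.left_commute flip: e)
    qed
    then show ?thesis using insert.prems(4)[OF that] by simp
  qed
  \<comment> \<open>Each gap between neighbouring zeros of \<open>f\<close> contains a zero of
    \<open>f'\<close>. In the induction on the largest element, the bound by the maximum keeps the
    new zero different from the earlier ones.\<close>
  have zeros: "\<exists>B. finite B \<and> card B = card A - 1 \<and> (\<forall>y\<in>B. f' y = 0) \<and> (\<forall>y\<in>B. y < Max A)" if "A \<noteq> {}"
  proof -
    have "\<exists>B. finite B \<and> card B = card A' - 1 \<and> (\<forall>y\<in>B. f' y = 0) \<and> (\<forall>y\<in>B. y < Max A')"
      if "finite A'" "A' \<noteq> {}" "\<forall>y\<in>A'. f y = 0" for A'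
      using that
    proof (induction A' rule: finite_linorder_max_induct)
      case (insert b A')
      show ?case
      proof (cases "A' = {}")
        case False
        then obtain B where B: "finite B" "card B = card A' - 1" "\<forall>y\<in>B. f' y = 0" "\<forall>y\<in>B. y < Max A'"
          using insert by auto
        have M: "Max A' \<in> A'" "Max A' < b" using insert False by auto
        have "continuous_on {Max A'..b} f"
          by (rule DERIV_continuous_on[OF has_field_derivative_at_within[OF df]])
        moreover have "f (Max A') = f b" using insert.prems M by simp
        ultimately have "\<exists>z. Max A' < z \<and> z < b \<and> DERIV f z :> 0"
          using df by (intro Rolle[OF M(2)]) (auto simp: real_differentiable_def)
        then obtain z where z: "Max A' < z" "z < b" "f' z = 0"
          using df DERIV_unique by blast
        have "z \<notin> B" using B(4) z(1) by auto
        moreover have "card A' > 0" using False insert.hyps by (simp add: card_gt_0_iff)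
        moreover have "Max (insert b A') = b"
          using insert.hyps M by (intro Max_eqI) auto
        moreover have "b \<notin> A'" using insert.hyps by auto
        ultimately show ?thesis
          using B z insert.hyps by (intro exI[of _ "insert z B"]) (auto intro: less_trans)
      qed auto
    qed auto
    from this[OF insert.prems(2) that] show ?thesis using f0 by blast
  qed
  have "card A = Suc (card K)" using insert by simp
  then have "A \<noteq> {}" by auto
  then obtain B where B: "finite B" "card B = card K" "\<forall>y\<in>B. f' y = 0"
    using zeros \<open>card A = Suc (card K)\<close> by auto
  have "inj_on (\<lambda>k. t k - t j) K" using insert.prems(1) by (auto simp: inj_on_def)
  then have "\<forall>k\<in>K. c k * (t k - t j) = 0"
    using insert.IH[of "\<lambda>k. t k - t j" B "\<lambda>k. c k * (t k - t j)"] B by (auto simp: f'_def)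
  moreover have "t k \<noteq> t j" if "k \<in> K" for k
    using insert.prems(1) insert.hyps that by (auto simp: inj_on_def)
  ultimately have cK: "\<forall>k\<in>K. c k = 0" by auto
  obtain y where "y \<in> A" using \<open>A \<noteq> {}\<close> by auto
  from f0[OF this] cK have "c j = 0" by (simp add: f_def)
  then show ?case using cK by simp
qed auto

definition exp_sum :: "('n::finite \<Rightarrow> real) \<Rightarrow> ('n \<Rightarrow> complex) \<Rightarrow> real \<Rightarrow> complex" where
  "exp_sum t c = (\<lambda>y. \<Sum>k\<in>UNIV. c k * exp (complex_of_real (t k * y)))"

lemma exp_sum_unique:
  fixes t x :: "'n::finite \<Rightarrow> real"
  assumes "inj t" "inj x" "\<And>m. exp_sum t c (x m) = 0"
  shows "c k = 0"
proof -
  have re: "Re (exp_sum t c y) = (\<Sum>k\<in>UNIV. Re (c k) * exp (t k * y))"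
    and im: "Im (exp_sum t c y) = (\<Sum>k\<in>UNIV. Im (c k) * exp (t k * y))" for y
    unfolding exp_sum_def Re_sum Im_sum exp_of_real by simp_all
  have "(\<Sum>k\<in>UNIV. Re (c k) * exp (t k * y)) = 0" "(\<Sum>k\<in>UNIV. Im (c k) * exp (t k * y)) = 0"
    if "y \<in> range x" for y
    using assms(3) that re im by (auto simp flip: re im)
  then have "\<forall>k\<in>UNIV. Re (c k) = 0" "\<forall>k\<in>UNIV. Im (c k) = 0"
    using assms(1,2) by (intro exp_sum_zeros[of UNIV t "range x"]; simp add: card_image)+
  then show ?thesis by (simp add: complex_eq_iff)
qed

context
  fixes x t :: "'n::finite \<Rightarrow> real"
  assumes x: "inj x" and t: "inj t"
begin

lemma exp_interpolant_eqI:
  assumes "\<And>m. exp_sum t c (x m) = f (x m)"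
  shows "exp_interpolant x t f = exp_sum t c"
  unfolding exp_interpolant_def
proof (rule the_equality)
  show "(\<exists>c'. exp_sum t c = (\<lambda>y. \<Sum>k\<in>UNIV. c' k * exp (complex_of_real (t k * y)))) \<and>
      (\<forall>m. exp_sum t c (x m) = f (x m))"
    using assms by (auto simp: exp_sum_def)
  fix g assume "(\<exists>c. g = (\<lambda>y. \<Sum>k\<in>UNIV. c k * exp (complex_of_real (t k * y)))) \<and> (\<forall>m. g (x m) = f (x m))"
  then obtain d where g: "g = exp_sum t d" "\<And>m. g (x m) = f (x m)"
    by (auto simp: exp_sum_def)
  have "exp_sum t (\<lambda>k. d k - c k) (x m) = 0" for m
    using assms[of m] g(2)[of m] unfolding g(1) by (simp add: exp_sum_def left_diff_distrib sum_subtractf)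
  from exp_sum_unique[OF t x this] show "g = exp_sum t c"
    unfolding g(1) by (simp add: exp_sum_def)
qed

text \<open>The matrix is square, so uniqueness, in the form of a trivial kernel, yields
  existence.\<close>

lemma exp_sum_exists: "\<exists>c. \<forall>m. exp_sum t c (x m) = f m"
proof -
  define A where "A = (\<chi> m k. exp (complex_of_real (t k * x m)))"
  have A: "(A *v v) $ m = exp_sum t (\<lambda>k. v $ k) (x m)" for v m
    by (simp add: A_def matrix_vector_mult_def exp_sum_def mult.commute)
  have "v = 0" if "A *v v = 0" for v
    using exp_sum_unique[OF t x, of "\<lambda>k. v $ k"] that A[of v] by (simp add: vec_eq_iff)
  then obtain B where "B ** A = mat 1"
    using matrix_left_invertible_ker[of A] by blast
  then have "A ** B = mat 1" by (simp add: matrix_left_right_inverse)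
  then have "A *v (B *v (\<chi> m. f m)) = (\<chi> m. f m)"
    by (simp add: matrix_vector_mul_assoc)
  then have "\<forall>m. exp_sum t (\<lambda>k. (B *v (\<chi> m. f m)) $ k) (x m) = f m"
    unfolding A[symmetric] by simp
  then show ?thesis by blast
qed

lemma exp_interpolant_linear:
  "exp_interpolant x t (\<lambda>y. f y + a * g y) y = exp_interpolant x t f y + a * exp_interpolant x t g y"
proof -
  obtain c d where c: "\<And>m. exp_sum t c (x m) = f (x m)" and d: "\<And>m. exp_sum t d (x m) = g (x m)"
    using exp_sum_exists[of "\<lambda>m. f (x m)"] exp_sum_exists[of "\<lambda>m. g (x m)"] by auto
  have lin: "exp_sum t (\<lambda>k. c k + a * d k) y = exp_sum t c y + a * exp_sum t d y" for y
    by (simp add: exp_sum_def distrib_right sum.distrib sum_distrib_left mult.assoc)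
  have "exp_interpolant x t (\<lambda>y. f y + a * g y) = exp_sum t (\<lambda>k. c k + a * d k)"
    by (rule exp_interpolant_eqI) (simp add: lin c d)
  then show ?thesis
    by (simp add: lin exp_interpolant_eqI[of c f, OF c] exp_interpolant_eqI[of d g, OF d])
qed

lemma exp_interpolant_node: "exp_interpolant x t f (x m) = f (x m)"
proof -
  obtain c where c: "\<And>m. exp_sum t c (x m) = f (x m)"
    using exp_sum_exists[of "\<lambda>m. f (x m)"] by auto
  show ?thesis by (simp add: exp_interpolant_eqI[of c f, OF c] c)
qed

text \<open>The constant is a Lebesgue constant at \<open>y\<close>: the sum of the absolute values
  of the cardinal functions, each equal to 1 at one node and 0 at the others. It does not depend on
  f.\<close>

lemma exp_interpolant_bound:
  obtains C where "C \<ge> 0" "\<And>f e. (\<And>m. cmod (f (x m)) \<le> e) \<Longrightarrow> cmod (exp_interpolant x t f y) \<le> C * e"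
proof -
  obtain d where d: "\<And>m k. exp_sum t (d m) (x k) = (if k = m then 1 else 0)"
  proof -
    have "\<forall>m. \<exists>d. \<forall>k. exp_sum t d (x k) = (if k = m then 1 else 0)"
      using exp_sum_exists[of "\<lambda>k. if k = _ then 1 else 0"] by blast
    then show thesis using that by metis
  qed
  show thesis
  proof
    show "0 \<le> (\<Sum>m\<in>UNIV. cmod (exp_sum t (d m) y))" by (simp add: sum_nonneg)
    fix f :: "real \<Rightarrow> complex" and e assume e: "\<And>m. cmod (f (x m)) \<le> e"
    have lin: "exp_sum t (\<lambda>k. \<Sum>m\<in>UNIV. f (x m) * d m k) z = (\<Sum>m\<in>UNIV. f (x m) * exp_sum t (d m) z)" for z
      unfolding exp_sum_def sum_distrib_right sum_distrib_left
      by (subst sum.swap) (simp add: mult.assoc)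
    have "exp_interpolant x t f = exp_sum t (\<lambda>k. \<Sum>m\<in>UNIV. f (x m) * d m k)"
      by (rule exp_interpolant_eqI) (simp add: lin d if_distrib cong: if_cong)
    then have "cmod (exp_interpolant x t f y) \<le> (\<Sum>m\<in>UNIV. cmod (f (x m)) * cmod (exp_sum t (d m) y))"
      unfolding lin by (auto intro!: order_trans[OF norm_sum] sum_mono simp: lin norm_mult)
    also have "\<dots> \<le> (\<Sum>m\<in>UNIV. e * cmod (exp_sum t (d m) y))"
      by (intro sum_mono mult_right_mono e) simp
    finally show "cmod (exp_interpolant x t f y) \<le> (\<Sum>m\<in>UNIV. cmod (exp_sum t (d m) y)) * e"
      by (simp add: sum_distrib_left sum_distrib_right mult.commute)
  qed
qed

lemma exp_interpolant_exp_sum: "exp_interpolant x t (exp_sum t c) = exp_sum t c"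
  by (rule exp_interpolant_eqI) simp

end

section \<open>Exponentials and linear differential operators on an interval\<close>

context
  fixes a b :: real
  assumes ab: "a < b"
begin

abbreviation "vd f \<equiv> \<lambda>y. vector_derivative f (at y within {a..b})"

lemma vd_eqI: "q \<in> {a..b} \<Longrightarrow> (f has_vector_derivative f') (at q within {a..b}) \<Longrightarrow> vd f q = f'"
  using vector_derivative_within_cbox[of a b q f f'] ab by simp

lemma vd_works: "f differentiable_on {a..b} \<Longrightarrow> q \<in> {a..b} \<Longrightarrow> (f has_vector_derivative vd f q) (at q within {a..b})"
  by (simp add: differentiable_on_def vector_derivative_works)

lemma vd_cong:
  assumes "\<And>q. q \<in> {a..b} \<Longrightarrow> f q = g q" "q \<in> {a..b}"
  shows "vd f q = vd g q"
proof -
  have "(f has_vector_derivative d) (at q within {a..b}) \<longleftrightarrow> (g has_vector_derivative d) (at q within {a..b})" for d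
    using has_vector_derivative_transform[OF assms(2), of f g d] has_vector_derivative_transform[OF assms(2), of g f d] assms(1)
    by auto
  then show ?thesis by (simp add: vector_derivative_def)
qed

lemma differentiable_on_lin:
  fixes f g :: "real \<Rightarrow> complex"
  assumes "f differentiable_on {a..b}" "g differentiable_on {a..b}"
  shows "(\<lambda>q. f q + c * g q) differentiable_on {a..b}"
    and "q \<in> {a..b} \<Longrightarrow> vd (\<lambda>q. f q + c * g q) q = vd f q + c * vd g q"
proof -
  have d: "((\<lambda>q. f q + c * g q) has_vector_derivative (vd f q + c * vd g q)) (at q within {a..b})" if "q \<in> {a..b}" for q
    using vd_works[OF assms(1) that] vd_works[OF assms(2) that]
    by (auto intro!: derivative_eq_intros)
  then show "q \<in> {a..b} \<Longrightarrow> vd (\<lambda>q. f q + c * g q) q = vd f q + c * vd g q"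
    by (intro vd_eqI)
  show "(\<lambda>q. f q + c * g q) differentiable_on {a..b}"
    using d unfolding differentiable_on_def by (blast intro: differentiableI_vector)
qed

lemma Ck_on_cong:
  "(\<And>q. q \<in> {a..b} \<Longrightarrow> f q = g q) \<Longrightarrow> Ck_on k {a..b} f \<Longrightarrow> Ck_on k {a..b} g"
proof (induction k arbitrary: f g)
  case 0
  then show ?case using continuous_on_cong[of "{a..b}" "{a..b}" f g] by simp
next
  case (Suc k)
  have "g differentiable_on {a..b}"
    unfolding differentiable_on_def
  proof
    fix q assume "q \<in> {a..b}"
    with Suc.prems(2) have "f differentiable (at q within {a..b})" by (simp add: differentiable_on_def)
    then show "g differentiable (at q within {a..b})"
      by (rule differentiable_transform_within[of _ _ _ 1]) (use Suc.prems(1) \<open>q \<in> {a..b}\<close> in auto)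
  qed
  moreover have "Ck_on k {a..b} (vd g)"
    by (rule Suc.IH[of "vd f"]) (use Suc.prems vd_cong[of f g] in auto)
  ultimately show ?case by simp
qed

lemma Ck_on_lin: "Ck_on k {a..b} f \<Longrightarrow> Ck_on k {a..b} g \<Longrightarrow> Ck_on k {a..b} (\<lambda>q. f q + c * g q)"
proof (induction k arbitrary: f g)
  case 0
  then show ?case by (auto intro!: continuous_intros)
next
  case (Suc k)
  have "Ck_on k {a..b} (\<lambda>q. vd f q + c * vd g q)"
    using Suc by auto
  then have "Ck_on k {a..b} (vd (\<lambda>q. f q + c * g q))"
    using Suc.prems by (elim Ck_on_cong[rotated]) (simp add: differentiable_on_lin(2))
  then show ?case using Suc.prems by (simp add: differentiable_on_lin(1))
qed

lemma Ck_on_Suc_imp: "Ck_on (Suc k) {a..b} f \<Longrightarrow> Ck_on k {a..b} f"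
  by (induction k arbitrary: f) (auto intro: differentiable_imp_continuous_on)

abbreviation expf :: "real \<Rightarrow> real \<Rightarrow> complex" where "expf s \<equiv> \<lambda>q. exp (complex_of_real (s * q))"

lemma expf_deriv: "((\<lambda>q. c * expf s q) has_vector_derivative c * (complex_of_real s * expf s q)) (at q within T)"
proof -
  have "((\<lambda>q. exp (complex_of_real s * complex_of_real q)) has_vector_derivative
      complex_of_real s * exp (complex_of_real s * complex_of_real q)) (at q within T)"
    by (rule has_vector_derivative_real_field) (auto intro!: derivative_eq_intros)
  then show ?thesis by (intro has_vector_derivative_mult_right) simp
qed

lemma expf_vd: "q \<in> {a..b} \<Longrightarrow> vd (\<lambda>q. c * expf s q) q = c * complex_of_real s * expf s q"
  using vd_eqI[OF _ expf_deriv[of c s q "{a..b}"]] by (simp add: mult.assoc)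

lemma Ck_on_expf: "Ck_on k {a..b} (\<lambda>q. c * expf s q)"
proof (induction k arbitrary: c)
  case 0
  show ?case by (auto intro!: continuous_intros)
next
  case (Suc k)
  have "Ck_on k {a..b} (vd (\<lambda>q. c * expf s q))"
    by (rule Ck_on_cong[OF _ Suc.IH[of "c * complex_of_real s"]]) (simp only: expf_vd)
  moreover have "(\<lambda>q. c * expf s q) differentiable_on {a..b}"
    unfolding differentiable_on_def by (blast intro: differentiableI_vector expf_deriv)
  ultimately show ?case by simp
qed

lemma Ck_on_diff_ops: "Ck_on (length ts + k) {a..b} f \<Longrightarrow> Ck_on k {a..b} (diff_ops {a..b} ts f)"
proof (induction ts arbitrary: k)
  case (Cons t ts)
  have *: "Ck_on (Suc k) {a..b} (diff_ops {a..b} ts f)"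
    using Cons.IH[of "Suc k"] Cons.prems by (simp del: Ck_on.simps)
  have "Ck_on k {a..b} (\<lambda>q. vd (diff_ops {a..b} ts f) q + (- complex_of_real t) * diff_ops {a..b} ts f q)"
    using * Ck_on_Suc_imp[OF *] by (intro Ck_on_lin) auto
  then show ?case by simp
qed simp

lemma diff_ops_lin:
  assumes "Ck_on (length ts) {a..b} f" "Ck_on (length ts) {a..b} g" "q \<in> {a..b}"
  shows "diff_ops {a..b} ts (\<lambda>q. f q + c * g q) q = diff_ops {a..b} ts f q + c * diff_ops {a..b} ts g q"
  using assms
proof (induction ts arbitrary: q)
  case (Cons t ts)
  have k: "Ck_on (length ts) {a..b} f" "Ck_on (length ts) {a..b} g"
    using Cons.prems by (auto intro: Ck_on_Suc_imp)
  have "diff_ops {a..b} ts f differentiable_on {a..b}" "diff_ops {a..b} ts g differentiable_on {a..b}"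
    using Ck_on_diff_ops[of ts 1 f] Ck_on_diff_ops[of ts 1 g] Cons.prems by auto
  then have "vd (\<lambda>q. diff_ops {a..b} ts f q + c * diff_ops {a..b} ts g q) q
      = vd (diff_ops {a..b} ts f) q + c * vd (diff_ops {a..b} ts g) q"
    using Cons.prems(3) by (rule differentiable_on_lin(2))
  moreover have "vd (diff_ops {a..b} ts (\<lambda>q. f q + c * g q)) q = vd (\<lambda>q. diff_ops {a..b} ts f q + c * diff_ops {a..b} ts g q) q"
    by (rule vd_cong) (use Cons.IH k Cons.prems in auto)
  ultimately show ?case
    using Cons.IH[OF k Cons.prems(3)] by (simp add: algebra_simps)
qed simp

text \<open>Each factor d/dq - t has e^(sq) as an eigenfunction with eigenvalue s - t.\<close>

lemma diff_ops_expf: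
  "q \<in> {a..b} \<Longrightarrow> diff_ops {a..b} ts (expf s) q = complex_of_real (\<Prod>t\<leftarrow>ts. s - t) * expf s q"
proof (induction ts arbitrary: q)
  case (Cons t ts)
  let ?p = "complex_of_real (\<Prod>t\<leftarrow>ts. s - t)"
  have "vd (diff_ops {a..b} ts (expf s)) q = vd (\<lambda>q. ?p * expf s q) q"
    by (rule vd_cong) (use Cons in auto)
  also have "\<dots> = ?p * complex_of_real s * expf s q"
    using Cons.prems by (rule expf_vd)
  finally show ?case using Cons by (simp add: algebra_simps)
qed simp

text \<open>If \<open>u' - t u\<close> is small on the interval, then \<open>u\<close> is close to a multiple of \<open>e\<^sup>t\<^sup>q\<close>; by induction,
  a function with small \<open>diff_ops\<close> is close to an exponential sum.\<close>

lemma diff_ops_small: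
  assumes "distinct ts"
  shows "\<exists>C\<ge>0. \<forall>r e. Ck_on (length ts) {a..b} r \<longrightarrow> (\<forall>q\<in>{a..b}. cmod (diff_ops {a..b} ts r q) \<le> e) \<longrightarrow>
    (\<exists>c. \<forall>q\<in>{a..b}. cmod (r q - (\<Sum>s\<in>set ts. c s * expf s q)) \<le> C * e)"
  using assms
proof (induction ts)
  case Nil
  show ?case by (intro exI[of _ 1]) auto
next
  case (Cons t ts)
  then obtain C where C: "C \<ge> 0" "\<And>r e. Ck_on (length ts) {a..b} r \<Longrightarrow> (\<forall>q\<in>{a..b}. cmod (diff_ops {a..b} ts r q) \<le> e) \<Longrightarrow>
    (\<exists>c. \<forall>q\<in>{a..b}. cmod (r q - (\<Sum>s\<in>set ts. c s * expf s q)) \<le> C * e)" by auto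
  define M where "M = exp (\<bar>t\<bar> * (\<bar>a\<bar> + \<bar>b\<bar>))"
  have M: "cmod (expf s q) \<le> M" if "q \<in> {a..b}" "\<bar>s\<bar> = \<bar>t\<bar>" for s q
  proof -
    have "s * q \<le> \<bar>s\<bar> * \<bar>q\<bar>" by (metis abs_ge_self abs_mult)
    also have "\<dots> \<le> \<bar>t\<bar> * (\<bar>a\<bar> + \<bar>b\<bar>)"
      using that by (intro mult_mono) auto
    finally show ?thesis by (simp add: M_def)
  qed
  have "M > 0" by (simp add: M_def)
  \<comment> \<open>One factor \<open>M\<close> bounds e^(-tq) in the derivative below, the other
    bounds e^(tq) when the integrating factor is undone; b - a comes from the mean value
    inequality.\<close>
  define C1 where "C1 = M * (M * (b - a))"
  have "C1 \<ge> 0" using ab \<open>M > 0\<close> by (simp add: C1_def)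
  show ?case
  proof (intro exI[of _ "C * C1"] conjI allI impI)
    show "0 \<le> C * C1" using C \<open>C1 \<ge> 0\<close> by simp
    fix r e assume r: "Ck_on (length (t # ts)) {a..b} r" and e: "\<forall>q\<in>{a..b}. cmod (diff_ops {a..b} (t # ts) r q) \<le> e"
    define u where "u = diff_ops {a..b} ts r"
    have "u differentiable_on {a..b}"
      unfolding u_def using Ck_on_diff_ops[of ts 1 r] r by simp
    have "e \<ge> 0" using e ab by (meson atLeastAtMost_iff less_imp_le norm_ge_zero order_refl order_trans)
    \<comment> \<open>Integrating factor: the derivative of e^(-tq) u is e^(-tq) (u' - t u), which
      is small, so e^(-tq) u is nearly constant.\<close>
    have w: "((\<lambda>q. expf (- t) q * u q) has_vector_derivative expf (- t) q * (vd u q - t * u q)) (at q within {a..b})"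
      if "q \<in> {a..b}" for q
      using has_vector_derivative_mult[OF expf_deriv[of 1 "- t" q "{a..b}"] vd_works[OF \<open>u differentiable_on {a..b}\<close> that]]
      by (simp add: algebra_simps)
    have bound: "cmod (expf (- t) q * u q - expf (- t) a * u a) \<le> M * e * (b - a)" if q: "q \<in> {a..b}" for q
    proof -
      have "norm (expf (- t) q * u q - expf (- t) a * u a) \<le> M * e * norm (q - a)"
      proof (rule differentiable_bound[where S = "{a..b}" and f' = "\<lambda>q h. h *\<^sub>R (expf (- t) q * (vd u q - t * u q))"])
        fix p assume p: "p \<in> {a..b}"
        show "((\<lambda>q. expf (- t) q * u q) has_derivative (\<lambda>h. h *\<^sub>R (expf (- t) p * (vd u p - t * u p)))) (at p within {a..b})"
          using w[OF p] by (simp add: has_vector_derivative_def)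
        have "cmod (vd u p - t * u p) \<le> e" using e p by (simp add: u_def)
        then have le: "norm (expf (- t) p * (vd u p - t * u p)) \<le> M * e"
          unfolding norm_mult using M[OF p, of "- t"] \<open>M > 0\<close> by (intro mult_mono) auto
        show "onorm (\<lambda>h. h *\<^sub>R (expf (- t) p * (vd u p - t * u p))) \<le> M * e"
        proof (rule onorm_le)
          fix h :: real
          show "norm (h *\<^sub>R (expf (- t) p * (vd u p - t * u p))) \<le> M * e * norm h"
            unfolding norm_scaleR using mult_left_mono[OF le, of "\<bar>h\<bar>"] by (simp add: mult.commute)
        qed
      qed (use q ab in auto)
      also have "\<dots> \<le> M * e * (b - a)"
        using q \<open>M > 0\<close> \<open>e \<ge> 0\<close> by (intro mult_left_mono) auto
      finally show ?thesis .
    qed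
    have inv: "expf t q * expf (- t) q = 1" for q
      by (simp flip: exp_add of_real_add)
    define c0 where "c0 = expf (- t) a * u a"
    have u_bound: "cmod (u q - c0 * expf t q) \<le> C1 * e" if q: "q \<in> {a..b}" for q
    proof -
      have "u q - c0 * expf t q = (expf t q * expf (- t) q) * u q - c0 * expf t q"
        unfolding inv by simp
      also have "\<dots> = expf t q * (expf (- t) q * u q - expf (- t) a * u a)"
        by (simp add: c0_def algebra_simps)
      finally have "cmod (u q - c0 * expf t q) = cmod (expf t q) * cmod (expf (- t) q * u q - expf (- t) a * u a)"
        by (simp only: norm_mult)
      also have "\<dots> \<le> M * (M * e * (b - a))"
        using M[OF q, of t] bound[OF q] \<open>M > 0\<close> by (intro mult_mono) auto
      finally show ?thesis by (simp add: C1_def mult_ac)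
    qed
    \<comment> \<open>The remaining operators multiply e^(tq) by \<open>p\<close>, which is nonzero
      because t is not in \<open>ts\<close>. Subtracting c0 / p times e^(tq) from \<open>r\<close>
      therefore removes c0 e^(tq) from \<open>u\<close>.\<close>
    define p where "p = complex_of_real (\<Prod>s\<leftarrow>ts. t - s)"
    have "p \<noteq> 0" using Cons.prems by (auto simp: p_def prod_list_zero_iff)
    define r1 where "r1 q = r q + (- (c0 / p)) * expf t q" for q
    have ck: "Ck_on (length ts) {a..b} r" using r Ck_on_Suc_imp by simp
    have cke: "Ck_on (length ts) {a..b} (expf t)" using Ck_on_expf[of "length ts" 1 t] by simp
    have "Ck_on (length ts) {a..b} r1"
      unfolding r1_def by (rule Ck_on_lin[OF ck cke])
    moreover have "\<forall>q\<in>{a..b}. cmod (diff_ops {a..b} ts r1 q) \<le> C1 * e"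
    proof
      fix q assume q: "q \<in> {a..b}"
      have "diff_ops {a..b} ts r1 q = u q - c0 * expf t q"
        unfolding r1_def diff_ops_lin[OF ck cke q] diff_ops_expf[OF q] p_def[symmetric] u_def[symmetric]
        using \<open>p \<noteq> 0\<close> by simp
      then show "cmod (diff_ops {a..b} ts r1 q) \<le> C1 * e" using u_bound[OF q] by simp
    qed
    ultimately obtain c where c: "\<forall>q\<in>{a..b}. cmod (r1 q - (\<Sum>s\<in>set ts. c s * expf s q)) \<le> C * (C1 * e)"
      using C(2) by blast
    have "t \<notin> set ts" using Cons.prems by simp
    then have "(\<Sum>s\<in>set (t # ts). (c(t := c0 / p)) s * expf s q) = c0 / p * expf t q + (\<Sum>s\<in>set ts. c s * expf s q)" for q
      by (auto intro!: sum.cong)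
    then have "r q - (\<Sum>s\<in>set (t # ts). (c(t := c0 / p)) s * expf s q) = r1 q - (\<Sum>s\<in>set ts. c s * expf s q)" for q
      by (simp add: r1_def)
    then show "\<exists>c. \<forall>q\<in>{a..b}. cmod (r q - (\<Sum>s\<in>set (t # ts). c s * expf s q)) \<le> C * C1 * e"
      using c by (intro exI[of _ "c(t := c0 / p)"]) (simp only: mult.assoc)
  qed
qed

lemma exp_approximation:
  fixes g :: "real \<Rightarrow> complex" and N :: real
  assumes g: "continuous_on {a..b} g" and e: "e > 0"
  shows "\<exists>\<alpha> d. \<forall>q\<in>{a..b}. cmod (g q - (\<Sum>i\<le>(d :: nat). \<alpha> i * expf (N + i) q)) \<le> e"
proof -
  define M where "M = exp (\<bar>N\<bar> * (\<bar>a\<bar> + \<bar>b\<bar>))"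
  have "M > 0" by (simp add: M_def)
  have M: "exp (N * q) \<le> M" if "q \<in> {a..b}" for q
  proof -
    have "N * q \<le> \<bar>N\<bar> * \<bar>q\<bar>" by (metis abs_ge_self abs_mult)
    also have "\<dots> \<le> \<bar>N\<bar> * (\<bar>a\<bar> + \<bar>b\<bar>)" using that by (intro mult_left_mono) auto
    finally show ?thesis by (simp add: M_def)
  qed
  \<comment> \<open>Dividing by e^(Nq) before approximating by a polynomial in w = e^q makes the
    exponents start at \<open>N\<close>. The factor is restored at the end, hence the accuracy e /
    M.\<close>
  define h where "h w = g (ln w) * expf (- N) (ln w)" for w
  have ln_I: "w > 0" "ln w \<in> {a..b}" if "w \<in> {exp a..exp b}" for w
  proof -
    show "w > 0" using that less_le_trans[OF exp_gt_zero[of a], of w] by simp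
    then show "ln w \<in> {a..b}" using that by (simp add: ln_ge_iff ln_le_cancel_iff[of w "exp b", simplified])
  qed
  have "continuous_on {exp a..exp b} h"
    unfolding h_def
    by (intro continuous_intros continuous_on_compose2[OF g] continuous_on_ln) (use ln_I in force)+
  then obtain p where p: "polynomial_function p" "\<And>w. w \<in> {exp a..exp b} \<Longrightarrow> norm (h w - p w) < e / M"
    using Stone_Weierstrass_polynomial_function[of "{exp a..exp b}" h "e / M"] e \<open>M > 0\<close> by auto
  have "real_polynomial_function (\<lambda>w. Re (p w))" "real_polynomial_function (\<lambda>w. Im (p w))"
    using p(1) bounded_linear_Re bounded_linear_Im unfolding polynomial_function_def comp_def by auto
  then obtain \<alpha>1 d1 \<alpha>2 d2 where re: "(\<lambda>w. Re (p w)) = (\<lambda>w. \<Sum>i\<le>(d1 :: nat). \<alpha>1 i * w ^ i)"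
    and im: "(\<lambda>w. Im (p w)) = (\<lambda>w. \<Sum>i\<le>(d2 :: nat). \<alpha>2 i * w ^ i)"
    unfolding real_polynomial_function_iff_sum by auto
  define d where "d = max d1 d2"
  define \<alpha> where "\<alpha> i = Complex (if i \<le> d1 then \<alpha>1 i else 0) (if i \<le> d2 then \<alpha>2 i else 0)" for i
  have p_sum: "p w = (\<Sum>i\<le>d. \<alpha> i * complex_of_real (w ^ i))" for w
  proof (rule complex_eqI)
    have "(\<Sum>i\<le>d1. \<alpha>1 i * w ^ i) = (\<Sum>i\<le>d. (if i \<le> d1 then \<alpha>1 i else 0) * w ^ i)"
      by (rule sum.mono_neutral_cong_left) (auto simp: d_def)
    then show "Re (p w) = Re (\<Sum>i\<le>d. \<alpha> i * complex_of_real (w ^ i))"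
      using fun_cong[OF re, of w] by (simp add: \<alpha>_def del: of_real_power)
    have "(\<Sum>i\<le>d2. \<alpha>2 i * w ^ i) = (\<Sum>i\<le>d. (if i \<le> d2 then \<alpha>2 i else 0) * w ^ i)"
      by (rule sum.mono_neutral_cong_left) (auto simp: d_def)
    then show "Im (p w) = Im (\<Sum>i\<le>d. \<alpha> i * complex_of_real (w ^ i))"
      using fun_cong[OF im, of w] by (simp add: \<alpha>_def del: of_real_power)
  qed
  have "cmod (g q - (\<Sum>i\<le>d. \<alpha> i * expf (N + i) q)) \<le> e" if q: "q \<in> {a..b}" for q
  proof -
    have inv: "expf N q * expf (- N) q = 1"
      by (simp flip: exp_add of_real_add)
    have "expf N q * h (exp q) = (expf N q * expf (- N) q) * g q"
      by (simp add: h_def mult_ac)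
    then have "g q = expf N q * h (exp q)"
      unfolding inv by simp
    moreover have "(\<Sum>i\<le>d. \<alpha> i * expf (N + i) q) = expf N q * p (exp q)"
      unfolding p_sum sum_distrib_left
    proof (rule sum.cong[OF refl])
      fix i
      have "expf (N + real i) q = expf N q * complex_of_real (exp q ^ i)"
        by (simp add: distrib_right exp_add exp_of_nat_mult exp_of_real)
      then show "\<alpha> i * expf (N + real i) q = expf N q * (\<alpha> i * complex_of_real (exp q ^ i))"
        by (simp only: mult_ac)
    qed
    ultimately have "cmod (g q - (\<Sum>i\<le>d. \<alpha> i * expf (N + i) q)) = exp (N * q) * cmod (h (exp q) - p (exp q))"
      by (simp add: norm_mult flip: right_diff_distrib)
    also have "\<dots> \<le> M * (e / M)"
      using q M[OF q] p(2)[of "exp q"] \<open>M > 0\<close> by (intro mult_mono) auto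
    finally show ?thesis using \<open>M > 0\<close> by simp
  qed
  then show ?thesis by blast
qed

end

section \<open>The remainder formula\<close>

lemma trace_weight:
  fixes Y :: "complex^'n^'m"
  shows "trace (real_diag t ** herm_conj Y ** real_diag x ** Y) = complex_of_real (weight x t Y)"
proof -
  have diag_left: "(real_diag d ** A) $ i $ j = complex_of_real (d i) * A $ i $ j"
    for d and A :: "complex^'r^'q" and i j
    unfolding matrix_matrix_mult_def real_diag_def by (simp add: if_distrib if_distribR cong: if_cong)
  have "trace (real_diag t ** herm_conj Y ** real_diag x ** Y)
      = (\<Sum>k\<in>UNIV. (real_diag t ** (herm_conj Y ** (real_diag x ** Y))) $ k $ k)"
    by (simp add: trace_def matrix_mul_assoc)
  also have "\<dots> = (\<Sum>k\<in>UNIV. complex_of_real (t k) * (\<Sum>i\<in>UNIV. cnj (Y $ i $ k) * (complex_of_real (x i) * Y $ i $ k)))"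
    unfolding diag_left matrix_matrix_mult_def[of "herm_conj Y"] by (simp add: herm_conj_def diag_left)
  also have "\<dots> = (\<Sum>k\<in>UNIV. \<Sum>i\<in>UNIV. complex_of_real (x i * (t k * (cmod (Y $ i $ k))\<^sup>2)))"
    unfolding sum_distrib_left of_real_mult complex_norm_square
    by (simp add: mult_ac)
  also have "\<dots> = complex_of_real (weight x t Y)"
    by (subst sum.swap) (simp add: weight_def row_weight_def sum_distrib_left)
  finally show ?thesis .
qed

definition quad :: "('m::finite \<Rightarrow> real) \<Rightarrow> complex^'m \<Rightarrow> real" where
  "quad d v = (\<Sum>a\<in>UNIV. d a * (cmod (v $ a))\<^sup>2)"

lemma Re_herm_form_diag: "Re (herm_form v (real_diag d *v v)) = quad d v"
proof -
  have "(real_diag d *v v) $ i = complex_of_real (d i) * v $ i" for i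
    unfolding matrix_vector_mult_def real_diag_def by (simp add: if_distrib if_distribR cong: if_cong)
  then have "herm_form v (real_diag d *v v) = (\<Sum>i\<in>UNIV. complex_of_real (d i * (cmod (v $ i))\<^sup>2))"
    by (simp add: herm_form_def mult_ac complex_norm_square flip: of_real_power)
  then show ?thesis by (simp add: quad_def)
qed

lemma quad_mem:
  assumes "norm v = 1" "convex S" "range d \<subseteq> S"
  shows "quad d v \<in> S"
proof -
  have "(\<Sum>a\<in>UNIV. (cmod (v $ a))\<^sup>2) = (norm v)\<^sup>2"
    by (simp add: norm_vec_def L2_set_def sum_nonneg)
  then have "(\<Sum>a\<in>UNIV. (cmod (v $ a))\<^sup>2 *\<^sub>R d a) \<in> S"
    using assms by (intro convex_sum) auto
  then show ?thesis by (simp add: quad_def mult.commute)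
qed

lemma continuous_on_quad: "continuous_on S (quad d)"
  unfolding quad_def by (intro continuous_intros)

lemma (in haar) Z_unitary_eq_Zint: "Z_unitary \<mu> x t = complex_of_real (Zint t x)"
  unfolding Z_unitary_def trace_weight exp_of_real Zint_def by (rule integral_complex_of_real)

context haar_extension
begin

lemma inner_integral:
  "(LINT U|\<mu>. exp (trace (real_diag t ** herm_conj U ** herm_conj (P v) ** real_diag d ** P v ** U)) * c)
    = complex_of_real (Jint d t v) * c"
proof -
  have "trace (real_diag t ** herm_conj U ** herm_conj (P v) ** real_diag d ** P v ** U)
      = complex_of_real (weight d t (P v ** U))" for U
    unfolding trace_weight[symmetric] by (simp add: herm_conj_mult matrix_mul_assoc)
  then show ?thesis
    by (simp add: Jint_def exp_of_real)
qed

context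
  fixes x t :: "'n \<Rightarrow> real" and x0 a b :: real and xt :: "'n option \<Rightarrow> real"
  assumes inj_x: "inj x" and inj_t: "inj t" and x0: "x0 \<notin> range x"
    and xt: "xt = case_option x0 x" and ab: "a < b" and range_xt: "range xt \<subseteq> {a..b}"
begin

text \<open>The double integral of the theorem after the inner integration, with an arbitrary
  \<open>g\<close> in place of the image of f under the operators.\<close>

definition avg :: "(real \<Rightarrow> complex) \<Rightarrow> complex" where
  "avg g = (LINT v|sph. complex_of_real (Jint xt t v) * g (quad xt v))"

lemma quad_xt: "norm v = 1 \<Longrightarrow> quad xt v \<in> {a..b}"
  using range_xt by (intro quad_mem) auto

lemma avg_integrable:
  assumes g: "continuous_on {a..b} g"
  shows "integrable sph (\<lambda>v. complex_of_real (Jint xt t v) * g (quad xt v))"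
proof -
  \<comment> \<open>\<open>g\<close> is continuous on the interval only. Clamping the argument gives
    a function on the whole space that agrees with it at \<open>quad xt v\<close> for unit vectors
    v.\<close>
  have "continuous_on UNIV (\<lambda>v. g (max a (min b (quad xt v))))"
    using ab by (intro continuous_on_compose2[OF g] continuous_on_max continuous_on_min continuous_on_quad
      continuous_on_const) auto
  from measurable_compose[OF borel_measurable_sphere borel_measurable_continuous_onI[OF this]]
  have "(\<lambda>v. complex_of_real (Jint xt t v) * g (max a (min b (quad xt v)))) \<in> borel_measurable sph"
    by (intro borel_measurable_times measurable_compose[OF Jint_measurable] borel_measurable_of_real) simp_all
  then have meas: "(\<lambda>v. complex_of_real (Jint xt t v) * g (quad xt v)) \<in> borel_measurable sph"
    by (rule measurable_cong[THEN iffD1, rotated]) (use quad_xt in \<open>force simp: max_def min_def\<close>)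
  obtain C where C: "\<And>v. norm v = 1 \<Longrightarrow> \<bar>Jint xt t v\<bar> \<le> C" using Jint_bounded by blast
  obtain M where M: "\<And>q. q \<in> {a..b} \<Longrightarrow> cmod (g q) \<le> M"
    using compact_imp_bounded[OF compact_continuous_image[OF g compact_Icc]] by (fastforce simp: bounded_iff)
  have "AE v in sph. cmod (complex_of_real (Jint xt t v) * g (quad xt v)) \<le> C * M"
  proof (rule AE_I2)
    fix v :: "complex^('n option)" assume "v \<in> space sph"
    then have v: "norm v = 1" by simp
    show "cmod (complex_of_real (Jint xt t v) * g (quad xt v)) \<le> C * M"
      unfolding norm_mult norm_of_real
      by (rule mult_mono[OF C[OF v] M[OF quad_xt[OF v]]]) (use C[OF v] in auto)
  qed
  then show ?thesis by (rule sph.integrable_const_bound[OF _ meas])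
qed

lemma avg_lin:
  assumes "continuous_on {a..b} f" "continuous_on {a..b} g" "\<And>q. q \<in> {a..b} \<Longrightarrow> h q = f q + c * g q"
  shows "avg h = avg f + c * avg g"
proof -
  have "avg h = (LINT v|sph. complex_of_real (Jint xt t v) * f (quad xt v)
      + c * (complex_of_real (Jint xt t v) * g (quad xt v)))"
    unfolding avg_def
    by (rule Bochner_Integration.integral_cong) (use assms(3) quad_xt in \<open>auto simp: algebra_simps\<close>)
  also have "\<dots> = avg f + c * avg g"
    unfolding avg_def using avg_integrable[OF assms(1)] avg_integrable[OF assms(2)] by simp
  finally show ?thesis .
qed

lemma avg_bound:
  obtains C where "C \<ge> 0"
    "\<And>g e. continuous_on {a..b} g \<Longrightarrow> (\<And>q. q \<in> {a..b} \<Longrightarrow> cmod (g q) \<le> e) \<Longrightarrow> cmod (avg g) \<le> C * e"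
proof -
  obtain C where C: "\<And>v. norm v = 1 \<Longrightarrow> \<bar>Jint xt t v\<bar> \<le> C" using Jint_bounded by blast
  obtain v :: "complex^('n option)" where "norm v = 1" using vector_choose_size[of 1] by (metis zero_le_one)
  then have C0: "C \<ge> 0" using C[of v] by simp
  show thesis
  proof (rule that[OF C0])
    fix g :: "real \<Rightarrow> complex" and e
    assume g: "continuous_on {a..b} g" and e: "\<And>q. q \<in> {a..b} \<Longrightarrow> cmod (g q) \<le> e"
    have "cmod (avg g) \<le> (LINT v|sph. cmod (complex_of_real (Jint xt t v) * g (quad xt v)))"
      unfolding avg_def by (rule integral_norm_bound)
    also have "\<dots> \<le> C * e"
    proof (rule sph.integral_le_const[OF integrable_norm[OF avg_integrable[OF g]]], rule AE_I2)
      fix v :: "complex^('n option)" assume "v \<in> space sph"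
      then have v: "norm v = 1" by simp
      show "cmod (complex_of_real (Jint xt t v) * g (quad xt v)) \<le> C * e"
        unfolding norm_mult norm_of_real by (rule mult_mono[OF C[OF v] e[OF quad_xt[OF v]] C0]) simp
    qed
    finally show "cmod (avg g) \<le> C * e" .
  qed
qed

lemma remainder_expf:
  assumes s: "\<And>k. t k < s"
  shows "expf s x0 - exp_interpolant x t (expf s) x0 =
    complex_of_real ((\<Prod>k\<in>UNIV. x0 - x k) / (fact CARD('n) * Zint t x) * (\<Prod>k\<in>UNIV. s - t k)) * avg (expf s)"
proof -
  define tt where "tt = case_option s t"
  have "inj tt"
    using inj_t s unfolding inj_on_def tt_def by (fastforce split: option.splits)
  moreover have "inj_on xt (- {None})"
    using inj_x unfolding inj_on_def xt by (auto split: option.splits)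
  ultimately obtain \<beta> where
    \<beta>: "\<And>h. (\<Prod>c\<in>- {None}. h - xt c) * ext.Zint tt (xt(None := h)) = (\<Sum>j\<in>UNIV. \<beta> j * exp (tt j * h))"
    using ext.Zint_exp_sum by blast
  define F where "F h = (\<Prod>k\<in>UNIV. h - x k) * ext.Zint tt (case_option h x)" for h
  have F: "F h = \<beta> None * exp (s * h) + (\<Sum>k\<in>UNIV. \<beta> (Some k) * exp (t k * h))" for h
  proof -
    have "xt(None := h) = case_option h x" by (auto simp: xt split: option.splits)
    moreover have "(\<Prod>c\<in>- {None}. h - xt c) = (\<Prod>k\<in>UNIV. h - x k)"
    proof -
      have "- {None :: 'n option} = range Some"
      proof (rule set_eqI)
        fix c :: "'n option"
        show "c \<in> - {None} \<longleftrightarrow> c \<in> range Some" by (cases c) auto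
      qed
      then show ?thesis by (simp add: prod.reindex xt)
    qed
    ultimately show ?thesis using \<beta>[of h] by (simp add: F_def sum_option tt_def)
  qed
  define B where "B = \<beta> None"
  \<comment> \<open>After division by e^(sh) only the term of exponent \<open>s\<close> survives as
    h tends to infinity; \<open>Zint_laplace\<close> evaluates the same limit.\<close>
  have "((\<lambda>h. B + (\<Sum>k\<in>UNIV. \<beta> (Some k) * exp ((t k - s) * h))) \<longlongrightarrow> B + (\<Sum>k\<in>UNIV. \<beta> (Some k) * 0)) at_top"
  proof (intro tendsto_intros)
    fix k
    show "((\<lambda>h. exp ((t k - s) * h)) \<longlongrightarrow> 0) at_top" using s[of k] by real_asymp
  qed
  moreover have "B + (\<Sum>k\<in>UNIV. \<beta> (Some k) * exp ((t k - s) * h))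
      = (\<Prod>k\<in>UNIV. h - x k) * exp (- s * h) * ext.Zint (case_option s t) (case_option h x)" for h
  proof -
    have "exp (- s * h) * F h = B + (\<Sum>k\<in>UNIV. \<beta> (Some k) * exp ((t k - s) * h))"
      unfolding F B_def distrib_left sum_distrib_left
      by (simp add: left_diff_distrib exp_diff exp_minus field_simps)
    then show ?thesis unfolding F_def tt_def by (simp add: mult_ac)
  qed
  ultimately have "((\<lambda>h. (\<Prod>k\<in>UNIV. h - x k) * exp (- s * h) * ext.Zint (case_option s t) (case_option h x)) \<longlongrightarrow> B) at_top"
    by simp
  from tendsto_unique[OF _ this Zint_laplace[OF s]]
  have B: "B = fact CARD('n) * Zint t x / (\<Prod>k\<in>UNIV. s - t k)" by simp
  have "(\<Prod>k\<in>UNIV. s - t k) > 0" using s by (intro prod_pos) auto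
  then have B0: "B > 0" unfolding B using Zint_pos[of t x] by simp
  have es: "exp_sum t (\<lambda>k. complex_of_real (- \<beta> (Some k) / B)) y
      = complex_of_real (exp (s * y) - F y / B)" for y
  proof -
    have "exp (s * y) - F y / B = (\<Sum>k\<in>UNIV. - \<beta> (Some k) / B * exp (t k * y))"
      using B0 by (simp add: F B_def add_divide_distrib sum_divide_distrib sum_negf)
    then show ?thesis by (simp add: exp_sum_def exp_of_real del: of_real_mult flip: of_real_mult)
  qed
  \<comment> \<open>Since F vanishes at the nodes, e^(sy) - F(y) / B agrees with e^(sy) there. It is
    an exponential sum in the \<open>t k\<close> alone, hence the interpolant.\<close>
  have "F (x m) = 0" for m by (auto simp: F_def)
  then have "exp_interpolant x t (expf s) = exp_sum t (\<lambda>k. complex_of_real (- \<beta> (Some k) / B))"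
    by (intro exp_interpolant_eqI[OF inj_x inj_t]) (simp only: es exp_of_real, simp)
  then have "expf s x0 - exp_interpolant x t (expf s) x0 = complex_of_real (F x0 / B)"
    by (simp only: es exp_of_real) simp
  \<comment> \<open>Here the rows carry the points \<open>xt\<close> and the columns the exponents,
    so the column \<open>None\<close>, which is v, contributes e^(s q) at q =
    \<open>quad xt v\<close>.\<close>
  moreover have "avg (expf s) = complex_of_real (ext.Zint tt xt)"
  proof -
    have "ext.Zint tt xt = (LINT v|sph. LINT U|\<mu>. exp (weight xt tt (frame (v, U))))"
      unfolding ext.Zint_def by (rule integral_ext_haar) (intro continuous_intros)
    also have "\<dots> = (LINT v|sph. Jint xt t v * exp (s * quad xt v))"
      by (simp add: tt_def weight_frame exp_add Jint_def quad_def mult.commute)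
    finally show ?thesis
      by (simp add: avg_def exp_of_real flip: of_real_mult)
  qed
  ultimately show ?thesis
    by (simp add: F_def xt B field_simps)
qed

section \<open>The error functional: linear, zero on exponentials, bounded by the operator
  image\<close>

context
  fixes ts :: "real list"
  assumes ts: "distinct ts" "set ts = range t"
begin

definition err :: "(real \<Rightarrow> complex) \<Rightarrow> complex" where
  "err f = f x0 - exp_interpolant x t f x0
    - complex_of_real ((\<Prod>k\<in>UNIV. x0 - x k) / (fact CARD('n) * Zint t x)) * avg (diff_ops {a..b} ts f)"

lemma diff_ops_continuous: "Ck_on (length ts) {a..b} f \<Longrightarrow> continuous_on {a..b} (diff_ops {a..b} ts f)"
  using Ck_on_diff_ops[OF ab, of ts 0 f] by simp

lemma err_lin:
  assumes "Ck_on (length ts) {a..b} f" "Ck_on (length ts) {a..b} g"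
  shows "err (\<lambda>q. f q + c * g q) = err f + c * err g"
proof -
  have "avg (diff_ops {a..b} ts (\<lambda>q. f q + c * g q)) = avg (diff_ops {a..b} ts f) + c * avg (diff_ops {a..b} ts g)"
    using assms by (intro avg_lin diff_ops_continuous diff_ops_lin[OF ab])
  then show ?thesis
    unfolding err_def exp_interpolant_linear[OF inj_x inj_t] by (simp add: algebra_simps)
qed

lemma err_expf:
  assumes s: "\<And>k. t k < s"
  shows "err (expf s) = 0"
proof -
  have "avg (diff_ops {a..b} ts (expf s)) = 0 + complex_of_real (\<Prod>t\<leftarrow>ts. s - t) * avg (expf s)"
    using avg_lin[of "\<lambda>_. 0" "expf s" "diff_ops {a..b} ts (expf s)"] diff_ops_expf[OF ab]
    by (simp add: continuous_intros avg_def)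
  moreover have "(\<Prod>t\<leftarrow>ts. s - t) = (\<Prod>k\<in>UNIV. s - t k)"
    using ts inj_t by (simp add: prod.reindex flip: prod.distinct_set_conv_list)
  ultimately show ?thesis
    unfolding err_def remainder_expf[OF s] by simp
qed

text \<open>The interpolation error sees \<open>r\<close> only modulo exponential sums with
  exponents \<open>t k\<close>. By \<open>diff_ops_small\<close> one of them is uniformly close to
  \<open>r\<close>, and \<open>exp_interpolant_bound\<close> controls the interpolant of the
  difference. The integral term is controlled by the operator image directly.\<close>

lemma err_bound:
  obtains K where "K \<ge> 0"
    "\<And>r e. Ck_on (length ts) {a..b} r \<Longrightarrow> (\<And>q. q \<in> {a..b} \<Longrightarrow> cmod (diff_ops {a..b} ts r q) \<le> e) \<Longrightarrow> cmod (err r) \<le> K * e"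
proof -
  define c where "c = complex_of_real ((\<Prod>k\<in>UNIV. x0 - x k) / (fact CARD('n) * Zint t x))"
  obtain CI where CI: "CI \<ge> 0" "\<And>f e. (\<And>m. cmod (f (x m)) \<le> e) \<Longrightarrow> cmod (exp_interpolant x t f x0) \<le> CI * e"
    proof (rule exp_interpolant_bound[OF inj_x inj_t, of x0])
    fix CI assume "0 \<le> CI" "\<And>f e. (\<And>m. cmod (f (x m)) \<le> e) \<Longrightarrow> cmod (exp_interpolant x t f x0) \<le> CI * e"
    then show thesis by (rule that)
  qed
  obtain CE where CE: "CE \<ge> 0" "\<And>g e. continuous_on {a..b} g \<Longrightarrow> (\<And>q. q \<in> {a..b} \<Longrightarrow> cmod (g q) \<le> e) \<Longrightarrow> cmod (avg g) \<le> CE * e"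
    proof (rule avg_bound)
    fix CE assume "0 \<le> CE" "\<And>g e. continuous_on {a..b} g \<Longrightarrow> (\<And>q. q \<in> {a..b} \<Longrightarrow> cmod (g q) \<le> e) \<Longrightarrow> cmod (avg g) \<le> CE * e"
    then show thesis by (rule that)
  qed
  obtain C where C: "C \<ge> 0" "\<And>r e. Ck_on (length ts) {a..b} r \<Longrightarrow> (\<forall>q\<in>{a..b}. cmod (diff_ops {a..b} ts r q) \<le> e) \<Longrightarrow>
    (\<exists>c. \<forall>q\<in>{a..b}. cmod (r q - (\<Sum>s\<in>set ts. c s * expf s q)) \<le> C * e)"
    using diff_ops_small[OF ab ts(1)] by blast
  show thesis
  proof
    show "0 \<le> C + CI * C + cmod c * CE" using C(1) CI(1) CE(1) by simp
    fix r e assume r: "Ck_on (length ts) {a..b} r" and e: "\<And>q. q \<in> {a..b} \<Longrightarrow> cmod (diff_ops {a..b} ts r q) \<le> e"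
    obtain d where d: "\<forall>q\<in>{a..b}. cmod (r q - (\<Sum>s\<in>set ts. d s * expf s q)) \<le> C * e"
      using C(2)[OF r] e by blast
    define w where "w = exp_sum t (\<lambda>k. d (t k))"
    have w: "w q = (\<Sum>s\<in>set ts. d s * expf s q)" for q
      using inj_t by (simp add: w_def exp_sum_def ts(2) sum.reindex)
    have dw: "cmod (r q + (- 1) * w q) \<le> C * e" if "q \<in> range xt" for q
      using d that range_xt by (auto simp: w)
    have node: "x m \<in> range xt" "x0 \<in> range xt" for m
      using rangeI[of xt "Some m"] rangeI[of xt None] by (simp_all add: xt)
    have "exp_interpolant x t (\<lambda>q. r q + (- 1) * w q) x0 = exp_interpolant x t r x0 + (- 1) * w x0"
      unfolding exp_interpolant_linear[OF inj_x inj_t] unfolding w_def exp_interpolant_exp_sum[OF inj_x inj_t] ..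
    then have "err r = (r x0 + (- 1) * w x0) - exp_interpolant x t (\<lambda>q. r q + (- 1) * w q) x0 - c * avg (diff_ops {a..b} ts r)"
      by (simp add: err_def c_def)
    also have "cmod \<dots> \<le> cmod (r x0 + (- 1) * w x0) + cmod (exp_interpolant x t (\<lambda>q. r q + (- 1) * w q) x0)
        + cmod (c * avg (diff_ops {a..b} ts r))"
      by (intro order_trans[OF norm_triangle_ineq4] add_mono order_refl)
    also have "\<dots> \<le> C * e + CI * (C * e) + cmod c * (CE * e)"
      unfolding norm_mult[of c] using node
      by (intro add_mono mult_left_mono dw CI(2) CE(2) diff_ops_continuous r e) auto
    finally show "cmod (err r) \<le> (C + CI * C + cmod c * CE) * e" by (simp add: algebra_simps)
  qed
qed

lemma err_zero:
  assumes f: "Ck_on (length ts) {a..b} f"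
  shows "err f = 0"
proof -
  obtain K where K: "K \<ge> 0"
    "\<And>r e. Ck_on (length ts) {a..b} r \<Longrightarrow> (\<And>q. q \<in> {a..b} \<Longrightarrow> cmod (diff_ops {a..b} ts r q) \<le> e) \<Longrightarrow> cmod (err r) \<le> K * e"
    proof (rule err_bound)
    fix K assume "0 \<le> K" "\<And>r e. Ck_on (length ts) {a..b} r \<Longrightarrow> (\<And>q. q \<in> {a..b} \<Longrightarrow> cmod (diff_ops {a..b} ts r q) \<le> e) \<Longrightarrow> cmod (err r) \<le> K * e"
    then show thesis by (rule that)
  qed
  \<comment> \<open>All exponents N + i exceed every \<open>t k\<close>. Hence
    \<open>err_expf\<close> applies to them and the eigenvalues \<open>p i\<close> are
    nonzero.\<close>
  define N where "N = 1 + (\<Sum>k\<in>UNIV. \<bar>t k\<bar>)"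
  have N: "t k < N + real i" for k i
    using member_le_sum[of k UNIV "\<lambda>k. \<bar>t k\<bar>"] by (simp add: N_def)
  define p where "p i = complex_of_real (\<Prod>s\<leftarrow>ts. N + real i - s)" for i
  have p: "p i \<noteq> 0" for i
    using N[of _ i] ts(2) unfolding p_def of_real_eq_0_iff prod_list_zero_iff by fastforce
  have small: "cmod (err f) \<le> K * e" if e: "e > 0" for e
  proof -
    obtain \<alpha> d where \<alpha>: "\<forall>q\<in>{a..b}. cmod (diff_ops {a..b} ts f q - (\<Sum>i\<le>(d::nat). \<alpha> i * expf (N + i) q)) \<le> e"
      using exp_approximation[OF ab diff_ops_continuous[OF f] e] by blast
    \<comment> \<open>Dividing by the eigenvalues \<open>p i\<close> makes the operators map
      \<open>A J\<close> to the approximating exponential sum itself, so f - A has a small image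
      while \<open>err\<close> vanishes on \<open>A\<close>.\<close>
    define A where "A J q = (\<Sum>i\<in>J. \<alpha> i / p i * expf (N + real i) q)" for J q
    have zero: "Ck_on (length ts) {a..b} (\<lambda>q. 0)"
      using Ck_on_expf[OF ab, of "length ts" 0 0] by simp
    have cke: "Ck_on (length ts) {a..b} (expf s)" for s
      using Ck_on_expf[OF ab, of "length ts" 1 s] by simp
    have A: "Ck_on (length ts) {a..b} (A J) \<and> err (A J) = 0 \<and>
        (\<forall>q\<in>{a..b}. diff_ops {a..b} ts (A J) q = (\<Sum>i\<in>J. \<alpha> i * expf (N + real i) q))" if "finite J" for J
      using that
    proof (induction J)
      case empty
      have "A {} = (\<lambda>q. 0)" by (simp add: A_def fun_eq_iff)
      then show ?case using zero err_lin[OF zero zero, of 1] diff_ops_lin[OF ab zero zero, of _ 1] by simp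
    next
      case (insert j J)
      have eq: "A (insert j J) = (\<lambda>q. A J q + \<alpha> j / p j * expf (N + real j) q)"
        using insert.hyps by (simp add: A_def fun_eq_iff add.commute)
      have IH: "Ck_on (length ts) {a..b} (A J)" "err (A J) = 0"
        "\<And>q. q \<in> {a..b} \<Longrightarrow> diff_ops {a..b} ts (A J) q = (\<Sum>i\<in>J. \<alpha> i * expf (N + real i) q)"
        using insert.IH by blast+
      show ?case
        unfolding eq
      proof (intro conjI ballI)
        show "Ck_on (length ts) {a..b} (\<lambda>q. A J q + \<alpha> j / p j * expf (N + real j) q)"
          by (rule Ck_on_lin[OF ab IH(1) cke])
        show "err (\<lambda>q. A J q + \<alpha> j / p j * expf (N + real j) q) = 0"
          unfolding err_lin[OF IH(1) cke] err_expf[OF N] IH(2) by simp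
        fix q assume q: "q \<in> {a..b}"
        have "diff_ops {a..b} ts (\<lambda>q. A J q + \<alpha> j / p j * expf (N + real j) q) q
            = (\<Sum>i\<in>J. \<alpha> i * expf (N + real i) q) + \<alpha> j / p j * (p j * expf (N + real j) q)"
          unfolding diff_ops_lin[OF ab IH(1) cke q] diff_ops_expf[OF ab q] p_def[symmetric] IH(3)[OF q] ..
        also have "\<dots> = (\<Sum>i\<in>insert j J. \<alpha> i * expf (N + real i) q)"
          using insert.hyps p[of j] by simp
        finally show "diff_ops {a..b} ts (\<lambda>q. A J q + \<alpha> j / p j * expf (N + real j) q) q
            = (\<Sum>i\<in>insert j J. \<alpha> i * expf (N + real i) q)" .
      qed
    qed
    have AJ: "Ck_on (length ts) {a..b} (A {..d})" "err (A {..d}) = 0"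
      "\<And>q. q \<in> {a..b} \<Longrightarrow> diff_ops {a..b} ts (A {..d}) q = (\<Sum>i\<le>d. \<alpha> i * expf (N + real i) q)"
      using A[of "{..d}"] by auto
    have "cmod (err (\<lambda>q. f q + (- 1) * A {..d} q)) \<le> K * e"
    proof (rule K(2)[OF Ck_on_lin[OF ab f AJ(1)]])
      fix q assume "q \<in> {a..b}"
      then show "cmod (diff_ops {a..b} ts (\<lambda>q. f q + (- 1) * A {..d} q) q) \<le> e"
        unfolding diff_ops_lin[OF ab f AJ(1) \<open>q \<in> {a..b}\<close>] using \<alpha> AJ(3) by simp
    qed
    then show ?thesis unfolding err_lin[OF f AJ(1)] AJ(2) by simp
  qed
  have "cmod (err f) \<le> 0 + e" if "e > 0" for e
    using small[of "e / (K + 1)"] that K(1) mult_right_mono[of K "K + 1" "e / (K + 1)"] by simp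
  then have "cmod (err f) \<le> 0" by (rule field_le_epsilon)
  then show ?thesis by simp
qed

end

end

end

text \<open>The list \<open>ks\<close> only fixes an order of composition, as
  \<open>diff_ops\<close> takes a list; every enumeration is allowed. The quadratic form has real
  values, and \<open>Re\<close> adjusts the type.\<close>

theorem theorem1:
  fixes x t :: "'n::finite \<Rightarrow> real"
    and x0 :: real
    and xt :: "'n option \<Rightarrow> real"
    and S :: "real set"
    and f :: "real \<Rightarrow> complex"
    and \<mu> :: "(complex^'n^'n) measure"
    and P :: "complex^('n option) \<Rightarrow> complex^'n^('n option)"
    and ks :: "'n list"
  assumes "inj x" and "inj t"
    and xt: "xt = case_option x0 x"
    and S: "S = convex hull (range xt)"
    and f: "Ck_on CARD('n) S f"
    and haar: "unitary_haar \<mu>"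
    and P_meas: "P \<in> borel_measurable sphere_measure"
    and P_isom: "\<And>v. norm v = 1 \<Longrightarrow> isometry_onto_compl v (P v)"
    and ks: "distinct ks" "set ks = UNIV"
  shows "f x0 - exp_interpolant x t f x0 =
    complex_of_real (\<Prod>k\<in>UNIV. x0 - x k) / (fact CARD('n) * Z_unitary \<mu> x t) *
    (LINT v|sphere_measure. LINT U|\<mu>.
       exp (trace (real_diag t ** herm_conj U ** herm_conj (P v) ** real_diag xt ** P v ** U)) *
       diff_ops S (map t ks) f (Re (herm_form v (real_diag xt *v v))))"
proof -
  interpret haar_extension \<mu> P
    by unfold_locales (use haar P_meas P_isom in auto)
  let ?D = "diff_ops S (map t ks) f"
  have rhs: "(LINT v|sphere_measure. LINT U|\<mu>.
       exp (trace (real_diag t ** herm_conj U ** herm_conj (P v) ** real_diag xt ** P v ** U)) *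
       ?D (Re (herm_form v (real_diag xt *v v))))
    = (LINT v|sph. complex_of_real (Jint xt t v) * ?D (quad xt v))"
    unfolding inner_integral Re_herm_form_diag ..
  show ?thesis
  proof (cases "x0 \<in> range x")
    \<comment> \<open>At a node both sides vanish. This also disposes of a single node equal to
      \<open>x0\<close>, for which the hull is one point and derivatives are unspecified.\<close>
    case True
    then obtain m where m: "x0 = x m" by auto
    then have "(\<Prod>k\<in>UNIV. x0 - x k) = 0" by auto
    then show ?thesis
      unfolding m exp_interpolant_node[OF assms(1,2)] by simp
  next
    case False
    define a where "a = Min (range xt)"
    define b where "b = Max (range xt)"
    have ab_mem: "a \<in> range xt" "b \<in> range xt"
      unfolding a_def b_def by (intro Min_in Max_in; simp)+
    have range_xt: "range xt \<subseteq> {a..b}"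
      by (auto simp: a_def b_def)
    \<comment> \<open>This merely names an index: types are nonempty, so there is a node, and it
      differs from \<open>x0\<close>.\<close>
    obtain k :: 'n where "True" by simp
    have "xt None \<noteq> xt (Some k)" using False by (auto simp: xt)
    moreover have "xt None \<in> {a..b}" "xt (Some k) \<in> {a..b}" using range_xt by blast+
    ultimately have ab: "a < b" by auto
    have S_eq: "S = {a..b}"
    proof
      show "S \<subseteq> {a..b}" unfolding S by (intro hull_minimal range_xt) simp
      have "closed_segment a b \<subseteq> S"
        unfolding S by (intro closed_segment_subset_convex_hull hull_inc ab_mem)
      then show "{a..b} \<subseteq> S" using ab by (simp add: closed_segment_eq_real_ivl)
    qed
    have ts: "distinct (map t ks)" "set (map t ks) = range t"
      using ks \<open>inj t\<close> by (auto simp: distinct_map intro: inj_on_subset)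
    have "length (map t ks) = CARD('n)"
      using distinct_card[OF ks(1)] ks(2) by simp
    then have "Ck_on (length (map t ks)) {a..b} f"
      using f S_eq by simp
    note err_zero[OF \<open>inj x\<close> \<open>inj t\<close> False xt ab range_xt ts this]
    then have "f x0 - exp_interpolant x t f x0
      = complex_of_real ((\<Prod>k\<in>UNIV. x0 - x k) / (fact CARD('n) * Zint t x)) *
        (LINT v|sph. complex_of_real (Jint xt t v) * ?D (quad xt v))"
      unfolding err_def[OF \<open>inj x\<close> \<open>inj t\<close> False xt ab range_xt ts]
        avg_def[OF \<open>inj x\<close> \<open>inj t\<close> False xt ab range_xt] S_eq
      by simp
    then show ?thesis
      unfolding rhs Z_unitary_eq_Zint by simp
  qed
qed

end
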